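(* Consider the generalized join the shortest orbit queue system with parameters $\lambda_0,\lambda_1,\lambda_2,\mu,\alpha_1,\alpha_2>0$, $\lambda=\lambda_0+\lambda_1+\lambda_2$, normalized so that $\lambda+\mu+\alpha_1+\alpha_2=1$, and let $\{(N_{1,n},N_{2,n},C_n);n\ge 0\}$ be its uniformized discrete-time Markov chain (described in the context), assumed positive recurrent. Put $\widehat{\lambda}=\lambda(\lambda+\alpha_1+\alpha_2)$, $\widehat{\lambda}_k=\lambda_k(\lambda+\alpha_1+\alpha_2)$ for $k=0,1,2$, $\widehat{\mu}_k=\mu\alpha_k$ for $k=1,2$, $\rho_k=\widehat{\lambda}_k/\widehat{\mu}_k$ for $k=1,2$, $\rho=\widehat{\lambda}/(\widehat{\mu}_1+\widehat{\mu}_2)$, $\gamma_1=\widehat{\mu}_1\rho^2+\widehat{\lambda}_2$, $\gamma_2=\widehat{\mu}_2\rho^2+\widehat{\lambda}_1$. For $m\ge 0$, $l\in\mathbb{Z}$, $k\in\{0,1\}$ let $$\pi_{m,l}(k)=\lim_{n\to\infty}\mathbb{P}\big(\min\{N_{1,n},N_{2,n}\}=m,\;N_{2,n}-N_{1,n}=l,\;C_n=k\big).$$ Suppose that $\max\{\rho_1,\rho_2\}<\rho<1$ and $\widehat{\lambda}_0>|\widehat{\lambda}_2-\widehat{\lambda}_1+\rho^2(\widehat{\mu}_1-\widehat{\mu}_2)|$. Then, for every $l\in\mathbb{Z}$, as $m\to\infty$, $$\rho^{-2m}\pi_{m,l}(0)\sim\frac{\mu}{\lambda+\alpha_1+\alpha_2}\,x_l(\rho^{-2}),$$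 where $x_l(\rho^{-2})=\lim_{m\to\infty}\rho^{-2m}\pi_{m,l}(1)$, which is given, with a constant $x_0>0$, by $$x_l(\rho^{-2})=\begin{cases}\dfrac{\gamma_2+\widehat{\lambda}_0/2}{\gamma_2}\,x_0\left(\rho\,\dfrac{\gamma_2}{\gamma_1+\widehat{\lambda}_0}\right)^{|l|}, & l\le -1,\\[2mm] x_0, & l=0,\\[1mm] \dfrac{\gamma_1+\widehat{\lambda}_0/2}{\gamma_1}\,x_0\left(\rho\,\dfrac{\gamma_1}{\gamma_2+\widehat{\lambda}_0}\right)^{l}, & l\ge 1.\end{cases}$$
   Context: The system: a single server that holds at most one job, with exponential($\mu$) service times, is fed by three independent Poisson streams: a smart stream (rate $\lambda_0$) and two dedicated streams (rates $\lambda_1,\lambda_2$). A job finding the server idle starts service at once. If the server is busy, a job of dedicated stream $k\in\{1,2\}$ joins orbit queue $k$, and a smart job joins the shorter orbit queue (each with probability $1/2$ in case of a tie). When nonempty, orbit queue $k$ sends retrials at rate $\alpha_k$ (constant retrial policy); a retrial succeeds if and only if the server is idle. $N_k$ is the number of jobs in orbit $k$, and $C\in\{0,1\}$ is the server state ($1$ = busy, $0$ = idle). Uniformized chain on $\mathbb{N}_0\times\mathbb{N}_0\times\{0,1\}$ (with $\lambda+\mu+\alpha_1+\alpha_2=1$): - From $(i,j,0)$: to $(i,j,1)$ with probability $\lambda$; to $(i-1,j,1)$ with probability $\alpha_1$ if $i>0$; to $(i,j-1,1)$ with probability $\alpha_2$ if $j>0$; it stays put with the remaining probability. - From $(i,j,1)$: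 to $(i,j,0)$ with probability $\mu$; to $(i+1,j,1)$ with probability $\lambda_1+\lambda_0h(j-i)$; to $(i,j+1,1)$ with probability $\lambda_2+\lambda_0h(i-j)$; it stays put with probability $\alpha_1+\alpha_2$. Here $h(n)=1$ for $n\geq 1$, $h(0)=1/2$, and $h(n)=0$ for $n\leq -1$. Here $a_m\sim b$ (with $b\neq0$) means $a_m\to b$ as $m\to\infty$. *)

theory Defs
  imports "HOL-Probability.Probability"
begin

definition markov_chain ::
  "'w measure \<Rightarrow> ('s \<Rightarrow> 's \<Rightarrow> real) \<Rightarrow> (nat \<Rightarrow> 'w \<Rightarrow> 's) \<Rightarrow> bool" where
  "markov_chain M p X \<longleftrightarrow>
     prob_space M \<and>
     (\<forall>n. X n \<in> measurable M (count_space UNIV)) \<and>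
     (\<forall>n s. measure M {\<omega> \<in> space M. \<forall>k\<le>Suc n. X k \<omega> = s k} =
            measure M {\<omega> \<in> space M. \<forall>k\<le>n. X k \<omega> = s k} * p (s n) (s (Suc n)))"

text \<open>
  The probability that the chain with transition probabilities \<open>p\<close>, started in \<open>x\<close>, visits \<open>y\<close>
  at time \<open>n\<close> for the first time after time 0 (so for \<open>x = y\<close> it is the law of the return time).
\<close>

fun first_passage :: "('s \<Rightarrow> 's \<Rightarrow> real) \<Rightarrow> nat \<Rightarrow> 's \<Rightarrow> 's \<Rightarrow> real" where
  "first_passage p 0 x y = 0"
| "first_passage p (Suc 0) x y = p x y"
| "first_passage p (Suc (Suc n)) x y =
     (\<Sum>\<^sub>\<infinity>z\<in>- {y}. p x z * first_passage p (Suc n) z y)"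

text \<open>Every state is recurrent and has finite mean return time.\<close>

definition positive_recurrent :: "('s \<Rightarrow> 's \<Rightarrow> real) \<Rightarrow> bool" where
  "positive_recurrent p \<longleftrightarrow>
     (\<forall>x. (\<lambda>n. first_passage p n x x) sums 1 \<and>
          summable (\<lambda>n. real n * first_passage p n x x))"

definition h :: "int \<Rightarrow> real" where
  "h n = (if n \<ge> 1 then 1 else if n = 0 then 1/2 else 0)"

text \<open>
  A state is \<open>(i, j, c)\<close> with orbit lengths \<open>i\<close>, \<open>j\<close> and server state \<open>c\<close>, where \<open>True\<close> stands for
  busy (\<open>C = 1\<close>) and \<open>False\<close> for idle (\<open>C = 0\<close>).  The targets of the different summands are distinct
  states, and the last summand of each equation is the probability of staying put.
\<close>

fun gjsoq_trans ::
  "real \<Rightarrow> real \<Rightarrow> real \<Rightarrow> real \<Rightarrow> real \<Rightarrow> real \<Rightarrow> nat \<times> nat \<times> bool \<Rightarrow> nat \<times> nat \<times> bool \<Rightarrow> real" where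
  "gjsoq_trans lam0 lam1 lam2 \<mu> \<alpha>1 \<alpha>2 (i, j, False) t =
     (lam0 + lam1 + lam2) * of_bool (t = (i, j, True))
     + \<alpha>1 * of_bool (i > 0 \<and> t = (i - 1, j, True))
     + \<alpha>2 * of_bool (j > 0 \<and> t = (i, j - 1, True))
     + (1 - (lam0 + lam1 + lam2) - \<alpha>1 * of_bool (i > 0) - \<alpha>2 * of_bool (j > 0))
         * of_bool (t = (i, j, False))"
| "gjsoq_trans lam0 lam1 lam2 \<mu> \<alpha>1 \<alpha>2 (i, j, True) t =
     \<mu> * of_bool (t = (i, j, False))
     + (lam1 + lam0 * h (int j - int i)) * of_bool (t = (i + 1, j, True))
     + (lam2 + lam0 * h (int i - int j)) * of_bool (t = (i, j + 1, True))
     + (\<alpha>1 + \<alpha>2) * of_bool (t = (i, j, True))"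

end

theory Submission
  imports Defs
begin

text \<open>
  The balance equations of the idle states express $\pi_{m,l}(0)$ through $\pi_{m,l}(1)$, so the busy
  part \<open>q\<close> of the stationary distribution is an invariant measure of a join-the-shortest-queue walk
  on $\mathbb{N}^2$. In the interior the function $\rho^{-(i+j)}$ is harmonic for this walk. After the
  corresponding change of measure, \<open>\<nu>(i, j) = \<rho>\<^bsup>-(i+j)\<^esup> q(i, j)\<close> is invariant for a walk that drifts
  to infinity along the diagonal, whose difference coordinate \<open>l = j - i\<close> is a positive recurrent
  birth and death chain with stationary weights \<open>\<eta>\<^sub>l\<close>. The claim is that \<open>\<nu> / \<eta>\<close> converges to a
  constant.

  By a Foster--Lyapunov argument, which uses \<open>\<rho>\<^sub>1, \<rho>\<^sub>2 < \<rho>\<close>, \<open>\<nu>\<close> is summable over the two axes; since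
  the cut equation at total orbit size \<open>n\<close> makes the \<open>\<nu>\<close>-mass of the antidiagonal \<open>i + j = n\<close>
  increase, by at most its mass on the axes, these masses converge to a positive limit. A second Lyapunov
  function gives \<open>\<nu>(i, j) \<le> C z\<^bsup>-|j-i|\<^esup>\<close> with \<open>z > 1\<close>. Finally, summing the strictly convex function
  \<open>1 / (1 + u)\<close> of \<open>\<nu> / \<eta>\<close> against \<open>\<eta>\<close> shows that the squared increments of \<open>\<nu> / \<eta>\<close> are summable along
  every diagonal, so \<open>\<nu> / \<eta>\<close> becomes constant far out, and the limit of the masses identifies the
  constant. Convergence of the chain itself is shown by the same kind of energy argument.
\<close>

section \<open>A join-the-shortest-queue walk on the quadrant\<close>

text \<open>The values of \<open>q\<close> on the axes are unknown, so the proof works with a priori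
  bounds that come from testing invariance on bounded functions. The convex function has to be
  bounded as well: the \<open>z\<close> of the geometric bound is chosen below the inverse decay
  ratios of \<eta>, so \<nu> / \<eta> is not known to be bounded across an antidiagonal. Since 1 /
  (1 + u) is at most 1, the boundary terms are at most \<eta>, whatever \<nu> / \<eta> does there.
  The price is that the convexity degenerates for large arguments: squared increments are recovered
  only along a fixed diagonal, where \<eta> is constant and \<nu> is bounded. Vanishing increments
  alone would still allow \<nu> / \<eta> to drift slowly along the diagonal. The limit of the masses
  excludes this, and the geometric bound is what allows limits to be taken inside the sum over an
  antidiagonal.\<close>

lemma h_add_minus: "h n + h (- n) = 1"
  by (simp add: h_def)

lemma h_bounds: "0 \<le> h n" "h n \<le> 1"
  by (simp_all add: h_def)

lemma has_sum_supported:
  fixes f :: "'b \<Rightarrow> 'c :: {comm_monoid_add, topological_space}"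
  assumes "inj_on k A" "((\<lambda>x. f (k x)) has_sum S) A" "\<And>y. y \<notin> k ` A \<Longrightarrow> f y = 0"
  shows "(f has_sum S) UNIV"
proof -
  have "(f has_sum S) (k ` A)"
    using assms(1,2) by (simp add: has_sum_reindex o_def)
  then show ?thesis
    using assms(3) by (subst has_sum_cong_neutral[of "k ` A" UNIV f f]) auto
qed

text \<open>
  \<open>L0\<close>, \<open>L1\<close>, \<open>L2\<close>, \<open>M1\<close>, \<open>M2\<close> stand for the paper's hatted rates. \<open>M1'\<close> is the service rate of queue 1
  while queue 2 is empty, and \<open>M2'\<close> that of queue 2 while queue 1 is empty: the server is then idle
  for longer, because only one orbit sends retrials.
\<close>

locale gjsq =
  fixes L0 L1 L2 M1 M2 M1' M2' \<rho> \<gamma>1 \<gamma>2 :: real and q :: "nat \<Rightarrow> nat \<Rightarrow> real"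
  assumes L_pos: "L0 > 0" "L1 > 0" "L2 > 0" and M_pos: "M1 > 0" "M2 > 0"
    and M1': "M1 \<le> M1'" "M1' \<le> M1 + M2"
    and M2': "M2 \<le> M2'" "M2' \<le> M1 + M2"
    and \<rho>_eq: "\<rho> * (M1 + M2) = L0 + L1 + L2"
    and \<rho>_less: "\<rho> < 1" "L1 < \<rho> * M1" "L2 < \<rho> * M2"
    and \<gamma>1: "\<gamma>1 = M1 * \<rho>\<^sup>2 + L2" and \<gamma>2: "\<gamma>2 = M2 * \<rho>\<^sup>2 + L1"
    and \<gamma>_less: "\<gamma>1 < \<gamma>2 + L0" "\<gamma>2 < \<gamma>1 + L0"
    and q_pos: "q i j > 0"
begin

abbreviation "L \<equiv> L0 + L1 + L2"
abbreviation "M \<equiv> M1 + M2"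

lemma \<rho>_pos: "\<rho> > 0"
  using \<rho>_eq L_pos M_pos by (metis add_pos_pos zero_less_mult_pos2)

definition up1 :: "nat \<Rightarrow> nat \<Rightarrow> real" where "up1 i j = L1 + L0 * h (int j - int i)"
definition up2 :: "nat \<Rightarrow> nat \<Rightarrow> real" where "up2 i j = L2 + L0 * h (int i - int j)"
definition down1 :: "nat \<Rightarrow> nat \<Rightarrow> real" where
  "down1 i j = (if i = 0 then 0 else if j = 0 then M1' else M1)"
definition down2 :: "nat \<Rightarrow> nat \<Rightarrow> real" where
  "down2 i j = (if j = 0 then 0 else if i = 0 then M2' else M2)"

text \<open>The truncated subtractions are harmless: \<open>down1 0 j = 0\<close> and \<open>down2 i 0 = 0\<close>.\<close>

definition gen :: "(nat \<Rightarrow> nat \<Rightarrow> real) \<Rightarrow> nat \<Rightarrow> nat \<Rightarrow> real" where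
  "gen V i j = up1 i j * (V (i + 1) j - V i j) + up2 i j * (V i (j + 1) - V i j)
     + down1 i j * (V (i - 1) j - V i j) + down2 i j * (V i (j - 1) - V i j)"

lemma up_add: "up1 i j + up2 i j = L0 + L1 + L2"
proof -
  have "h (int j - int i) + h (int i - int j) = 1"
    using h_add_minus[of "int j - int i"] by simp
  then have "L0 * h (int j - int i) + L0 * h (int i - int j) = L0"
    by (metis distrib_left mult.right_neutral)
  then show ?thesis by (simp add: up1_def up2_def)
qed

lemma rates_nonneg: "0 \<le> up1 i j" "0 \<le> up2 i j" "0 \<le> down1 i j" "0 \<le> down2 i j"
  using L_pos M_pos M1' M2' h_bounds[of "int j - int i"] h_bounds[of "int i - int j"]
  by (auto simp: up1_def up2_def down1_def down2_def intro!: add_nonneg_nonneg)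

lemma up_bounds: "L1 \<le> up1 i j" "L2 \<le> up2 i j"
  using L_pos h_bounds by (auto simp: up1_def up2_def)

text \<open>At a point that the cap leaves unchanged, the neighbours can only go down; at a point
  that it cuts (\<open>gen_min_nonpos\<close>), the capped function attains its maximum. Together
  these carry a drift inequality over to the capped function.\<close>

lemma gen_min_le:
  assumes "V i j \<le> B"
  shows "gen (\<lambda>i j. min (V i j) B) i j \<le> gen V i j"
  unfolding gen_def
  by (intro add_mono mult_left_mono rates_nonneg) (use assms in auto)

lemma gen_min_nonpos:
  assumes "V i j \<ge> B"
  shows "gen (\<lambda>i j. min (V i j) B) i j \<le> 0"
  unfolding gen_def
  by (intro add_nonpos_nonpos mult_nonneg_nonpos rates_nonneg) (use assms in auto)


lemma gen_power:
  assumes "u \<noteq> 0"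
  shows "gen (\<lambda>i j. u ^ (i + j)) i j
      = u ^ (i + j) * (L * (u - 1) + (down1 i j + down2 i j) * (1 / u - 1))"
    and "gen (\<lambda>i j. u ^ i) i j = u ^ i * (up1 i j * (u - 1) + down1 i j * (1 / u - 1))"
    and "gen (\<lambda>i j. u ^ j) i j = u ^ j * (up2 i j * (u - 1) + down2 i j * (1 / u - 1))"
proof -
  have 1: "down1 i j * (u ^ (i - 1 + k) - u ^ (i + k)) = u ^ (i + k) * (down1 i j * (1 / u - 1))" for k
    using assms by (cases i) (simp_all add: down1_def field_simps)
  have 2: "down2 i j * (u ^ (k + (j - 1)) - u ^ (k + j)) = u ^ (k + j) * (down2 i j * (1 / u - 1))" for k
    using assms by (cases j) (simp_all add: down2_def field_simps)
  show "gen (\<lambda>i j. u ^ i) i j = u ^ i * (up1 i j * (u - 1) + down1 i j * (1 / u - 1))"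
    using 1[of 0] by (simp add: gen_def algebra_simps)
  show "gen (\<lambda>i j. u ^ j) i j = u ^ j * (up2 i j * (u - 1) + down2 i j * (1 / u - 1))"
    using 2[of 0] by (simp add: gen_def algebra_simps)
  have "gen (\<lambda>i j. u ^ (i + j)) i j
      = u ^ (i + j) * ((up1 i j + up2 i j) * (u - 1)) + u ^ (i + j) * (down1 i j * (1 / u - 1))
        + u ^ (i + j) * (down2 i j * (1 / u - 1))"
    using 1[of j] 2[of i] by (simp add: gen_def algebra_simps)
  then show "gen (\<lambda>i j. u ^ (i + j)) i j
      = u ^ (i + j) * (L * (u - 1) + (down1 i j + down2 i j) * (1 / u - 1))"
    by (simp add: up_add algebra_simps)
qed

lemma gen_linear:
  "gen (\<lambda>i j. V i j + W i j) i j = gen V i j + gen W i j"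
  "gen (\<lambda>i j. c * V i j) i j = c * gen V i j"
  by (simp_all add: gen_def algebra_simps)

end

text \<open>Invariance in weak form: bounded test functions require no moments of \<open>q\<close>.
  Indicators give the balance and cut equations, capped Lyapunov functions give tail bounds.\<close>

locale gjsq_invariant = gjsq +
  assumes gen_invariant: "\<And>V B. (\<And>i j. \<bar>V i j\<bar> \<le> B) \<Longrightarrow> ((\<lambda>(i, j). q i j * gen V i j) has_sum 0) UNIV"
begin

text \<open>Truncating \<open>V\<close> at a level that exceeds its values on \<open>F\<close> removes all integrability questions.\<close>

lemma foster_lyapunov:
  assumes V: "\<And>i j. V i j \<ge> 0" and b: "\<And>i j. b i j \<ge> 0"
    and g: "\<And>i j. g i j \<ge> 0"
    and drift: "\<And>i j. gen V i j \<le> b i j - g i j"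
    and sum: "((\<lambda>(i, j). q i j * b i j) has_sum B) UNIV"
    and F: "finite F"
  shows "(\<Sum>(i, j)\<in>F. q i j * g i j) \<le> B"
proof -
  define C where "C = Max (insert 0 ((\<lambda>(i, j). V i j) ` F))"
  have C: "V i j \<le> C" if "(i, j) \<in> F" for i j
    unfolding C_def using F that by (intro Max_ge) force+
  have C0: "C \<ge> 0" unfolding C_def using F by (intro Max_ge) auto
  let ?g = "\<lambda>(i, j). if (i, j) \<in> F then q i j * g i j else 0"
  have "(?g has_sum (\<Sum>x\<in>F. ?g x)) F"
    using F by (rule has_sum_finite)
  then have "(?g has_sum (\<Sum>x\<in>F. ?g x)) UNIV"
    by (subst has_sum_cong_neutral[of F UNIV]) auto
  then have hs: "((\<lambda>x. (\<lambda>(i, j). q i j * b i j) x - ?g x) has_sum (B - (\<Sum>x\<in>F. ?g x))) UNIV"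
    using has_sum_add[OF sum, of "\<lambda>x. - ?g x" "- (\<Sum>x\<in>F. ?g x)"] by (simp add: has_sum_uminus)
  have "((\<lambda>(i, j). q i j * gen (\<lambda>i j. min (V i j) C) i j) has_sum 0) UNIV"
    by (rule gen_invariant[of _ C]) (use V C0 in \<open>auto simp: abs_le_iff min_def intro: order_trans\<close>)
  then have "0 \<le> B - (\<Sum>x\<in>F. ?g x)"
    using hs
  proof (rule has_sum_mono)
    fix x :: "nat \<times> nat"
    obtain i j where x: "x = (i, j)" by force
    have "gen (\<lambda>i j. min (V i j) C) i j \<le> b i j - (if (i, j) \<in> F then g i j else 0)"
    proof (cases "V i j \<le> C")
      case True
      then show ?thesis
        using gen_min_le[of V i j C] drift[of i j] g[of i j] by auto
    next
      \<comment> \<open>A point where \<open>V\<close> exceeds \<open>C\<close> lies outside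
        \<open>F\<close>, so \<open>g\<close> is absent there and \<open>b \<ge> 0\<close>
        suffices.\<close>
      case False
      then show ?thesis using gen_min_nonpos[of C V i j] C[of i j] b[of i j] by auto
    qed
    then show "(case x of (i, j) \<Rightarrow> q i j * gen (\<lambda>i j. min (V i j) C) i j)
        \<le> (case x of (i, j) \<Rightarrow> q i j * b i j) - ?g x"
      using q_pos[of i j] by (simp add: x flip: right_diff_distrib split: if_splits)
  qed
  also have "(\<Sum>x\<in>F. ?g x) = (\<Sum>(i, j)\<in>F. q i j * g i j)"
    by (intro sum.cong) auto
  finally show ?thesis by simp
qed


text \<open>On the axis \<open>i = 0\<close>, queue 2 receives only its dedicated stream and is
  served at rate at least \<open>M2\<close>, so its tail should decay like that of a single queue of
  load \<open>L2 / M2 < \<rho>\<close>; likewise on the other axis. The strict gap between these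
  loads and \<rho> leaves room for a base \<open>y > 1 / \<rho>\<close>, and this room later pays
  for the factor \<open>z ^ gap i j\<close>.\<close>

lemma boundary_summable:
  obtains y where "y > 1 / \<rho>" "summable (\<lambda>j. q 0 j * y ^ j)" "summable (\<lambda>i. q i 0 * y ^ i)"
proof -
  define R where "R = 1 / \<rho>"
  have R: "R > 1" "R < R\<^sup>2" "L * R = M" "L > 0" "M > 0" "R < M1 / L1" "R < M2 / L2"
    using \<rho>_pos \<rho>_less \<rho>_eq L_pos M_pos
    by (auto simp: R_def field_simps power2_eq_square)
  \<comment> \<open>\<open>y < M1 / L1\<close> and \<open>y < M2 / L2\<close> give the power of
    \<open>y\<close> in the longer queue a negative drift; \<open>y < R\<^sup>2\<close> puts
    \<open>t\<close> below \<open>R = M / L\<close>, so that \<open>t ^ (i + j)\<close> has negative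
    drift in the interior.\<close>
  obtain y where y: "R < y" "y < min (R\<^sup>2) (min (M1 / L1) (M2 / L2))"
    using dense[of R "min (R\<^sup>2) (min (M1 / L1) (M2 / L2))"] R by auto
  define t where "t = sqrt y"
  have y1: "y > 1" "y > 0" using y R by auto
  have t: "t > 1" "t < R" "t\<^sup>2 = y" "t > 0"
    using y y1 R by (auto simp: t_def real_less_lsqrt)
  have "L * t < M" using t R by (metis mult_strict_left_mono)
  then have Mt: "M / t - L > 0" using t by (simp add: field_simps)
  \<comment> \<open>The interior drift of \<open>t ^ (i + j)\<close> is
    \<open>- c1 * t ^ (i + j)\<close>. The factor \<open>K\<close> makes it outweigh the drifts of
    \<open>y ^ i\<close> and \<open>y ^ j\<close>, each at most
    \<open>L * (y - 1) * t ^ (i + j)\<close>.\<close>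
  define c1 where "c1 = (t - 1) * (M / t - L)"
  define K where "K = 2 * L * (y - 1) / c1"
  have c1: "c1 > 0" using t Mt by (simp add: c1_def)
  have K: "K > 0" using y1 R c1 by (simp add: K_def)
  \<comment> \<open>On an axis the large power of \<open>y\<close> has drift at most
    \<open>- 2 * c * y ^ n\<close>: one half absorbs \<open>C * R ^ n\<close> from \<open>n0\<close>
    on, the other half becomes \<open>g\<close>. The finitely many smaller \<open>n\<close> are left
    to \<open>b\<close>.\<close>
  define c where "c = (y - 1) * min (M1 / y - L1) (M2 / y - L2) / 2"
  have "M1 / y - L1 > 0" "M2 / y - L2 > 0"
    using y y1 L_pos by (auto simp: field_simps)
  then have c: "c > 0" using y1 by (simp add: c_def)
  have c_le: "2 * c \<le> (y - 1) * (M1 / y - L1)" "2 * c \<le> (y - 1) * (M2 / y - L2)"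
    using y1 by (auto simp: c_def)
  define C where "C = L * (R - 1) + K * L * (t - 1) + L * (y - 1)"
  have C: "C > 0" using R K t y1 by (auto simp: C_def intro!: add_pos_pos)
  have "\<forall>\<^sub>F n in sequentially. C / c < (y / R) ^ n"
    using real_arch_pow[of "y / R" "C / c"] y R
    by (metis (no_types, lifting) eventually_at_top_linorder less_divide_eq_1_pos order.strict_trans1
        order.strict_trans2 order_less_imp_le power_increasing_iff zero_less_one)
  then obtain n0 where n0: "C / c < (y / R) ^ n" if "n \<ge> n0" for n
    by (auto simp: eventually_at_top_linorder)
  have n0': "C * R ^ n \<le> c * y ^ n" if "n \<ge> n0" for n
    using n0[OF that] c R by (simp add: field_simps)
  \<comment> \<open>\<open>R\<^bsup>i+j\<^esup>\<close> is harmonic in the interior; \<open>y\<^bsup>j\<^esup>\<close> has negative drift for \<open>i < j\<close> because \<open>L2 * y < M2\<close>,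
     and its positive drift for \<open>j \<le> i\<close> is absorbed by \<open>t\<^bsup>i+j\<^esup>\<close>, as \<open>y = t\<^sup>2\<close>.\<close>
  define V where "V i j = R ^ (i + j) + (K * t ^ (i + j) + (y ^ i + y ^ j))" for i j :: nat
  define B where "B = C * R ^ n0 + L * (y - 1) + c"
  define b where "b i j = (if (i = 0 \<or> j = 0) \<and> i + j \<le> n0 then B else 0)" for i j :: nat
  define g where "g i j = (if i = 0 \<or> j = 0 then c * y ^ (i + j) else 0)" for i j :: nat
  have B: "B \<ge> 0" using C c R y1 by (auto simp: B_def)
  have gen_V: "gen V i j =
      R ^ (i + j) * (L * (R - 1) + (down1 i j + down2 i j) * (1 / R - 1))
      + K * (t ^ (i + j) * (L * (t - 1) + (down1 i j + down2 i j) * (1 / t - 1)))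
      + y ^ i * (up1 i j * (y - 1) + down1 i j * (1 / y - 1))
      + y ^ j * (up2 i j * (y - 1) + down2 i j * (1 / y - 1))" for i j
    unfolding V_def gen_linear using R t y1 by (simp add: gen_power)
  have nonpos: "d * (1 / u - 1) \<le> 0" if "d \<ge> 0" "u > 1" for d u :: real
    using that by (simp add: mult_nonneg_nonpos)
  have edge: "C * R ^ n - 2 * c * y ^ n \<le> (if n \<le> n0 then B else 0) - c * y ^ n" for n
  proof (cases "n \<le> n0")
    case True
    then have "C * R ^ n \<le> C * R ^ n0" using C R by simp
    moreover have "0 \<le> c * y ^ n" "0 \<le> L * (y - 1)" using c y1 R by auto
    ultimately have "C * R ^ n \<le> B + c * y ^ n" using c by (simp only: B_def)
    then show ?thesis using True by simp
  next
    case False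
    then show ?thesis using n0'[of n] by simp
  qed
  \<comment> \<open>Both axes at once: \<open>d\<close> is the total service rate there,
    \<open>u\<close> the arrival rate of the empty queue, while \<open>u'\<close> and
    \<open>d'\<close> are the arrival and service rates of the nonempty queue.\<close>
  have edge': "R ^ n * (L * (R - 1) + d * (1 / R - 1)) + K * (t ^ n * (L * (t - 1) + d * (1 / t - 1)))
      + u * (y - 1) + y ^ n * (u' * (y - 1) + d' * (1 / y - 1)) \<le> C * R ^ n - 2 * c * y ^ n"
    if "d \<ge> 0" "u \<le> L" "2 * c \<le> (y - 1) * (d'/ y - u')" for d u u' d' n
  proof -
    have 1: "R ^ n * (L * (R - 1) + d * (1 / R - 1)) \<le> R ^ n * (L * (R - 1))"
      using nonpos[of d R] that R by (intro mult_left_mono) auto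
    have "t ^ n * (L * (t - 1) + d * (1 / t - 1)) \<le> t ^ n * (L * (t - 1))"
      using nonpos[of d t] that t by (intro mult_left_mono) auto
    also have "\<dots> \<le> R ^ n * (L * (t - 1))"
      using t R by (intro mult_right_mono power_mono) auto
    finally have 2: "K * (t ^ n * (L * (t - 1) + d * (1 / t - 1))) \<le> K * (R ^ n * (L * (t - 1)))"
      using K by (intro mult_left_mono) auto
    have "u * (y - 1) \<le> L * (y - 1) * 1" using that y1 by simp
    also have "\<dots> \<le> L * (y - 1) * R ^ n" using R y1 by (intro mult_left_mono) auto
    finally have 3: "u * (y - 1) \<le> L * (y - 1) * R ^ n" .
    have "u' * (y - 1) + d' * (1 / y - 1) = - ((y - 1) * (d' / y - u'))"
      using y1 by (simp add: field_simps)
    then have "y ^ n * (u' * (y - 1) + d' * (1 / y - 1)) \<le> y ^ n * (- (2 * c))"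
      using that y1 by (intro mult_left_mono) auto
    with 1 2 3 show ?thesis by (simp add: C_def algebra_simps)
  qed
  have drift: "gen V i j \<le> b i j - g i j" for i j
  proof -
    consider "i > 0" "j > 0" | "i = 0" "j > 0" | "i > 0" "j = 0" | "i = 0" "j = 0" by auto
    then show ?thesis
    proof cases
      case 1
      \<comment> \<open>In the first alternative \<open>k\<close> is at most half of
        \<open>i + j\<close>, and \<open>y ^ k = t ^ (2 * k)\<close>; in the second the queue is the
        longer one and its own drift is already negative.\<close>
      have y_le: "y ^ k * (u * (y - 1) + d * (1 / y - 1)) \<le> L * (y - 1) * t ^ (i + j)"
        if "2 * k \<le> i + j \<and> u \<le> L \<or> 2 * c \<le> (y - 1) * (d / y - u)" "d \<ge> 0" for k u d
        using that(1)
      proof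
        assume k: "2 * k \<le> i + j \<and> u \<le> L"
        have "y ^ k * (u * (y - 1) + d * (1 / y - 1)) \<le> y ^ k * (L * (y - 1))"
        proof (rule mult_left_mono)
          have "u * (y - 1) \<le> L * (y - 1)" using k y1 by simp
          then show "u * (y - 1) + d * (1 / y - 1) \<le> L * (y - 1)"
            using nonpos[of d y] that y1 by linarith
        qed (use y1 in auto)
        also have "\<dots> = t ^ (2 * k) * (L * (y - 1))" by (simp add: power_mult t(3))
        also have "\<dots> \<le> t ^ (i + j) * (L * (y - 1))"
          using k t R y1 by (intro mult_right_mono power_increasing) auto
        finally show ?thesis by (simp add: algebra_simps)
      next
        assume "2 * c \<le> (y - 1) * (d / y - u)"
        moreover have "u * (y - 1) + d * (1 / y - 1) = - ((y - 1) * (d / y - u))"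
          using y1 by (simp add: field_simps)
        ultimately have "y ^ k * (u * (y - 1) + d * (1 / y - 1)) \<le> 0"
          using c y1 by (intro mult_nonneg_nonpos) auto
        also have "0 \<le> L * (y - 1) * t ^ (i + j)" using R y1 t by auto
        finally show ?thesis .
      qed
      have "up1 i j \<le> L" "up2 i j \<le> L"
        using up_add[of i j] rates_nonneg[of i j] by linarith+
      moreover have "down1 i j = M1" "down2 i j = M2" using 1 by (auto simp: down1_def down2_def)
      moreover have "up1 i j = L1" if "j < i" using that by (simp add: up1_def h_def)
      moreover have "up2 i j = L2" if "i < j" using that by (simp add: up2_def h_def)
      ultimately have "y ^ i * (up1 i j * (y - 1) + down1 i j * (1 / y - 1)) \<le> L * (y - 1) * t ^ (i + j)
        \<and> y ^ j * (up2 i j * (y - 1) + down2 i j * (1 / y - 1)) \<le> L * (y - 1) * t ^ (i + j)"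
        using c_le M_pos by (intro conjI y_le; cases i j rule: linorder_cases; simp)
      moreover have "L * (t - 1) + M * (1 / t - 1) = - c1" using t by (simp add: c1_def field_simps)
      moreover have "L * (R - 1) + M * (1 / R - 1) = 0" using R by (simp add: field_simps)
      moreover have "K * (t ^ (i + j) * (- c1)) = - (2 * L * (y - 1) * t ^ (i + j))"
        using c1 by (simp add: K_def)
      ultimately have "gen V i j \<le> 0"
        unfolding gen_V \<open>down1 i j = M1\<close> \<open>down2 i j = M2\<close> by (simp only: mult_zero_right) linarith
      then show ?thesis using 1 by (simp add: b_def g_def)
    next
      case 2
      then have *: "up2 i j = L2" "up1 i j \<le> L" "down1 i j = 0" "down2 i j = M2'" "M2' \<ge> 0"
        using L_pos M_pos M2' by (auto simp: up1_def up2_def h_def down1_def down2_def)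
      have "(y - 1) * (M2 / y - L2) \<le> (y - 1) * (M2' / y - L2)"
        using y1 M2' by (intro mult_left_mono diff_right_mono divide_right_mono) auto
      then have "gen V i j \<le> C * R ^ j - 2 * c * y ^ j"
        unfolding gen_V using 2 * edge'[of M2' "up1 i j" M2' L2 j] c_le by simp
      then show ?thesis using edge[of j] 2 by (simp add: b_def g_def)
    next
      case 3
      then have *: "up1 i j = L1" "up2 i j \<le> L" "down2 i j = 0" "down1 i j = M1'" "M1' \<ge> 0"
        using L_pos M_pos M1' by (auto simp: up1_def up2_def h_def down1_def down2_def)
      have "(y - 1) * (M1 / y - L1) \<le> (y - 1) * (M1' / y - L1)"
        using y1 M1' by (intro mult_left_mono diff_right_mono divide_right_mono) auto
      then have "gen V i j \<le> C * R ^ i - 2 * c * y ^ i"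
        unfolding gen_V using 3 * edge'[of M1' "up2 i j" M1' L1 i] c_le by (simp add: algebra_simps)
      then show ?thesis using edge[of i] 3 by (simp add: b_def g_def)
    next
      case 4
      have "gen V 0 0 = C"
        unfolding gen_V using up_add[of 0 0]
        by (simp add: down1_def down2_def C_def flip: distrib_right)
      moreover have "C \<le> C * R ^ n0" using C R by simp
      moreover have "L * (y - 1) \<ge> 0" using R y1 by simp
      ultimately show ?thesis using 4 by (simp add: b_def g_def B_def)
    qed
  qed
  let ?D = "{(i, j). (i = 0 \<or> j = 0) \<and> i + j \<le> n0} :: (nat \<times> nat) set"
  have "finite ?D" by (rule finite_subset[of _ "{..n0} \<times> {..n0}"]) auto
  then have sum_b: "((\<lambda>(i, j). q i j * b i j) has_sum (\<Sum>(i, j)\<in>?D. q i j * b i j)) UNIV"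
    by (intro has_sum_supported[of id ?D]) (auto simp: b_def split: if_splits)
  have fl: "(\<Sum>(i, j)\<in>F. q i j * g i j) \<le> (\<Sum>(i, j)\<in>?D. q i j * b i j)" if "finite F" for F
  proof (rule foster_lyapunov[OF _ _ _ drift sum_b that])
    show "0 \<le> V i j" for i j using R K t y1 by (simp add: V_def)
    show "0 \<le> b i j" for i j using B by (simp add: b_def)
    show "0 \<le> g i j" for i j using c y1 by (simp add: g_def)
  qed
  show thesis
  proof
    show "1 / \<rho> < y" using y by (simp add: R_def)
    have "summable (\<lambda>j. c * (q 0 j * y ^ j))"
    proof (rule summableI_nonneg_bounded)
      fix n
      have "(\<Sum>(i, j)\<in>Pair 0 ` {..<n}. q i j * g i j) = (\<Sum>j<n. c * (q 0 j * y ^ j))"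
        by (subst sum.reindex) (auto simp: inj_on_def g_def algebra_simps)
      then show "(\<Sum>j<n. c * (q 0 j * y ^ j)) \<le> (\<Sum>(i, j)\<in>?D. q i j * b i j)"
        using fl[of "Pair 0 ` {..<n}"] by simp
    qed (use c y1 q_pos in \<open>auto intro!: mult_nonneg_nonneg less_imp_le[OF q_pos]\<close>)
    then show "summable (\<lambda>j. q 0 j * y ^ j)" using c by (subst (asm) summable_cmult_iff) auto
    have "summable (\<lambda>i. c * (q i 0 * y ^ i))"
    proof (rule summableI_nonneg_bounded)
      fix n
      have "(\<Sum>(i, j)\<in>(\<lambda>i. (i, 0)) ` {..<n}. q i j * g i j) = (\<Sum>i<n. c * (q i 0 * y ^ i))"
        by (subst sum.reindex) (auto simp: inj_on_def g_def algebra_simps)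
      then show "(\<Sum>i<n. c * (q i 0 * y ^ i)) \<le> (\<Sum>(i, j)\<in>?D. q i j * b i j)"
        using fl[of "(\<lambda>i. (i, 0)) ` {..<n}"] by simp
    qed (use c y1 q_pos in \<open>auto intro!: mult_nonneg_nonneg less_imp_le[OF q_pos]\<close>)
    then show "summable (\<lambda>i. q i 0 * y ^ i)" using c by (subst (asm) summable_cmult_iff) auto
  qed
qed

section \<open>The tilted measure and the masses of its antidiagonals\<close>

definition nu :: "nat \<Rightarrow> nat \<Rightarrow> real" where "nu i j = q i j / \<rho> ^ (i + j)"

lemma nu_pos: "nu i j > 0"
  using q_pos \<rho>_pos by (simp add: nu_def)

lemma nu_abs: "\<bar>nu i j\<bar> = nu i j"
  using nu_pos[of i j] by simp

lemma nu_boundary_summable: "summable (\<lambda>j. nu 0 j)" "summable (\<lambda>i. nu i 0)"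
proof -
  obtain y where y: "y > 1 / \<rho>" "summable (\<lambda>j. q 0 j * y ^ j)" "summable (\<lambda>i. q i 0 * y ^ i)"
    by (rule boundary_summable)
  have le: "a / \<rho> ^ n \<le> a * y ^ n" if "a > 0" for a n
  proof -
    have "(1 / \<rho>) ^ n \<le> y ^ n" using y \<rho>_pos by (intro power_mono) auto
    then have "a * (1 / \<rho>) ^ n \<le> a * y ^ n" using that by simp
    then show ?thesis by (simp add: power_one_over)
  qed
  show "summable (\<lambda>j. nu 0 j)"
    by (rule summable_comparison_test'[OF y(2)]) (use le[OF q_pos] in \<open>simp only: real_norm_def nu_abs; simp add: nu_def\<close>)
  show "summable (\<lambda>i. nu i 0)"
    by (rule summable_comparison_test'[OF y(3)]) (use le[OF q_pos] in \<open>simp only: real_norm_def nu_abs; simp add: nu_def\<close>)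
qed

text \<open>This is \<open>gen_invariant\<close> for the indicator of \<open>i + j \<le> n\<close>.
  Only the two antidiagonals next to the cut contribute, and every arrival crosses it upwards, at
  total rate \<open>L\<close>.\<close>

lemma cut_equation:
  "(\<Sum>i\<le>Suc n. q i (Suc n - i) * (down1 i (Suc n - i) + down2 i (Suc n - i))) = L * (\<Sum>i\<le>n. q i (n - i))"
proof -
  define V where "V i j = (if i + j \<le> n then 1 else 0 :: real)" for i j :: nat
  have gen_V: "gen V i j = (if i + j = n then - L else if i + j = Suc n then down1 i j + down2 i j else 0)" for i j
  proof -
    have "gen V i j = (up1 i j + up2 i j) * (if i + j = n then - 1 else 0)
        + (down1 i j + down2 i j) * (if i + j = Suc n then 1 else 0)"
      by (cases "i = 0"; cases "j = 0") (auto simp: gen_def V_def down1_def down2_def algebra_simps)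
    then show ?thesis by (simp add: up_add)
  qed
  define diag where "diag k = (\<lambda>i. (i, k - i)) ` {..k}" for k :: nat
  have diag: "(i, j) \<in> diag k \<longleftrightarrow> i + j = k" for i j k
    by (auto simp: diag_def image_iff)
  have sum_diag: "(\<Sum>(i, j)\<in>diag k. f i j) = (\<Sum>i\<le>k. f i (k - i))" for k and f :: "nat \<Rightarrow> nat \<Rightarrow> real"
    unfolding diag_def by (subst sum.reindex) (auto simp: inj_on_def)
  have fin: "finite (diag k)" for k by (simp add: diag_def)
  have "((\<lambda>(i, j). q i j * gen V i j) has_sum 0) UNIV"
    by (rule gen_invariant[of _ 1]) (simp add: V_def)
  moreover have "((\<lambda>(i, j). q i j * gen V i j) has_sum (\<Sum>(i, j)\<in>diag n \<union> diag (Suc n). q i j * gen V i j)) UNIV"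
    using fin by (intro has_sum_supported[of id "diag n \<union> diag (Suc n)"]) (auto simp: diag gen_V)
  ultimately have "0 = (\<Sum>(i, j)\<in>diag n \<union> diag (Suc n). q i j * gen V i j)"
    by (rule has_sum_unique)
  also have "\<dots> = (\<Sum>(i, j)\<in>diag n. q i j * gen V i j) + (\<Sum>(i, j)\<in>diag (Suc n). q i j * gen V i j)"
    using fin diag by (intro sum.union_disjoint) auto
  also have "\<dots> = (\<Sum>i\<le>n. q i (n - i) * (- L))
      + (\<Sum>i\<le>Suc n. q i (Suc n - i) * (down1 i (Suc n - i) + down2 i (Suc n - i)))"
    unfolding sum_diag by (intro arg_cong2[of _ _ _ _ "(+)"] sum.cong) (auto simp: gen_V simp del: diff_Suc_Suc)
  also have "(\<Sum>i\<le>n. q i (n - i) * (- L)) = - (L * (\<Sum>i\<le>n. q i (n - i)))"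
    by (simp add: sum_distrib_left algebra_simps flip: sum_negf)
  finally show ?thesis by simp
qed

definition mass :: "nat \<Rightarrow> real" where "mass n = (\<Sum>i\<le>n. nu i (n - i))"

text \<open>Since \<open>L = \<rho> * M\<close>, the cut equation says that
  \<open>M * mass (Suc n)\<close> exceeds \<open>M * mass n\<close> by the sum of
  \<open>nu * e\<close>, where \<open>e\<close> is the service rate lost because a queue is empty.
  It vanishes off the axes and lies between 0 and \<open>M\<close>.\<close>

lemma mass_Suc: "mass n \<le> mass (Suc n)" "mass (Suc n) \<le> mass n + (nu 0 (Suc n) + nu (Suc n) 0)"
proof -
  define e where "e i = M - (down1 i (Suc n - i) + down2 i (Suc n - i))" for i
  have M: "M > 0" using M_pos by simp
  have e: "0 \<le> e i" "e i \<le> M" "0 < i \<Longrightarrow> i < Suc n \<Longrightarrow> e i = 0" for i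
    using M1' M2' M_pos by (auto simp: e_def down1_def down2_def)
  have "(\<Sum>i\<le>Suc n. q i (Suc n - i) * (M - e i)) = L * (\<Sum>i\<le>n. q i (n - i))"
    unfolding e_def using cut_equation[of n] by simp
  then have "(\<Sum>i\<le>Suc n. q i (Suc n - i)) * M - (\<Sum>i\<le>Suc n. q i (Suc n - i) * e i) = L * (\<Sum>i\<le>n. q i (n - i))"
    by (simp only: right_diff_distrib sum_subtractf sum_distrib_right)
  moreover have "(\<Sum>i\<le>k. q i (k - i)) = mass k * \<rho> ^ k" for k
    unfolding mass_def sum_distrib_right
    by (intro sum.cong) (use \<rho>_pos in \<open>auto simp: nu_def\<close>)
  moreover have "(\<Sum>i\<le>Suc n. q i (Suc n - i) * e i) = (\<Sum>i\<le>Suc n. nu i (Suc n - i) * e i) * \<rho> ^ Suc n"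
    unfolding sum_distrib_right
    by (intro sum.cong) (use \<rho>_pos in \<open>auto simp: nu_def\<close>)
  ultimately have "mass (Suc n) * \<rho> ^ Suc n * M - (\<Sum>i\<le>Suc n. nu i (Suc n - i) * e i) * \<rho> ^ Suc n = mass n * \<rho> ^ Suc n * M"
    using \<rho>_eq by simp
  then have "\<rho> ^ Suc n * (mass (Suc n) * M - (\<Sum>i\<le>Suc n. nu i (Suc n - i) * e i)) = \<rho> ^ Suc n * (mass n * M)"
    by (simp only: algebra_simps)
  then have eq: "mass (Suc n) * M = mass n * M + (\<Sum>i\<le>Suc n. nu i (Suc n - i) * e i)"
    using \<rho>_pos by simp
  have "0 \<le> (\<Sum>i\<le>Suc n. nu i (Suc n - i) * e i)"
    using e nu_pos by (intro sum_nonneg mult_nonneg_nonneg) (auto intro: less_imp_le)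
  with eq have "mass n * M \<le> mass (Suc n) * M" by simp
  then show "mass n \<le> mass (Suc n)" using M by (rule mult_right_le_imp_le)
  have "(\<Sum>i\<le>Suc n. nu i (Suc n - i) * e i) = (\<Sum>i\<in>{0, Suc n}. nu i (Suc n - i) * e i)"
    by (rule sum.mono_neutral_right) (auto simp: e(3))
  also have "\<dots> \<le> (nu 0 (Suc n) + nu (Suc n) 0) * M"
    using e(2) nu_pos by (simp add: distrib_right) (intro add_mono mult_left_mono; simp add: less_imp_le)
  finally have "mass (Suc n) * M \<le> (mass n + (nu 0 (Suc n) + nu (Suc n) 0)) * M"
    using eq by (simp add: distrib_right)
  then show "mass (Suc n) \<le> mass n + (nu 0 (Suc n) + nu (Suc n) 0)" using M by (rule mult_right_le_imp_le)
qed

lemma mass_limit: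
  obtains S where "S > 0" "mass \<longlonglongrightarrow> S" "\<And>n. mass n \<le> S"
proof -
  define B where "B = (\<Sum>j. nu 0 (Suc j)) + (\<Sum>i. nu (Suc i) 0)"
  have sm: "summable (\<lambda>j. nu 0 (Suc j))" "summable (\<lambda>i. nu (Suc i) 0)"
    using nu_boundary_summable summable_Suc_iff[of "\<lambda>j. nu 0 j"] summable_Suc_iff[of "\<lambda>i. nu i 0"]
    by simp_all
  have "mass n \<le> mass 0 + ((\<Sum>j<n. nu 0 (Suc j)) + (\<Sum>i<n. nu (Suc i) 0))" for n
  proof (induction n)
    case (Suc n)
    then show ?case using mass_Suc(2)[of n] by simp
  qed simp
  moreover have "(\<Sum>j<n. nu 0 (Suc j)) + (\<Sum>i<n. nu (Suc i) 0) \<le> B" for n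
    unfolding B_def by (intro add_mono sum_le_suminf sm) (auto intro: less_imp_le nu_pos)
  ultimately have "mass n \<le> mass 0 + B" for n
    by (meson add_left_mono order_trans)
  moreover have "incseq mass" by (intro incseq_SucI mass_Suc)
  ultimately obtain S where S: "mass \<longlonglongrightarrow> S" "\<forall>n. mass n \<le> S"
    using incseq_convergent[of mass "mass 0 + B"] by blast
  have "mass 0 > 0" using nu_pos by (simp add: mass_def)
  then have "S > 0" using S(2) by (meson less_le_trans)
  then show thesis using S that by blast
qed

lemma nu_le_mass: "nu i j \<le> mass (i + j)"
proof -
  have "nu i (i + j - i) \<le> mass (i + j)"
    unfolding mass_def by (rule member_le_sum) (auto intro: less_imp_le nu_pos)
  then show ?thesis by simp
qed

end

section \<open>Geometric decay away from the main diagonal\<close>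

context gjsq_invariant begin

lemma sum_axis_le:
  fixes f :: "nat \<Rightarrow> real"
  assumes "\<And>i. 0 \<le> f i" "\<And>i. f i \<le> K * s i" "summable s"
  shows "(f has_sum suminf f) UNIV" "suminf f \<le> K * suminf s"
proof -
  have "summable (\<lambda>i. K * s i)" using assms(3) by (rule summable_mult)
  then have f: "summable f"
    by (rule summable_comparison_test') (use assms in auto)
  then show "(f has_sum suminf f) UNIV"
    using assms(1) by (intro sums_nonneg_imp_has_sum summable_sums)
  have "suminf f \<le> (\<Sum>i. K * s i)"
    using f assms by (intro suminf_le summable_mult) auto
  then show "suminf f \<le> K * suminf s" using assms(3) by (simp add: suminf_mult)
qed

definition gap :: "nat \<Rightarrow> nat \<Rightarrow> nat" where "gap i j = nat \<bar>int j - int i\<bar>"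

text \<open>The constants of the Lyapunov function in \<open>nu_geometric_bound\<close>, whose level
  weight is \<open>\<theta> ^ (N - n)\<close> up to a level \<open>N\<close> and
  \<open>\<tau> ^ (n - N)\<close> beyond it. The four drift inequalities serve the levels above
  \<open>N\<close>, the level \<open>N\<close> itself, and the levels below \<open>N\<close> for
  \<open>i < j\<close> and for \<open>j < i\<close>.\<close>

lemma tightness_parameters:
  assumes "y > 1 / \<rho>"
  obtains \<tau> z \<theta> c where "\<rho> < \<tau>" "\<tau> < 1" "1 < z" "z / \<rho> \<le> y" "0 < \<theta>" "\<theta> < 1" "0 < c"
    "L * (\<tau> / \<rho> * z - 1) + M * (\<rho> / \<tau> * z - 1) \<le> 0"
    "L * (\<tau> / \<rho> * z - 1) + M * (\<rho> * z - 1) \<le> - c"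
    "(L1 + L0) * (1 / (\<rho> * \<theta>) / z - 1) + L2 * (1 / (\<rho> * \<theta>) * z - 1)
       + M1 * (\<theta> * \<rho> * z - 1) + M2 * (\<theta> * \<rho> / z - 1) \<le> 0"
    "L1 * (1 / (\<rho> * \<theta>) * z - 1) + (L2 + L0) * (1 / (\<rho> * \<theta>) / z - 1)
       + M1 * (\<theta> * \<rho> / z - 1) + M2 * (\<theta> * \<rho> * z - 1) \<le> 0"
proof -
  obtain \<tau> where \<tau>: "\<rho> < \<tau>" "\<tau> < 1" using dense[OF \<rho>_less(1)] by auto
  have \<tau>0: "\<tau> > 0" using \<tau> \<rho>_pos by linarith
  have LM: "L > 0" "M > 0" "L = \<rho> * M" using L_pos M_pos \<rho>_eq by auto
  have \<gamma>_pos: "\<gamma>1 > 0" "\<gamma>2 > 0" using \<gamma>1 \<gamma>2 L_pos M_pos by (auto intro!: add_nonneg_pos)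
  \<comment> \<open>At \<open>z = 1\<close> the drift beyond level \<open>N\<close> is
    \<open>D - (L + M)\<close>, which is negative because \<rho> < \<tau> < 1; a \<open>z\<close>
    slightly above 1 keeps the sign.\<close>
  define D where "D = M * \<tau> + L / \<tau>"
  have D_pos: "D > 0" using LM \<tau>0 by (simp add: D_def add_pos_pos)
  have "(1 - \<tau>) * (L - M * \<tau>) < 0"
  proof (rule mult_pos_neg)
    show "L - M * \<tau> < 0" using LM \<tau> by (simp add: mult.commute)
  qed (use \<tau> in simp)
  then have D: "D < L + M" using \<tau>0 by (simp add: D_def field_simps)
  have "1 < min (min ((\<gamma>2 + L0) / \<gamma>1) ((\<gamma>1 + L0) / \<gamma>2)) (min (y * \<rho>) ((L + M) / D))"
    using \<gamma>_less \<gamma>_pos assms \<rho>_pos D D_pos by (simp add: field_simps)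
  from dense[OF this] obtain z where
    z: "1 < z" "z < (\<gamma>2 + L0) / \<gamma>1" "z < (\<gamma>1 + L0) / \<gamma>2" "z < y * \<rho>" "z < (L + M) / D"
    unfolding min_less_iff_conj by blast
  have zD: "z * D < L + M" using z D_pos by (simp add: field_simps)
  have *: "L * (\<tau> / \<rho> * z - 1) = z * (M * \<tau>) - L" using LM \<rho>_pos by (simp add: field_simps)
  have "M * (\<rho> / \<tau> * z - 1) = z * (L / \<tau>) - M" using LM \<tau>0 by (simp add: field_simps)
  then have 2: "L * (\<tau> / \<rho> * z - 1) + M * (\<rho> / \<tau> * z - 1) \<le> 0"
    using * zD by (simp add: D_def distrib_left)
  define c where "c = L + M - z * D"
  have "M * (\<rho> * z - 1) = z * L - M" using LM by (simp add: field_simps)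
  moreover have "z * L \<le> z * (L / \<tau>)"
    using z \<tau> \<tau>0 LM(1) mult_left_le[of \<tau> L] by (intro mult_left_mono) (simp_all add: pos_le_divide_eq)
  ultimately have 3: "L * (\<tau> / \<rho> * z - 1) + M * (\<rho> * z - 1) \<le> - c"
    using * by (simp add: D_def distrib_left c_def)
  let ?E1 = "\<lambda>\<theta>. (L1 + L0) * (1 / (\<rho> * \<theta>) / z - 1) + L2 * (1 / (\<rho> * \<theta>) * z - 1)
       + M1 * (\<theta> * \<rho> * z - 1) + M2 * (\<theta> * \<rho> / z - 1)"
  let ?E2 = "\<lambda>\<theta>. L1 * (1 / (\<rho> * \<theta>) * z - 1) + (L2 + L0) * (1 / (\<rho> * \<theta>) / z - 1)
       + M1 * (\<theta> * \<rho> / z - 1) + M2 * (\<theta> * \<rho> * z - 1)"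
  have L0_eq: "L0 = \<rho> * M - L1 - L2" using LM by simp
  have "?E1 1 = (z - 1) / \<rho> * (\<gamma>1 - (\<gamma>2 + L0) / z)"
    unfolding \<gamma>1 \<gamma>2 L0_eq using z \<rho>_pos by (simp add: field_simps power2_eq_square)
  also have "\<dots> < 0" using z \<gamma>_pos \<rho>_pos by (intro mult_pos_neg) (simp_all add: field_simps)
  finally have E1: "?E1 1 < 0" .
  have "?E2 1 = (z - 1) / \<rho> * (\<gamma>2 - (\<gamma>1 + L0) / z)"
    unfolding \<gamma>1 \<gamma>2 L0_eq using z \<rho>_pos by (simp add: field_simps power2_eq_square)
  also have "\<dots> < 0" using z \<gamma>_pos \<rho>_pos by (intro mult_pos_neg) (simp_all add: field_simps)
  finally have E2: "?E2 1 < 0" .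
  \<comment> \<open>At \<open>\<theta> = 1\<close> both expressions are negative because
    \<open>z\<close> lies below the ratios in \<gamma>1, \<gamma>2, that is, because the difference
    is pulled towards 0. Continuity then allows some \<theta> below 1.\<close>
  have "(?E1 \<longlongrightarrow> ?E1 1) (at_left 1)" "(?E2 \<longlongrightarrow> ?E2 1) (at_left 1)"
    by ((intro tendsto_intros; use \<rho>_pos z in simp)+)
  then have "\<forall>\<^sub>F \<theta> in at_left 1. ?E1 \<theta> < 0" "\<forall>\<^sub>F \<theta> in at_left 1. ?E2 \<theta> < 0"
    using E1 E2 by (auto elim!: order_tendstoD)
  moreover have "\<forall>\<^sub>F \<theta> in at_left 1. \<theta> \<in> {0<..<1 :: real}"
    by (intro eventually_at_leftI[of 0]) auto
  ultimately have "\<forall>\<^sub>F \<theta> in at_left 1. ?E1 \<theta> < 0 \<and> ?E2 \<theta> < 0 \<and> \<theta> \<in> {0<..<1}"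
    by eventually_elim auto
  then obtain \<theta> where "?E1 \<theta> < 0" "?E2 \<theta> < 0" "0 < \<theta>" "\<theta> < 1"
    using eventually_happens'[OF trivial_limit_at_left_real] by (metis (no_types, lifting) greaterThanLessThan_iff)
  moreover have "z / \<rho> \<le> y" using z \<rho>_pos by (simp add: field_simps)
  moreover have "c > 0" using zD by (simp add: c_def)
  ultimately show thesis using that[of \<tau> z \<theta> c] \<tau> z 2 3 by simp
qed


lemma power_gap:
  fixes z :: real
  assumes z: "z \<noteq> 0"
  shows "z ^ gap (i + 1) j = z ^ gap i j * (if i < j then 1 / z else z)"
    and "z ^ gap i (j + 1) = z ^ gap i j * (if j < i then 1 / z else z)"
    and "i > 0 \<Longrightarrow> z ^ gap (i - 1) j = z ^ gap i j * (if j < i then 1 / z else z)"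
    and "j > 0 \<Longrightarrow> z ^ gap i (j - 1) = z ^ gap i j * (if i < j then 1 / z else z)"
proof -
  have up1: "z ^ gap (i + 1) j = z ^ gap i j * (if i < j then 1 / z else z)" for i j
  proof (cases "i < j")
    case True
    then have "gap i j = Suc (gap (i + 1) j)" by (auto simp: gap_def)
    then show ?thesis using True z by simp
  next
    case False
    then have "gap (i + 1) j = Suc (gap i j)" by (auto simp: gap_def)
    then show ?thesis using False by simp
  qed
  have sym: "gap i j = gap j i" for i j by (auto simp: gap_def)
  have up2: "z ^ gap i (j + 1) = z ^ gap i j * (if j < i then 1 / z else z)" for i j
    using up1[of j i] by (simp only: sym[of i])
  show "z ^ gap (i + 1) j = z ^ gap i j * (if i < j then 1 / z else z)"
    "z ^ gap i (j + 1) = z ^ gap i j * (if j < i then 1 / z else z)"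
    by (fact up1, fact up2)
  show "z ^ gap (i - 1) j = z ^ gap i j * (if j < i then 1 / z else z)" if "i > 0"
    using that up1[of "i - 1" j] z by auto
  show "z ^ gap i (j - 1) = z ^ gap i j * (if i < j then 1 / z else z)" if "j > 0"
    using that up2[of i "j - 1"] z by auto
qed

lemma gen_gap:
  fixes \<psi> :: "nat \<Rightarrow> real"
  assumes z: "z > 1" and \<psi>: "\<psi> (i + j) > 0"
    and u: "\<psi> (i + j + 1) = u * \<psi> (i + j)" and v: "i + j > 0 \<Longrightarrow> \<psi> (i + j - 1) = v * \<psi> (i + j)"
  defines "\<phi> \<equiv> \<lambda>i j. \<psi> (i + j) * z ^ gap i j"
  shows "gen \<phi> i j = \<phi> i j *
     (up1 i j * (u * (if i < j then 1 / z else z) - 1) + up2 i j * (u * (if j < i then 1 / z else z) - 1)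
      + down1 i j * (v * (if j < i then 1 / z else z) - 1) + down2 i j * (v * (if i < j then 1 / z else z) - 1))"
proof -
  note gap = power_gap[where z = z and i = i and j = j]
  have "z \<noteq> 0" using z by simp
  have "\<phi> (i + 1) j = \<phi> i j * (u * (if i < j then 1 / z else z))"
    using gap(1) z u by (simp add: \<phi>_def)
  moreover have "\<phi> i (j + 1) = \<phi> i j * (u * (if j < i then 1 / z else z))"
    using gap(2) z u by (simp add: \<phi>_def)
  moreover have "down1 i j * (\<phi> (i - 1) j - \<phi> i j) = down1 i j * (\<phi> i j * (v * (if j < i then 1 / z else z)) - \<phi> i j)"
  proof (cases "i = 0")
    case False
    then have "i - 1 + j = i + j - 1" by simp
    then have "\<phi> (i - 1) j = \<phi> i j * (v * (if j < i then 1 / z else z))"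
      using gap(3) False z v by (simp add: \<phi>_def)
    then show ?thesis by simp
  qed (simp add: down1_def)
  moreover have "down2 i j * (\<phi> i (j - 1) - \<phi> i j) = down2 i j * (\<phi> i j * (v * (if i < j then 1 / z else z)) - \<phi> i j)"
  proof (cases "j = 0")
    case False
    then have "i + (j - 1) = i + j - 1" by simp
    then have "\<phi> i (j - 1) = \<phi> i j * (v * (if i < j then 1 / z else z))"
      using gap(4) False z v by (simp add: \<phi>_def)
    then show ?thesis by simp
  qed (simp add: down2_def)
  ultimately show ?thesis
    unfolding gen_def by (simp only:) (simp add: algebra_simps)
qed

lemma down_add_le: "down1 i j + down2 i j \<le> M"
  using M1' M2' M_pos by (auto simp: down1_def down2_def)

text \<open>Positive drift is tolerated on the axes and, below level \<open>N\<close>, on the main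
  diagonal, where every move widens the gap. The axes are paid for by
  \<open>boundary_summable\<close>, through \<open>z / \<rho> \<le> y\<close>; the diagonal costs a
  bounded \<open>nu\<close> times a geometric series in \<theta>. Neither cost depends on
  \<open>N\<close>, so the bound is uniform in the target point.\<close>

lemma nu_geometric_bound:
  obtains C z where "z > 1" "\<And>i j. nu i j * z ^ gap i j \<le> C"
proof -
  obtain y where y: "y > 1 / \<rho>" "summable (\<lambda>j. q 0 j * y ^ j)" "summable (\<lambda>i. q i 0 * y ^ i)"
    by (rule boundary_summable)
  obtain \<tau> z \<theta> c where par: "\<rho> < \<tau>" "\<tau> < 1" "1 < z" "z / \<rho> \<le> y" "0 < \<theta>" "\<theta> < 1" "0 < c"
    and right: "L * (\<tau> / \<rho> * z - 1) + M * (\<rho> / \<tau> * z - 1) \<le> 0"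
    and level: "L * (\<tau> / \<rho> * z - 1) + M * (\<rho> * z - 1) \<le> - c"
    and left1: "(L1 + L0) * (1 / (\<rho> * \<theta>) / z - 1) + L2 * (1 / (\<rho> * \<theta>) * z - 1)
       + M1 * (\<theta> * \<rho> * z - 1) + M2 * (\<theta> * \<rho> / z - 1) \<le> 0"
    and left2: "L1 * (1 / (\<rho> * \<theta>) * z - 1) + (L2 + L0) * (1 / (\<rho> * \<theta>) / z - 1)
       + M1 * (\<theta> * \<rho> / z - 1) + M2 * (\<theta> * \<rho> * z - 1) \<le> 0"
    by (rule tightness_parameters[OF y(1)])
  obtain S where S: "S > 0" "\<And>n. mass n \<le> S" using mass_limit by metis
  have LM: "L > 0" "M > 0" using L_pos M_pos by auto
  have \<tau>0: "\<tau> > 0" using par \<rho>_pos by linarith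
  \<comment> \<open>\<open>K - c\<close> bounds the relative drift everywhere
    (\<open>gen_le_K\<close>); the additional \<open>c\<close> pays for \<open>g\<close> where level
    \<open>N\<close> meets an axis.\<close>
  define K where "K = L * (1 / (\<rho> * \<theta>) * z) + M * z + c"
  have K: "K \<ge> c" "K > 0" using LM par \<rho>_pos by (auto simp: K_def intro!: add_pos_pos add_nonneg_nonneg)
  define C where "C = K * (\<Sum>j. q 0 j * y ^ j) + K * (\<Sum>i. q i 0 * y ^ i) + K * S / (1 - \<theta>)"
  show thesis
  proof
    show "z > 1" by fact
    fix i0 j0 :: nat
    define N where "N = i0 + j0"
    \<comment> \<open>The kink of the weight at level \<open>N\<close> makes the drift of \<open>\<phi>\<close> strictly negative on that level.\<close>
    define w where "w n = (if n \<le> N then \<theta> ^ (N - n) else \<tau> ^ (n - N))" for n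
    define \<psi> where "\<psi> n = w n / \<rho> ^ n" for n
    define \<phi> where "\<phi> i j = \<psi> (i + j) * z ^ gap i j" for i j
    have w: "0 < w n" "w n \<le> 1" for n using par \<tau>0 by (auto simp: w_def power_le_one)
    have \<psi>_pos: "\<psi> n > 0" for n using w \<rho>_pos by (simp add: \<psi>_def)
    have \<phi>_pos: "\<phi> i j > 0" for i j using \<psi>_pos par by (simp add: \<phi>_def)
    define u where "u n = (if n < N then 1 / (\<rho> * \<theta>) else \<tau> / \<rho>)" for n
    define v where "v n = (if n \<le> N then \<theta> * \<rho> else \<rho> / \<tau>)" for n
    have u: "\<psi> (n + 1) = u n * \<psi> n" for n
    proof (cases "n < N")
      case True
      then have "N - n = Suc (N - Suc n)" by simp
      then have "\<theta> ^ (N - n) = \<theta> * \<theta> ^ (N - Suc n)" by (simp only: power_Suc)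
      then show ?thesis using True par \<rho>_pos by (simp add: \<psi>_def w_def u_def field_simps)
    next
      case False
      then show ?thesis using \<rho>_pos by (auto simp: \<psi>_def w_def u_def field_simps Suc_diff_le)
    qed
    have v: "\<psi> (n - 1) = v n * \<psi> n" if n: "n > 0" for n
    proof -
      obtain k where "n = Suc k" using n by (cases n) auto
      moreover have "1 = v (Suc k) * u k" using par \<rho>_pos \<tau>0 by (auto simp: v_def u_def)
      ultimately show ?thesis using u[of k] by simp
    qed
    have uv_pos: "u n > 0" "v n > 0" for n using par \<rho>_pos \<tau>0 by (auto simp: u_def v_def)
    have "\<tau> * \<theta> \<le> 1" using par \<tau>0 by (simp add: mult_le_one)
    then have uv_le: "u n \<le> 1 / (\<rho> * \<theta>)" "v n \<le> 1" for n
      using par \<rho>_pos \<tau>0 \<rho>_less(1) mult_le_one[of \<theta> \<rho>] by (auto simp: u_def v_def field_simps)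
    define b1 where "b1 i j = (if i = 0 then K * \<phi> i j else 0)" for i j :: nat
    define b2 where "b2 i j = (if j = 0 then K * \<phi> i j else 0)" for i j :: nat
    define b3 where "b3 i j = (if i = j \<and> i + j < N then K * \<phi> i j else 0)" for i j :: nat
    define g where "g i j = (if i + j = N then c * \<phi> i j else 0)" for i j
    have b_nonneg: "b1 i j \<ge> 0" "b2 i j \<ge> 0" "b3 i j \<ge> 0" for i j
      using K \<phi>_pos by (auto simp: b1_def b2_def b3_def less_imp_le)
    have gen_\<phi>: "gen \<phi> i j = \<phi> i j *
     (up1 i j * (u (i + j) * (if i < j then 1 / z else z) - 1) + up2 i j * (u (i + j) * (if j < i then 1 / z else z) - 1)
      + down1 i j * (v (i + j) * (if j < i then 1 / z else z) - 1) + down2 i j * (v (i + j) * (if i < j then 1 / z else z) - 1))"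
      for i j
      using gen_gap[of z \<psi> i j "u (i + j)" "v (i + j)"] par \<psi>_pos u v unfolding \<phi>_def by auto
    have z_le: "(if P then 1 / z else z) \<le> z" for P
    proof -
      have "1 / z \<le> 1" using par by simp
      then have "1 / z \<le> z" using par by linarith
      then show ?thesis by simp
    qed
    \<comment> \<open>Replacing every gap factor by \<open>z\<close> is good enough on and above
      level \<open>N\<close>. Below \<open>N\<close> the negative drift comes from closing the gap,
      and the exact \<open>gen_\<phi>\<close> is used.\<close>
    have crude: "gen \<phi> i j \<le> \<phi> i j * (L * (u (i + j) * z - 1) + (down1 i j + down2 i j) * (v (i + j) * z - 1))" for i j
    proof -
      have "up1 i j * (u (i + j) * (if i < j then 1 / z else z) - 1) + up2 i j * (u (i + j) * (if j < i then 1 / z else z) - 1)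
      + down1 i j * (v (i + j) * (if j < i then 1 / z else z) - 1) + down2 i j * (v (i + j) * (if i < j then 1 / z else z) - 1)
      \<le> up1 i j * (u (i + j) * z - 1) + up2 i j * (u (i + j) * z - 1)
      + down1 i j * (v (i + j) * z - 1) + down2 i j * (v (i + j) * z - 1)"
        by (intro add_mono mult_left_mono diff_right_mono z_le rates_nonneg less_imp_le[OF uv_pos(1)] less_imp_le[OF uv_pos(2)])
      also have "\<dots> = (up1 i j + up2 i j) * (u (i + j) * z - 1) + (down1 i j + down2 i j) * (v (i + j) * z - 1)"
        by (simp only: distrib_right)
      finally show ?thesis
        unfolding gen_\<phi> up_add using \<phi>_pos[of i j] by (intro mult_left_mono) auto
    qed
    have gen_le_K: "gen \<phi> i j \<le> (K - c) * \<phi> i j" for i j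
    proof -
      have "L * (u (i + j) * z - 1) \<le> L * (1 / (\<rho> * \<theta>) * z)"
      proof (rule mult_left_mono)
        have "u (i + j) * z \<le> 1 / (\<rho> * \<theta>) * z" using uv_le par by (intro mult_right_mono) auto
        then show "u (i + j) * z - 1 \<le> 1 / (\<rho> * \<theta>) * z" by linarith
      qed (use LM in auto)
      moreover have "(down1 i j + down2 i j) * (v (i + j) * z - 1) \<le> M * z"
      proof -
        have "v (i + j) * z \<le> 1 * z" using uv_le par by (intro mult_right_mono) auto
        then have "(down1 i j + down2 i j) * (v (i + j) * z - 1) \<le> (down1 i j + down2 i j) * z"
          using rates_nonneg[of i j] by (intro mult_left_mono) auto
        also have "\<dots> \<le> M * z" using down_add_le par by (intro mult_right_mono) auto
        finally show ?thesis .
      qed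
      ultimately have "L * (u (i + j) * z - 1) + (down1 i j + down2 i j) * (v (i + j) * z - 1) \<le> K - c"
        by (simp add: K_def)
      then have "\<phi> i j * (L * (u (i + j) * z - 1) + (down1 i j + down2 i j) * (v (i + j) * z - 1)) \<le> \<phi> i j * (K - c)"
        using \<phi>_pos[of i j] by (intro mult_left_mono) auto
      then show ?thesis using crude[of i j] by (simp add: mult.commute)
    qed
    have drift: "gen \<phi> i j \<le> (b1 i j + b2 i j + b3 i j) - g i j" for i j
    proof (cases "i = 0 \<or> j = 0 \<or> (i = j \<and> i + j < N)")
      case True
      then have "K * \<phi> i j \<le> b1 i j + b2 i j + b3 i j"
        using b_nonneg[of i j] by (auto simp: b1_def b2_def b3_def)
      moreover have "g i j \<le> c * \<phi> i j" using \<phi>_pos[of i j] par by (simp add: g_def)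
      ultimately show ?thesis using gen_le_K[of i j] by (simp add: left_diff_distrib)
    next
      case False
      then have b0: "b1 i j + b2 i j + b3 i j = 0" by (auto simp: b1_def b2_def b3_def)
      have d: "down1 i j = M1" "down2 i j = M2" using False by (auto simp: down1_def down2_def)
      consider "i + j < N" "i < j" | "i + j < N" "j < i" | "i + j = N" | "i + j > N"
        using False by linarith
      then show ?thesis
      proof cases
        case 1
        have "up1 i j = L1 + L0" "up2 i j = L2" using 1 by (auto simp: up1_def up2_def h_def)
        then have "gen \<phi> i j \<le> 0"
          unfolding gen_\<phi> d using left1 1 \<phi>_pos[of i j] by (intro mult_nonneg_nonpos) (auto simp: u_def v_def)
        then show ?thesis using b0 1 by (simp add: g_def)
      next
        case 2
        have "up1 i j = L1" "up2 i j = L2 + L0" using 2 by (auto simp: up1_def up2_def h_def)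
        then have "gen \<phi> i j \<le> 0"
          unfolding gen_\<phi> d using left2 2 \<phi>_pos[of i j] by (intro mult_nonneg_nonpos) (auto simp: u_def v_def)
        then show ?thesis using b0 2 by (simp add: g_def)
      next
        case 3
        have "M * (\<theta> * \<rho> * z - 1) \<le> M * (\<rho> * z - 1)"
          using par \<rho>_pos LM by (intro mult_left_mono diff_right_mono mult_right_mono) (auto simp: mult_left_le_one_le)
        then have "L * (\<tau> / \<rho> * z - 1) + M * (\<theta> * \<rho> * z - 1) \<le> - c" using level by linarith
        then have "\<phi> i j * (L * (\<tau> / \<rho> * z - 1) + M * (\<theta> * \<rho> * z - 1)) \<le> \<phi> i j * (- c)"
          using \<phi>_pos[of i j] by (intro mult_left_mono) auto
        then have "gen \<phi> i j \<le> - c * \<phi> i j"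
          using crude[of i j] 3 by (simp add: d u_def v_def mult.commute)
        then show ?thesis using b0 3 by (simp add: g_def)
      next
        case 4
        have "gen \<phi> i j \<le> \<phi> i j * (L * (\<tau> / \<rho> * z - 1) + M * (\<rho> / \<tau> * z - 1))"
          using crude[of i j] 4 by (simp add: d u_def v_def)
        also have "\<dots> \<le> 0" using right \<phi>_pos[of i j] by (intro mult_nonneg_nonpos) auto
        finally show ?thesis using b0 4 by (simp add: g_def)
      qed
    qed
    have edge: "0 \<le> p * (K * (w n / \<rho> ^ n * z ^ n))" "p * (K * (w n / \<rho> ^ n * z ^ n)) \<le> K * (p * y ^ n)" if "p > 0" for p n
    proof -
      show "0 \<le> p * (K * (w n / \<rho> ^ n * z ^ n))" using that K w[of n] \<rho>_pos par by simp
      have "w n / \<rho> ^ n * z ^ n = w n * (z / \<rho>) ^ n" by (simp add: power_divide)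
      also have "\<dots> \<le> 1 * y ^ n"
        using w[of n] par \<rho>_pos by (intro mult_mono power_mono) auto
      finally show "p * (K * (w n / \<rho> ^ n * z ^ n)) \<le> K * (p * y ^ n)"
        using that K mult_left_mono[of "w n / \<rho> ^ n * z ^ n" "y ^ n" "p * K"] by (simp add: algebra_simps)
    qed
    have \<phi>_edge: "\<phi> 0 n = w n / \<rho> ^ n * z ^ n" "\<phi> n 0 = w n / \<rho> ^ n * z ^ n" for n
      by (auto simp: \<phi>_def \<psi>_def gap_def)
    let ?B1 = "\<Sum>j. q 0 j * (K * \<phi> 0 j)" and ?B2 = "\<Sum>i. q i 0 * (K * \<phi> i 0)"
    let ?B3 = "\<Sum>m | 2 * m < N. q m m * (K * \<phi> m m)"
    have B1: "((\<lambda>j. q 0 j * (K * \<phi> 0 j)) has_sum ?B1) UNIV" "?B1 \<le> K * (\<Sum>j. q 0 j * y ^ j)"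
      using sum_axis_le[of "\<lambda>j. q 0 j * (K * \<phi> 0 j)" K "\<lambda>j. q 0 j * y ^ j"] edge[OF q_pos] y
      unfolding \<phi>_edge by auto
    have B2: "((\<lambda>i. q i 0 * (K * \<phi> i 0)) has_sum ?B2) UNIV" "?B2 \<le> K * (\<Sum>i. q i 0 * y ^ i)"
      using sum_axis_le[of "\<lambda>i. q i 0 * (K * \<phi> i 0)" K "\<lambda>i. q i 0 * y ^ i"] edge[OF q_pos] y
      unfolding \<phi>_edge by auto
    have fin: "finite {m. 2 * m < N}" by (rule finite_subset[of _ "{..N}"]) auto
    have B3: "?B3 \<le> K * S / (1 - \<theta>)"
    proof -
      have "?B3 \<le> (\<Sum>m | 2 * m < N. K * S * \<theta> ^ (N - 2 * m))"
      proof (rule sum_mono)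
        fix m assume "m \<in> {m. 2 * m < N}"
        then have "q m m * (K * \<phi> m m) = K * nu m m * \<theta> ^ (N - 2 * m)"
          by (simp add: \<phi>_def \<psi>_def w_def gap_def nu_def mult_2)
        also have "\<dots> \<le> K * S * \<theta> ^ (N - 2 * m)"
          using K par order_trans[OF nu_le_mass S(2), of m m] by (intro mult_right_mono mult_left_mono) auto
        finally show "q m m * (K * \<phi> m m) \<le> K * S * \<theta> ^ (N - 2 * m)" .
      qed
      also have "\<dots> = K * S * (\<Sum>m | 2 * m < N. \<theta> ^ (N - 2 * m))" by (simp add: sum_distrib_left)
      also have "(\<Sum>m | 2 * m < N. \<theta> ^ (N - 2 * m)) = (\<Sum>k\<in>(\<lambda>m. N - 2 * m) ` {m. 2 * m < N}. \<theta> ^ k)"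
        by (subst sum.reindex) (auto simp: inj_on_def)
      also have "\<dots> \<le> (\<Sum>k. \<theta> ^ k)"
        using fin par by (intro sum_le_suminf) (auto intro!: summable_geometric)
      also have "(\<Sum>k. \<theta> ^ k) = 1 / (1 - \<theta>)" using par by (intro suminf_geometric) auto
      finally show ?thesis using K S by (simp add: mult_left_mono)
    qed
    have 1: "((\<lambda>(i, j). q i j * b1 i j) has_sum ?B1) UNIV"
      by (rule has_sum_supported[of "Pair 0" UNIV]) (use B1 in \<open>auto simp: b1_def inj_on_def image_iff\<close>)
    have 2: "((\<lambda>(i, j). q i j * b2 i j) has_sum ?B2) UNIV"
      by (rule has_sum_supported[of "\<lambda>i. (i, 0)" UNIV]) (use B2 in \<open>auto simp: b2_def inj_on_def image_iff\<close>)
    have 3: "((\<lambda>(i, j). q i j * b3 i j) has_sum ?B3) UNIV"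
      by (rule has_sum_supported[of "\<lambda>m. (m, m)" "{m. 2 * m < N}"])
        (auto simp: b3_def inj_on_def image_iff fin intro!: has_sum_finiteI sum.cong)
    have "((\<lambda>(i, j). q i j * (b1 i j + b2 i j + b3 i j)) has_sum (?B1 + ?B2 + ?B3)) UNIV"
      using has_sum_add[OF has_sum_add[OF 1 2] 3] by (simp add: case_prod_unfold distrib_left)
    then have "(\<Sum>(i, j)\<in>{(i0, j0)}. q i j * g i j) \<le> ?B1 + ?B2 + ?B3"
    proof (rule foster_lyapunov[rotated 4])
      show "gen \<phi> i j \<le> b1 i j + b2 i j + b3 i j - g i j" for i j by (rule drift)
      show "0 \<le> \<phi> i j" for i j using \<phi>_pos[of i j] by simp
      show "0 \<le> b1 i j + b2 i j + b3 i j" for i j using b_nonneg[of i j] by simp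
      show "0 \<le> g i j" for i j using \<phi>_pos[of i j] par by (simp add: g_def)
    qed simp
    then have "q i0 j0 * g i0 j0 \<le> C" using B1 B2 B3 by (simp add: C_def)
    moreover have "q i0 j0 * g i0 j0 = c * (nu i0 j0 * z ^ gap i0 j0)"
      by (simp add: g_def N_def[symmetric] \<phi>_def \<psi>_def w_def nu_def)
    ultimately show "nu i0 j0 * z ^ gap i0 j0 \<le> C / c" using par by (simp add: field_simps)
  qed
qed

end

text \<open>The Bregman divergence of the convex function $u \mapsto 1 / (1 + u)$.\<close>

definition breg :: "real \<Rightarrow> real \<Rightarrow> real" where
  "breg v u = (v - u)\<^sup>2 / ((1 + u)\<^sup>2 * (1 + v))"

lemma breg_eq:
  assumes "u \<ge> 0" "v \<ge> 0"
  shows "breg v u = 1 / (1 + v) - 1 / (1 + u) + (v - u) / (1 + u)\<^sup>2"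
proof -
  have "(b - a)\<^sup>2 / (a\<^sup>2 * b) = 1 / b - 1 / a + (b - a) / a\<^sup>2" if "a \<noteq> 0" "b \<noteq> 0" for a b :: real
    using that by (simp add: field_simps power2_eq_square)
  from this[of "1 + u" "1 + v"] show ?thesis using assms by (simp add: breg_def)
qed

lemma breg_nonneg: "u \<ge> 0 \<Longrightarrow> v \<ge> 0 \<Longrightarrow> breg v u \<ge> 0"
  by (simp add: breg_def)

text \<open>The second derivative \<open>2 / (1 + u) ^ 3\<close> is bounded away from 0 only on
  bounded ranges, hence the factor in \<open>U\<close>.\<close>

lemma breg_ge:
  assumes "0 \<le> u" "u \<le> U" "0 \<le> v" "v \<le> U"
  shows "(v - u)\<^sup>2 \<le> (1 + U) ^ 3 * breg v u"
proof -
  have pos: "0 < (1 + u)\<^sup>2 * (1 + v)" using assms by auto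
  have "(1 + u)\<^sup>2 * (1 + v) \<le> (1 + U)\<^sup>2 * (1 + U)"
    using assms by (intro mult_mono power_mono) auto
  then have "(v - u)\<^sup>2 * ((1 + u)\<^sup>2 * (1 + v)) \<le> (v - u)\<^sup>2 * (1 + U) ^ 3"
    by (intro mult_left_mono) (auto simp: power3_eq_cube power2_eq_square)
  then show ?thesis using pos by (simp add: breg_def field_simps)
qed

text \<open>Dominated convergence in \<open>k\<close>, in a form that does not presuppose
  convergence of \<open>w\<close>. It is applied with \<open>w m = nu m m\<close>, whose convergence
  is then deduced from that of the sums.\<close>

lemma diagonal_dominated_sums:
  fixes T :: "nat \<Rightarrow> nat \<Rightarrow> real"
  assumes lim: "\<And>k. (\<lambda>m. T m k - e k * w m) \<longlonglongrightarrow> 0"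
    and T: "\<And>m k. k \<le> m \<Longrightarrow> \<bar>T m k\<bar> \<le> s k" and s: "summable s" "\<And>k. 0 \<le> s k"
    and e: "summable e" "\<And>k. 0 \<le> e k" and w: "\<And>m. \<bar>w m\<bar> \<le> S"
  shows "(\<lambda>m. (\<Sum>k\<le>m. T m k) - w m * suminf e) \<longlonglongrightarrow> 0"
proof -
  define a where "a k m = (if k \<le> m then T m k else 0) - e k * w m" for k m
  have "(\<lambda>m. a k m) \<longlonglongrightarrow> 0" for k
    using lim[of k] by (rule Lim_transform_eventually)
      (use eventually_ge_at_top[of k] in eventually_elim, simp add: a_def)
  moreover have "norm (a k m) \<le> s k + S * e k" for k m
  proof -
    have "\<bar>e k * w m\<bar> \<le> S * e k"
      using e(2)[of k] w[of m] mult_left_mono[of "\<bar>w m\<bar>" S "e k"]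
      by (simp add: abs_mult mult.commute)
    then show ?thesis using T[of k m] s(2)[of k] by (auto simp: a_def)
  qed
  moreover have "summable (\<lambda>k. s k + S * e k)" using s e by (intro summable_add summable_mult)
  ultimately have "(\<lambda>m. suminf (\<lambda>k. a k m)) \<longlonglongrightarrow> suminf (\<lambda>k. 0)"
    by (intro tannerys_theorem[of a "\<lambda>_. 0" sequentially "\<lambda>k. s k + S * e k", THEN conjunct2, THEN conjunct2])
      (simp_all add: case_prod_unfold)
  moreover have "suminf (\<lambda>k. a k m) = (\<Sum>k\<le>m. T m k) - w m * suminf e" for m
  proof -
    have "(\<lambda>k. if k \<le> m then T m k else 0) sums (\<Sum>k\<le>m. T m k)"
      using sums_If_finite_set[of "{..m}" "T m"] by simp
    moreover have "(\<lambda>k. e k * w m) sums (suminf e * w m)"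
      using e by (intro sums_mult2 summable_sums)
    ultimately show ?thesis
      unfolding a_def by (simp add: sums_diff sums_unique[symmetric] mult.commute)
  qed
  ultimately show ?thesis by simp
qed

section \<open>The difference coordinate and its stationary weights\<close>

context gjsq_invariant begin

text \<open>Under the tilted walk, \<open>l\<close> goes up at rate
  \<open>(\<gamma>1 + L0 * h (- l)) / \<rho>\<close> and down at rate
  \<open>(\<gamma>2 + L0 * h l) / \<rho>\<close>; this is its reversing measure with
  \<open>eta 0 = 1\<close>. The prefactors come from the tie at \<open>l = 0\<close>, where
  \<open>h\<close> is 1/2.\<close>

definition eta :: "int \<Rightarrow> real" where
  "eta l = (if l \<le> -1 then (\<gamma>2 + L0 / 2) / \<gamma>2 * (\<gamma>2 / (\<gamma>1 + L0)) ^ nat \<bar>l\<bar>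
     else if l = 0 then 1 else (\<gamma>1 + L0 / 2) / \<gamma>1 * (\<gamma>1 / (\<gamma>2 + L0)) ^ nat l)"

lemma \<gamma>_pos: "\<gamma>1 > 0" "\<gamma>2 > 0"
  using \<gamma>1 \<gamma>2 L_pos M_pos by (auto intro!: add_nonneg_pos)

lemma eta_pos: "eta l > 0"
  using \<gamma>_pos L_pos by (auto simp: eta_def intro!: mult_pos_pos divide_pos_pos add_pos_pos)

lemma eta_detailed_balance: "(\<gamma>2 + L0 * h (l + 1)) * eta (l + 1) = (\<gamma>1 + L0 * h (- l)) * eta l"
proof -
  have nz: "\<gamma>1 \<noteq> 0" "\<gamma>2 \<noteq> 0" "\<gamma>1 + L0 \<noteq> 0" "\<gamma>2 + L0 \<noteq> 0"
    using \<gamma>_pos L_pos by auto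
  have cancel: "c * (a / b * (b / c)) = a" if "b \<noteq> 0" "c \<noteq> 0" for a b c :: real
    using that by simp
  consider "l \<ge> 1" | "l = 0" | "l = -1" | "l \<le> -2" by linarith
  then show ?thesis
  proof cases
    case 1
    then have "nat (l + 1) = Suc (nat l)" by simp
    then have "eta (l + 1) = \<gamma>1 / (\<gamma>2 + L0) * eta l" using 1 by (simp add: eta_def)
    then show ?thesis using 1 nz by (simp add: h_def)
  next
    case 4
    then have "nat \<bar>l\<bar> = Suc (nat \<bar>l + 1\<bar>)" by simp
    then have "eta l = \<gamma>2 / (\<gamma>1 + L0) * eta (l + 1)" using 4 by (simp add: eta_def)
    then show ?thesis using 4 nz by (simp add: h_def)
  next
    case 2
    then show ?thesis using nz cancel[of \<gamma>1 "\<gamma>2 + L0" "\<gamma>1 + L0 / 2"] by (simp add: eta_def h_def)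
  next
    case 3
    then show ?thesis using nz cancel[of \<gamma>2 "\<gamma>1 + L0" "\<gamma>2 + L0 / 2"] by (simp add: eta_def h_def)
  qed
qed

text \<open>Detailed balance over the two edges at \<open>l\<close>, added up; \<open>L + M\<close>
  is the total jump rate \<open>(\<gamma>1 + \<gamma>2 + L0) / \<rho>\<close>, because
  \<open>h l + h (- l) = 1\<close>.\<close>

lemma eta_balance:
  "(L + M) * eta l = ((L1 + L0 * h (l + 1)) / \<rho> + \<rho> * M2) * eta (l + 1)
     + ((L2 + L0 * h (1 - l)) / \<rho> + \<rho> * M1) * eta (l - 1)"
proof -
  have 1: "(L1 + L0 * h (l + 1)) / \<rho> + \<rho> * M2 = (\<gamma>2 + L0 * h (l + 1)) / \<rho>"
    and 2: "(L2 + L0 * h (1 - l)) / \<rho> + \<rho> * M1 = (\<gamma>1 + L0 * h (1 - l)) / \<rho>"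
    using \<rho>_pos by (simp_all add: \<gamma>1 \<gamma>2 field_simps power2_eq_square)
  have 3: "L + M = (\<gamma>1 + \<gamma>2 + L0) / \<rho>"
    using \<rho>_pos \<rho>_eq by (simp add: \<gamma>1 \<gamma>2 field_simps power2_eq_square) algebra
  have "(\<gamma>2 + L0 * h (l + 1)) * eta (l + 1) = (\<gamma>1 + L0 * h (- l)) * eta l"
    "(\<gamma>1 + L0 * h (1 - l)) * eta (l - 1) = (\<gamma>2 + L0 * h l) * eta l"
    using eta_detailed_balance[of l] eta_detailed_balance[of "l - 1"] by simp_all
  moreover have "(\<gamma>1 + L0 * h (- l)) * eta l + (\<gamma>2 + L0 * h l) * eta l = (\<gamma>1 + \<gamma>2 + L0) * eta l"
  proof -
    have "h (- l) = 1 - h l" using h_add_minus[of l] by simp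
    show ?thesis unfolding \<open>h (- l) = 1 - h l\<close> by (simp add: algebra_simps)
  qed
  ultimately show ?thesis
    unfolding 1 2 3 times_divide_eq_left add_divide_distrib[symmetric] by simp
qed

lemma eta_summable: "summable (\<lambda>k. eta (int k))" "summable (\<lambda>k. eta (- int k))"
proof -
  have g: "norm (\<gamma>1 / (\<gamma>2 + L0)) < 1" "norm (\<gamma>2 / (\<gamma>1 + L0)) < 1"
    using \<gamma>_pos L_pos \<gamma>_less by auto
  have "summable (\<lambda>k. (\<gamma>1 + L0 / 2) / \<gamma>1 * (\<gamma>1 / (\<gamma>2 + L0)) ^ k)"
    by (intro summable_mult summable_geometric g)
  then show "summable (\<lambda>k. eta (int k))"
    by (rule summable_cong[THEN iffD1, rotated])
      (use eventually_gt_at_top[of 0] in eventually_elim, simp add: eta_def)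
  have "summable (\<lambda>k. (\<gamma>2 + L0 / 2) / \<gamma>2 * (\<gamma>2 / (\<gamma>1 + L0)) ^ k)"
    by (intro summable_mult summable_geometric g)
  then show "summable (\<lambda>k. eta (- int k))"
    by (rule summable_cong[THEN iffD1, rotated])
      (use eventually_gt_at_top[of 0] in eventually_elim, simp add: eta_def)
qed

text \<open>Uniformity over finite sets makes this applicable to every region on which
  \<open>j - i\<close> is injective.\<close>

lemma eta_sum_bounded:
  obtains H where "\<And>A. finite A \<Longrightarrow> (\<Sum>l\<in>A. eta l) \<le> H"
proof
  fix A :: "int set" assume A: "finite A"
  define n where "n = Max (insert 0 ((\<lambda>l. nat \<bar>l\<bar>) ` A))"
  have n: "nat \<bar>l\<bar> \<le> n" if "l \<in> A" for l
    unfolding n_def using A that by (intro Max_ge) auto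
  have sub: "A \<subseteq> int ` {..n} \<union> (\<lambda>k. - int k) ` {..n}"
  proof
    fix l assume "l \<in> A"
    then have "nat \<bar>l\<bar> \<in> {..n}" using n by simp
    moreover have "l = int (nat \<bar>l\<bar>) \<or> l = - int (nat \<bar>l\<bar>)" by linarith
    ultimately show "l \<in> int ` {..n} \<union> (\<lambda>k. - int k) ` {..n}" by blast
  qed
  have "(\<Sum>l\<in>A. eta l) \<le> (\<Sum>l\<in>int ` {..n} \<union> (\<lambda>k. - int k) ` {..n}. eta l)"
    using sub by (intro sum_mono2) (auto intro: less_imp_le eta_pos)
  also have "\<dots> \<le> (\<Sum>l\<in>int ` {..n}. eta l) + (\<Sum>l\<in>(\<lambda>k. - int k) ` {..n}. eta l)"
    by (simp add: sum_Un sum_nonneg less_imp_le eta_pos)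
  also have "\<dots> = (\<Sum>k\<le>n. eta (int k)) + (\<Sum>k\<le>n. eta (- int k))"
    by (subst (1 2) sum.reindex) (auto simp: inj_on_def)
  also have "\<dots> \<le> (\<Sum>k. eta (int k)) + (\<Sum>k. eta (- int k))"
    by (intro add_mono sum_le_suminf eta_summable) (auto intro: less_imp_le eta_pos)
  finally show "(\<Sum>l\<in>A. eta l) \<le> (\<Sum>k. eta (int k)) + (\<Sum>k. eta (- int k))" .
qed

text \<open>The test function is the indicator of one point. With both coordinates positive, only
  the interior service rates lead into and out of that point.\<close>

lemma q_balance:
  assumes "i > 0" "j > 0"
  shows "(L + M) * q i j = up1 (i - 1) j * q (i - 1) j + up2 i (j - 1) * q i (j - 1)
     + M1 * q (i + 1) j + M2 * q i (j + 1)"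
proof -
  define V where "V a b = (if a = i \<and> b = j then 1 else 0 :: real)" for a b
  let ?D = "{(i, j), (i - 1, j), (i, j - 1), (i + 1, j), (i, j + 1)}"
  have gen_V: "gen V a b = (if (a, b) = (i, j) then - (L + M) else if (a, b) = (i - 1, j) then up1 a b
      else if (a, b) = (i, j - 1) then up2 a b else if (a, b) = (i + 1, j) then M1
      else if (a, b) = (i, j + 1) then M2 else 0)" for a b
  proof -
    have "gen V i j = - (up1 i j + up2 i j) - (M1 + M2)"
      using assms by (cases i; cases j) (simp_all add: gen_def V_def down1_def down2_def)
    then have "gen V i j = - (L + M)" by (simp add: up_add)
    moreover have "gen V (i - 1) j = up1 (i - 1) j" "gen V i (j - 1) = up2 i (j - 1)"
      "gen V (i + 1) j = M1" "gen V i (j + 1) = M2"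
      using assms by (cases i; cases j; simp add: gen_def V_def down1_def down2_def)+
    moreover have "gen V a b = 0" if "(a, b) \<notin> ?D"
    proof -
      have "V a b = 0" "V (a + 1) b = 0" "V a (b + 1) = 0" using that assms by (auto simp: V_def)
      moreover have "V (a - 1) b = 0" "V a (b - 1) = 0"
        using that assms by (cases a; cases b; auto simp: V_def)+
      ultimately show ?thesis by (simp add: gen_def)
    qed
    ultimately show ?thesis by auto
  qed
  have "((\<lambda>(a, b). q a b * gen V a b) has_sum 0) UNIV"
    by (rule gen_invariant[of _ 1]) (simp add: V_def)
  moreover have "((\<lambda>(a, b). q a b * gen V a b) has_sum (\<Sum>(a, b)\<in>?D. q a b * gen V a b)) UNIV"
    by (rule has_sum_supported[of id ?D]) (auto simp: gen_V split: if_splits)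
  ultimately have "0 = (\<Sum>(a, b)\<in>?D. q a b * gen V a b)"
    by (rule has_sum_unique)
  then show ?thesis using assms by (cases i; cases j) (simp_all add: gen_V algebra_simps)
qed

abbreviation eta' :: "nat \<Rightarrow> nat \<Rightarrow> real" where "eta' i j \<equiv> eta (int j - int i)"

section \<open>Increments of the density\<close>

definition dens :: "nat \<Rightarrow> nat \<Rightarrow> real" where "dens i j = nu i j / eta' i j"

lemma dens_pos: "dens i j > 0"
  by (simp add: dens_def nu_pos eta_pos)

definition into1 :: "nat \<Rightarrow> nat \<Rightarrow> real" where "into1 i j = up1 i j / \<rho>"
definition into2 :: "nat \<Rightarrow> nat \<Rightarrow> real" where "into2 i j = up2 i j / \<rho>"

text \<open>By \<open>nu_balance\<close> and \<open>eta'_balance\<close>, \<open>dens i j\<close> is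
  a weighted mean of its values at the four predecessors in the tilted walk. Up to a factor, this is
  the defect in Jensen's inequality for 1 / (1 + u), written as a sum of nonnegative terms. It is
  evaluated at positive \<open>i\<close> and \<open>j\<close> only.\<close>

definition energy :: "nat \<Rightarrow> nat \<Rightarrow> real" where
  "energy i j = into1 (i - 1) j * eta' (i - 1) j * breg (dens (i - 1) j) (dens i j)
     + into2 i (j - 1) * eta' i (j - 1) * breg (dens i (j - 1)) (dens i j)
     + \<rho> * M1 * eta' (i + 1) j * breg (dens (i + 1) j) (dens i j)
     + \<rho> * M2 * eta' i (j + 1) * breg (dens i (j + 1)) (dens i j)"

lemma into_bounds: "L1 / \<rho> \<le> into1 i j" "L2 / \<rho> \<le> into2 i j" "0 \<le> into1 i j" "0 \<le> into2 i j"
  using up_bounds rates_nonneg \<rho>_pos by (auto simp: into1_def into2_def divide_right_mono)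

lemma into_add: "into1 i j + into2 i j + \<rho> * M1 + \<rho> * M2 = L + M"
proof -
  have "into1 i j + into2 i j = L / \<rho>"
    by (simp only: into1_def into2_def add_divide_distrib[symmetric] up_add)
  also have "\<dots> = M" using \<rho>_pos by (simp flip: \<rho>_eq)
  finally show ?thesis using \<rho>_eq by (simp add: algebra_simps)
qed

lemma nu_balance:
  assumes "i > 0" "j > 0"
  shows "(L + M) * nu i j = into1 (i - 1) j * nu (i - 1) j + into2 i (j - 1) * nu i (j - 1)
     + \<rho> * M1 * nu (i + 1) j + \<rho> * M2 * nu i (j + 1)"
proof -
  obtain k where k: "i + j = Suc k" using assms by (cases i) auto
  have "nu (i - 1) j = \<rho> * q (i - 1) j / \<rho> ^ (i + j)" "nu i (j - 1) = \<rho> * q i (j - 1) / \<rho> ^ (i + j)"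
    using assms \<rho>_pos by (cases i; cases j; simp add: nu_def)+
  moreover have "nu (i + 1) j = q (i + 1) j / \<rho> / \<rho> ^ (i + j)" "nu i (j + 1) = q i (j + 1) / \<rho> / \<rho> ^ (i + j)"
    using \<rho>_pos by (simp_all add: nu_def)
  ultimately have "into1 (i - 1) j * nu (i - 1) j + into2 i (j - 1) * nu i (j - 1)
     + \<rho> * M1 * nu (i + 1) j + \<rho> * M2 * nu i (j + 1)
     = (up1 (i - 1) j * q (i - 1) j + up2 i (j - 1) * q i (j - 1) + M1 * q (i + 1) j + M2 * q i (j + 1)) / \<rho> ^ (i + j)"
    using \<rho>_pos by (simp add: into1_def into2_def add_divide_distrib)
  then show ?thesis by (simp only: q_balance[OF assms, symmetric] nu_def times_divide_eq_right)
qed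

lemma eta'_balance:
  assumes "i > 0" "j > 0"
  shows "(L + M) * eta' i j = into1 (i - 1) j * eta' (i - 1) j + into2 i (j - 1) * eta' i (j - 1)
     + \<rho> * M1 * eta' (i + 1) j + \<rho> * M2 * eta' i (j + 1)"
proof -
  have 1: "int j - int (i - 1) = (int j - int i) + 1" "int (j - 1) - int i = (int j - int i) - 1"
    "int j - int (i + 1) = (int j - int i) - 1" "int (j + 1) - int i = (int j - int i) + 1"
    "int i - int (j - 1) = 1 - (int j - int i)"
    using assms by auto
  show ?thesis unfolding into1_def into2_def up1_def up2_def 1
    by (subst eta_balance) (simp add: algebra_simps)
qed

text \<open>The parts of \<open>breg\<close> that are linear in the density of the predecessor
  cancel, by the mean value property of \<open>dens\<close>; the differences of 1 / (1 + u)
  remain.\<close>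

lemma energy_eq:
  assumes "i > 0" "j > 0"
  defines "e \<equiv> \<lambda>i j. eta' i j / (1 + dens i j)"
  shows "energy i j = into1 (i - 1) j * e (i - 1) j + into2 i (j - 1) * e i (j - 1)
     + \<rho> * M1 * e (i + 1) j + \<rho> * M2 * e i (j + 1) - (L + M) * e i j"
proof -
  have nu: "eta' a b * dens a b = nu a b" for a b
    using eta_pos[of "int b - int a"] by (simp add: dens_def)
  define u where "u = dens i j"
  have u: "u \<ge> 0" "dens a b \<ge> 0" for a b using dens_pos by (auto simp: u_def intro: less_imp_le)
  have b: "c * eta' a b * breg (dens a b) u
     = c * e a b - (1 / (1 + u) + u / (1 + u)\<^sup>2) * (c * eta' a b) + 1 / (1 + u)\<^sup>2 * (c * nu a b)" for c a b
    unfolding breg_eq[OF u] nu[symmetric] by (simp add: e_def algebra_simps diff_divide_distrib)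
  have "energy i j = into1 (i - 1) j * e (i - 1) j + into2 i (j - 1) * e i (j - 1)
     + \<rho> * M1 * e (i + 1) j + \<rho> * M2 * e i (j + 1)
     - (1 / (1 + u) + u / (1 + u)\<^sup>2) * ((L + M) * eta' i j) + 1 / (1 + u)\<^sup>2 * ((L + M) * nu i j)"
    unfolding energy_def u_def[symmetric] b nu_balance[OF assms(1,2)] eta'_balance[OF assms(1,2)]
    by (simp only: distrib_left)
  also have "1 / (1 + u)\<^sup>2 * ((L + M) * nu i j) = u / (1 + u)\<^sup>2 * ((L + M) * eta' i j)"
    using nu[where a = i and b = j] by (simp add: u_def mult.commute)
  finally have "energy i j = into1 (i - 1) j * e (i - 1) j + into2 i (j - 1) * e i (j - 1)
     + \<rho> * M1 * e (i + 1) j + \<rho> * M2 * e i (j + 1) - 1 / (1 + u) * ((L + M) * eta' i j)"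
    by (simp only: distrib_right)
  also have "1 / (1 + u) * ((L + M) * eta' i j) = (L + M) * e i j" by (simp add: e_def u_def)
  finally show ?thesis .
qed

text \<open>
  Summed over a region, \<open>energy_eq\<close> telescopes to its boundary, where \<open>e \<le> \<eta>\<close> is summable.
\<close>

lemma energy_sum_bounded:
  obtains C where "\<And>F. finite F \<Longrightarrow> F \<subseteq> {0<..} \<times> {0<..} \<Longrightarrow> (\<Sum>(i, j)\<in>F. energy i j) \<le> C"
proof -
  obtain H where H: "\<And>A. finite A \<Longrightarrow> (\<Sum>l\<in>A. eta l) \<le> H" by (rule eta_sum_bounded) blast
  define e where "e = (\<lambda>i j. eta' i j / (1 + dens i j))"
  have e: "0 < e i j" "e i j \<le> eta' i j" for i j
    using eta_pos[of "int j - int i"] dens_pos[of i j] by (auto simp: e_def field_simps)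
  show thesis
  proof
    fix F :: "(nat \<times> nat) set" assume F: "finite F" "F \<subseteq> {0<..} \<times> {0<..}"
    define N where "N = Max (insert 0 ((\<lambda>(i, j). i + j) ` F))"
    define I where "I = {(i, j). i > 0 \<and> j > 0 \<and> i + j \<le> N}"
    define J where "J = {(i, j). i + j \<le> Suc N}"
    have fin: "finite J" "finite I"
      by (rule finite_subset[of _ "{..Suc N} \<times> {..Suc N}"]; auto simp: I_def J_def)+
    have "F \<subseteq> I"
    proof
      fix x assume x: "x \<in> F"
      then have "(\<lambda>(i, j). i + j) x \<le> N" unfolding N_def using F by (intro Max_ge) auto
      then show "x \<in> I" using x F by (auto simp: I_def)
    qed
    \<comment> \<open>Each inflow into \<open>I\<close> is reindexed by its source, which lies in
      \<open>J\<close>, and then extended to all of \<open>J\<close>. By \<open>into_add\<close> the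
      outflows of a point add up to \<open>(L + M) * e\<close>, so only the sum over
      \<open>J - I\<close> survives.\<close>
    have shift: "(\<Sum>(i, j)\<in>I. r (a i j) (b i j) * e (a i j) (b i j)) \<le> (\<Sum>(i, j)\<in>J. r i j * e i j)"
      if inj: "\<And>i j i' j'. (i, j) \<in> I \<Longrightarrow> (i', j') \<in> I \<Longrightarrow> a i j = a i' j' \<Longrightarrow> b i j = b i' j' \<Longrightarrow> i = i' \<and> j = j'"
        and J: "\<And>i j. (i, j) \<in> I \<Longrightarrow> a i j + b i j \<le> Suc N"
        and r: "\<And>i j. 0 \<le> r i j"
      for a b and r :: "nat \<Rightarrow> nat \<Rightarrow> real"
    proof -
      let ?s = "\<lambda>(i, j). (a i j, b i j)"
      have "inj_on ?s I" using inj by (auto simp: inj_on_def)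
      then have "(\<Sum>(i, j)\<in>I. r (a i j) (b i j) * e (a i j) (b i j)) = (\<Sum>(i, j)\<in>?s ` I. r i j * e i j)"
        by (simp add: sum.reindex case_prod_unfold)
      also have "\<dots> \<le> (\<Sum>(i, j)\<in>J. r i j * e i j)"
        using J r fin by (intro sum_mono2) (auto simp: J_def less_imp_le e(1))
      finally show ?thesis .
    qed
    have "(\<Sum>(i, j)\<in>I. into1 (i - 1) j * e (i - 1) j) \<le> (\<Sum>(i, j)\<in>J. into1 i j * e i j)"
      by (rule shift[where a = "\<lambda>i j. i - 1" and b = "\<lambda>i j. j" and r = "into1"])
        (use \<rho>_pos M_pos into_bounds in \<open>auto simp: I_def\<close>)
    moreover have "(\<Sum>(i, j)\<in>I. into2 i (j - 1) * e i (j - 1)) \<le> (\<Sum>(i, j)\<in>J. into2 i j * e i j)"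
      by (rule shift[where a = "\<lambda>i j. i" and b = "\<lambda>i j. j - 1" and r = "into2"])
        (use \<rho>_pos M_pos into_bounds in \<open>auto simp: I_def\<close>)
    moreover have "(\<Sum>(i, j)\<in>I. \<rho> * M1 * e (i + 1) j) \<le> (\<Sum>(i, j)\<in>J. \<rho> * M1 * e i j)"
      by (rule shift[where a = "\<lambda>i j. i + 1" and b = "\<lambda>i j. j" and r = "\<lambda>i j. \<rho> * M1"])
        (use \<rho>_pos M_pos into_bounds in \<open>auto simp: I_def\<close>)
    moreover have "(\<Sum>(i, j)\<in>I. \<rho> * M2 * e i (j + 1)) \<le> (\<Sum>(i, j)\<in>J. \<rho> * M2 * e i j)"
      by (rule shift[where a = "\<lambda>i j. i" and b = "\<lambda>i j. j + 1" and r = "\<lambda>i j. \<rho> * M2"])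
        (use \<rho>_pos M_pos into_bounds in \<open>auto simp: I_def\<close>)
    moreover have "(\<Sum>(i, j)\<in>J. into1 i j * e i j) + (\<Sum>(i, j)\<in>J. into2 i j * e i j)
        + (\<Sum>(i, j)\<in>J. \<rho> * M1 * e i j) + (\<Sum>(i, j)\<in>J. \<rho> * M2 * e i j) = (\<Sum>(i, j)\<in>J. (L + M) * e i j)"
      by (simp only: into_add sum.distrib[symmetric] case_prod_unfold distrib_right[symmetric])
    moreover have "(\<Sum>(i, j)\<in>I. energy i j) = (\<Sum>(i, j)\<in>I. into1 (i - 1) j * e (i - 1) j)
        + (\<Sum>(i, j)\<in>I. into2 i (j - 1) * e i (j - 1)) + (\<Sum>(i, j)\<in>I. \<rho> * M1 * e (i + 1) j)
        + (\<Sum>(i, j)\<in>I. \<rho> * M2 * e i (j + 1)) - (\<Sum>(i, j)\<in>I. (L + M) * e i j)"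
      unfolding sum.distrib[symmetric] sum_subtractf[symmetric]
      by (intro sum.cong) (auto simp: energy_eq I_def e_def)
    ultimately have "(\<Sum>(i, j)\<in>I. energy i j) \<le> (\<Sum>(i, j)\<in>J. (L + M) * e i j) - (\<Sum>(i, j)\<in>I. (L + M) * e i j)"
      by linarith
    also have "\<dots> = (\<Sum>(i, j)\<in>J - I. (L + M) * e i j)"
      using fin by (subst sum_diff) (auto simp: I_def J_def)
    also have "\<dots> \<le> (\<Sum>(i, j)\<in>J - I. (L + M) * eta' i j)"
      using e L_pos M_pos by (intro sum_mono) auto
    also have "\<dots> = (L + M) * (\<Sum>(i, j)\<in>J - I. eta' i j)"
      by (simp add: sum_distrib_left case_prod_unfold)
    also have "(\<Sum>(i, j)\<in>J - I. eta' i j) \<le> 3 * H"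
    proof -
      \<comment> \<open>\<open>J - I\<close> is covered by the three sides of a triangle. On each
        side \<open>j - i\<close> is injective, so each contributes at most
        \<open>H\<close>.\<close>
      let ?A = "Pair 0 ` {..Suc N}" and ?B = "(\<lambda>i. (i, 0)) ` {..Suc N}" and ?C = "(\<lambda>i. (i, Suc N - i)) ` {..Suc N}"
      have inj: "(\<Sum>(i, j)\<in>D. eta' i j) \<le> H" if "inj_on (\<lambda>(i, j). int j - int i) D" "finite D" for D :: "(nat \<times> nat) set"
        using H[of "(\<lambda>(i, j). int j - int i) ` D"] that
        by (simp add: sum.reindex case_prod_unfold)
      have "J - I \<subseteq> ?A \<union> ?B \<union> ?C"
        by (auto simp: I_def J_def image_iff)
      then have "(\<Sum>(i, j)\<in>J - I. eta' i j) \<le> (\<Sum>(i, j)\<in>?A \<union> ?B \<union> ?C. eta' i j)"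
        by (intro sum_mono2) (auto intro: less_imp_le eta_pos)
      also have "\<dots> \<le> (\<Sum>(i, j)\<in>?A \<union> ?B. eta' i j) + (\<Sum>(i, j)\<in>?C. eta' i j)"
        by (simp add: sum_Un sum_nonneg less_imp_le eta_pos case_prod_unfold)
      also have "(\<Sum>(i, j)\<in>?A \<union> ?B. eta' i j) \<le> (\<Sum>(i, j)\<in>?A. eta' i j) + (\<Sum>(i, j)\<in>?B. eta' i j)"
        by (simp add: sum_Un sum_nonneg less_imp_le eta_pos case_prod_unfold)
      also have "(\<Sum>(i, j)\<in>?A. eta' i j) \<le> H" by (rule inj) (auto simp: inj_on_def)
      also have "(\<Sum>(i, j)\<in>?B. eta' i j) \<le> H" by (rule inj) (auto simp: inj_on_def)
      also have "(\<Sum>(i, j)\<in>?C. eta' i j) \<le> H" by (rule inj) (auto simp: inj_on_def)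
      finally show ?thesis by simp
    qed
    finally have "(\<Sum>(i, j)\<in>I. energy i j) \<le> (L + M) * (3 * H)"
      using L_pos M_pos by simp
    moreover have "(\<Sum>(i, j)\<in>F. energy i j) \<le> (\<Sum>(i, j)\<in>I. energy i j)"
    proof (rule sum_mono2)
      have "energy i j \<ge> 0" for i j
        using into_bounds \<rho>_pos M_pos unfolding energy_def
        by (intro add_nonneg_nonneg mult_nonneg_nonneg breg_nonneg)
          (auto intro: less_imp_le eta_pos dens_pos)
      then show "0 \<le> (case x of (i, j) \<Rightarrow> energy i j)" for x by (simp add: case_prod_unfold)
    qed (use \<open>F \<subseteq> I\<close> fin in auto)
    ultimately show "(\<Sum>(i, j)\<in>F. energy i j) \<le> (L + M) * (3 * H)" by linarith
  qed
qed

end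

lemma sum_upto_double:
  fixes g :: "nat \<Rightarrow> real"
  shows "(\<Sum>i\<le>2 * m. g i) = (\<Sum>k\<le>m. g (m - k)) + (\<Sum>k\<le>m. g (m + k)) - g m"
proof -
  have "(\<Sum>i\<le>m + n. g i) = (\<Sum>i\<le>m. g i) + (\<Sum>k\<le>n. g (m + k)) - g m" for n
    by (induction n) auto
  moreover have "(\<Sum>k\<le>m. g (m - k)) = (\<Sum>i\<le>m. g i)"
    by (rule sum.reindex_bij_witness[of _ "\<lambda>i. m - i" "\<lambda>i. m - i"]) auto
  ultimately show ?thesis by (simp add: mult_2)
qed

section \<open>From vanishing increments to the limit along the diagonals\<close>

context gjsq_invariant begin

lemma nu_bounded:
  obtains S where "S > 0" "\<And>i j. nu i j \<le> S"
proof -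
  obtain S where S: "S > 0" "mass \<longlonglongrightarrow> S" "\<And>n. mass n \<le> S" by (rule mass_limit) blast
  show thesis using that[OF S(1) order_trans[OF nu_le_mass S(3)]] .
qed

text \<open>Along a diagonal \<open>eta'\<close> is constant and \<open>nu\<close> is at most
  \<open>S\<close>, so one bound \<open>U\<close> for \<open>dens\<close> makes
  \<open>breg_ge\<close> applicable at all \<open>m\<close>. The bounded total energy then makes the
  squared differences summable.\<close>

lemma energy_term_vanishes:
  assumes ij: "i > 0" "j > 0" and c: "c > 0"
    and le: "\<And>m. c * breg (dens (i' + m) (j' + m)) (dens (i + m) (j + m)) \<le> energy (i + m) (j + m)"
  shows "(\<lambda>m. dens (i' + m) (j' + m) - dens (i + m) (j + m)) \<longlonglongrightarrow> 0"
proof -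
  obtain S where S: "S > 0" "\<And>i j. nu i j \<le> S" by (rule nu_bounded) blast
  obtain C where C: "\<And>F. finite F \<Longrightarrow> F \<subseteq> {0<..} \<times> {0<..} \<Longrightarrow> (\<Sum>(i, j)\<in>F. energy i j) \<le> C"
    by (rule energy_sum_bounded) blast
  define U where "U = S / eta' i j + S / eta' i' j'"
  have dens_le: "dens (a + m) (b + m) \<le> S / eta' a b" for a b m
  proof -
    have "dens (a + m) (b + m) = nu (a + m) (b + m) / eta' a b" by (simp add: dens_def)
    also have "\<dots> \<le> S / eta' a b" using S eta_pos by (intro divide_right_mono) (auto intro: less_imp_le)
    finally show ?thesis .
  qed
  have quot: "S / eta' a b \<ge> 0" for a b using S eta_pos[of "int b - int a"] by simp
  have U: "0 \<le> dens (i + m) (j + m)" "dens (i + m) (j + m) \<le> U"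
    "0 \<le> dens (i' + m) (j' + m)" "dens (i' + m) (j' + m) \<le> U" for m
    using dens_le[of i m j] dens_le[of i' m j'] quot[where a = i and b = j] quot[where a = i' and b = j']
      dens_pos by (auto simp: U_def less_imp_le)
  define d where "d m = (dens (i' + m) (j' + m) - dens (i + m) (j + m))\<^sup>2" for m
  have energy_ge: "c * (d m / (1 + U) ^ 3) \<le> energy (i + m) (j + m)" for m
  proof -
    have "0 < (1 + U) ^ 3" using U(1,2)[of m] by simp
    then have "d m / (1 + U) ^ 3 \<le> breg (dens (i' + m) (j' + m)) (dens (i + m) (j + m))"
      using breg_ge[OF U(1,2) U(3,4), of m m] unfolding d_def by (simp add: pos_divide_le_eq mult.commute)
    then show ?thesis using c le[of m] by (meson mult_left_mono less_imp_le order_trans)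
  qed
  have "summable (\<lambda>m. c * (d m / (1 + U) ^ 3))"
  proof (rule summableI_nonneg_bounded)
    show "0 \<le> c * (d m / (1 + U) ^ 3)" for m using c U(1,2)[of m] by (simp add: d_def)
    fix n
    have "(\<Sum>m<n. c * (d m / (1 + U) ^ 3)) \<le> (\<Sum>m<n. energy (i + m) (j + m))"
      by (intro sum_mono energy_ge)
    also have "\<dots> = (\<Sum>(a, b)\<in>(\<lambda>m. (i + m, j + m)) ` {..<n}. energy a b)"
      by (subst sum.reindex) (auto simp: inj_on_def)
    also have "\<dots> \<le> C" using ij by (intro C) auto
    finally show "(\<Sum>m<n. c * (d m / (1 + U) ^ 3)) \<le> C" .
  qed
  then have "(\<lambda>m. (1 + U) ^ 3 / c * (c * (d m / (1 + U) ^ 3))) \<longlonglongrightarrow> (1 + U) ^ 3 / c * 0"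
    by (intro tendsto_intros summable_LIMSEQ_zero)
  moreover have "(1 + U) ^ 3 / c * (c * (d m / (1 + U) ^ 3)) = d m" for m
    using c U(1,2)[of m] by simp
  ultimately have "d \<longlonglongrightarrow> 0" by simp
  then show ?thesis unfolding d_def by (subst (asm) power_tendsto_0_iff) auto
qed

text \<open>Read off from the first term of \<open>energy\<close>: the dedicated stream alone keeps
  its weight at least \<open>L1 / \<rho> * eta' (i - 1) j\<close> along the whole diagonal.
  \<open>dens_step2\<close> is the mirror image, with the second term.\<close>

lemma dens_step1:
  assumes "i > 0" "j > 0"
  shows "(\<lambda>m. dens (i - 1 + m) (j + m) - dens (i + m) (j + m)) \<longlonglongrightarrow> 0"
proof (rule energy_term_vanishes[OF assms])
  show "0 < L1 / \<rho> * eta' (i - 1) j" using L_pos \<rho>_pos eta_pos by simp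
  fix m
  let ?b = "breg (dens (i - 1 + m) (j + m)) (dens (i + m) (j + m))"
  have b: "0 \<le> breg (dens a b) (dens a' b')" for a b a' b'
    by (intro breg_nonneg less_imp_le dens_pos)
  have "L1 / \<rho> * eta' (i - 1) j * ?b \<le> into1 (i + m - 1) (j + m) * eta' (i - 1) j * ?b"
    by (intro mult_right_mono into_bounds b less_imp_le[OF eta_pos])
  also have "\<dots> = into1 (i + m - 1) (j + m) * eta' (i + m - 1) (j + m) * breg (dens (i + m - 1) (j + m)) (dens (i + m) (j + m))"
    using assms by (cases i) auto
  also have "\<dots> \<le> energy (i + m) (j + m)"
    unfolding energy_def using into_bounds \<rho>_pos M_pos b eta_pos
    by (simp add: less_imp_le add_nonneg_nonneg)
  finally show "L1 / \<rho> * eta' (i - 1) j * ?b \<le> energy (i + m) (j + m)" .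
qed

lemma dens_step2:
  assumes "i > 0" "j > 0"
  shows "(\<lambda>m. dens (i + m) (j - 1 + m) - dens (i + m) (j + m)) \<longlonglongrightarrow> 0"
proof (rule energy_term_vanishes[OF assms])
  show "0 < L2 / \<rho> * eta' i (j - 1)" using L_pos \<rho>_pos eta_pos by simp
  fix m
  let ?b = "breg (dens (i + m) (j - 1 + m)) (dens (i + m) (j + m))"
  have b: "0 \<le> breg (dens a b) (dens a' b')" for a b a' b'
    by (intro breg_nonneg less_imp_le dens_pos)
  have "L2 / \<rho> * eta' i (j - 1) * ?b \<le> into2 (i + m) (j + m - 1) * eta' i (j - 1) * ?b"
    by (intro mult_right_mono into_bounds b less_imp_le[OF eta_pos])
  also have "\<dots> = into2 (i + m) (j + m - 1) * eta' (i + m) (j + m - 1) * breg (dens (i + m) (j + m - 1)) (dens (i + m) (j + m))"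
    using assms by (cases j) auto
  also have "\<dots> \<le> energy (i + m) (j + m)"
    unfolding energy_def using into_bounds \<rho>_pos M_pos b eta_pos
    by (simp add: less_imp_le add_nonneg_nonneg)
  finally show "L2 / \<rho> * eta' i (j - 1) * ?b \<le> energy (i + m) (j + m)" .
qed

lemma dens_diagonal:
  "(\<lambda>m. dens m (m + l) - dens m m) \<longlonglongrightarrow> 0" "(\<lambda>m. dens (m + l) m - dens m m) \<longlonglongrightarrow> 0"
proof -
  show "(\<lambda>m. dens m (m + l) - dens m m) \<longlonglongrightarrow> 0"
  proof (induction l)
    case (Suc l)
    \<comment> \<open>The index starts at \<open>Suc m\<close> because \<open>dens_step2\<close>
      needs positive coordinates.\<close>
    have "(\<lambda>m. dens (Suc m) (Suc m + l) - dens (Suc m) (Suc m + Suc l)) \<longlonglongrightarrow> 0"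
      using dens_step2[of 1 "l + 2"] by (simp add: ac_simps)
    then have "(\<lambda>m. dens m (m + l) - dens m (m + Suc l)) \<longlonglongrightarrow> 0" by (rule LIMSEQ_imp_Suc)
    from tendsto_diff[OF Suc this] show ?case by simp
  qed simp
  show "(\<lambda>m. dens (m + l) m - dens m m) \<longlonglongrightarrow> 0"
  proof (induction l)
    case (Suc l)
    have "(\<lambda>m. dens (Suc m + l) (Suc m) - dens (Suc m + Suc l) (Suc m)) \<longlonglongrightarrow> 0"
      using dens_step1[of "l + 2" 1] by (simp add: ac_simps)
    then have "(\<lambda>m. dens (m + l) m - dens (m + Suc l) m) \<longlonglongrightarrow> 0" by (rule LIMSEQ_imp_Suc)
    from tendsto_diff[OF Suc this] show ?case by simp
  qed simp
qed

text \<open>One step along the diagonal passes through \<open>(m, m + 1)\<close>.\<close>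

lemma dens_shift: "(\<lambda>m. dens m m - dens (m + k) (m + k)) \<longlonglongrightarrow> 0"
proof (induction k)
  case (Suc k)
  have "(\<lambda>m. dens m (Suc m) - dens (Suc m) (Suc m)) \<longlonglongrightarrow> 0"
    using dens_step1[of 1 1] by simp
  from tendsto_diff[OF this dens_diagonal(1)[of 1]]
  have "(\<lambda>m. dens m m - dens (Suc m) (Suc m)) \<longlonglongrightarrow> 0" by simp
  then have "(\<lambda>m. dens (m + k) (m + k) - dens (Suc (m + k)) (Suc (m + k))) \<longlonglongrightarrow> 0"
    by (rule LIMSEQ_ignore_initial_segment)
  from tendsto_add[OF Suc this] show ?case by simp
qed simp

lemma eta_0: "eta 0 = 1"
  by (simp add: eta_def)

lemma dens_0: "dens m m = nu m m"
  by (simp add: dens_def eta_0)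

text \<open>The point \<open>(m, m + 2 * k)\<close> is compared with \<open>(m, m)\<close> and then
  with \<open>(m + k, m + k)\<close>, which lies on its own antidiagonal. The claim follows by
  shifting \<open>m\<close> by \<open>k\<close>; the indices \<open>m < k\<close> do not affect the
  limit.\<close>

lemma nu_antidiagonal:
  "(\<lambda>m. nu (m - k) (m + k) - eta (2 * int k) * nu m m) \<longlonglongrightarrow> 0"
  "(\<lambda>m. nu (m + k) (m - k) - eta (- 2 * int k) * nu m m) \<longlonglongrightarrow> 0"
proof -
  have "(\<lambda>m. eta (2 * int k) * ((dens m (m + 2 * k) - dens m m) + (dens m m - dens (m + k) (m + k)))) \<longlonglongrightarrow> eta (2 * int k) * (0 + 0)"
    by (intro tendsto_intros dens_diagonal dens_shift)
  moreover have "eta (2 * int k) * ((dens m (m + 2 * k) - dens m m) + (dens m m - dens (m + k) (m + k)))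
      = nu (m + k - k) (m + k + k) - eta (2 * int k) * nu (m + k) (m + k)" for m
  proof -
    have "eta (2 * int k) * dens m (m + 2 * k) = nu m (m + 2 * k)"
      using eta_pos[of "2 * int k"] by (simp add: dens_def)
    moreover have "m + k - k = m" "m + k + k = m + 2 * k" by simp_all
    ultimately show ?thesis by (simp only: right_diff_distrib distrib_left dens_0)
  qed
  ultimately have "(\<lambda>m. nu (m + k - k) (m + k + k) - eta (2 * int k) * nu (m + k) (m + k)) \<longlonglongrightarrow> 0"
    by (simp only: add_0_right mult_zero_right)
  then show "(\<lambda>m. nu (m - k) (m + k) - eta (2 * int k) * nu m m) \<longlonglongrightarrow> 0"
    by (rule LIMSEQ_offset)
  have "(\<lambda>m. eta (- 2 * int k) * ((dens (m + 2 * k) m - dens m m) + (dens m m - dens (m + k) (m + k)))) \<longlonglongrightarrow> eta (- 2 * int k) * (0 + 0)"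
    by (intro tendsto_intros dens_diagonal dens_shift)
  moreover have "eta (- 2 * int k) * ((dens (m + 2 * k) m - dens m m) + (dens m m - dens (m + k) (m + k)))
      = nu (m + k + k) (m + k - k) - eta (- 2 * int k) * nu (m + k) (m + k)" for m
  proof -
    have "eta (- 2 * int k) * dens (m + 2 * k) m = nu (m + 2 * k) m"
      using eta_pos[of "- 2 * int k"] by (simp add: dens_def)
    moreover have "m + k - k = m" "m + k + k = m + 2 * k" by simp_all
    ultimately show ?thesis by (simp only: right_diff_distrib distrib_left dens_0)
  qed
  ultimately have "(\<lambda>m. nu (m + k + k) (m + k - k) - eta (- 2 * int k) * nu (m + k) (m + k)) \<longlonglongrightarrow> 0"
    by (simp only: add_0_right mult_zero_right)
  then show "(\<lambda>m. nu (m + k) (m - k) - eta (- 2 * int k) * nu m m) \<longlonglongrightarrow> 0"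
    by (rule LIMSEQ_offset)
qed

lemma eta_summable_scaled:
  assumes "c \<noteq> 0"
  shows "summable (\<lambda>k. eta (c * int k))"
proof -
  obtain H where H: "\<And>A. finite A \<Longrightarrow> (\<Sum>l\<in>A. eta l) \<le> H" by (rule eta_sum_bounded) blast
  have "(\<Sum>k<n. eta (c * int k)) = (\<Sum>l\<in>(\<lambda>k. c * int k) ` {..<n}. eta l)" for n
    using assms by (subst sum.reindex) (auto simp: inj_on_def)
  then have "(\<Sum>k<n. eta (c * int k)) \<le> H" for n
    using H[of "(\<lambda>k. c * int k) ` {..<n}"] by simp
  then show ?thesis
    by (intro summableI_nonneg_bounded[where x = H] less_imp_le[OF eta_pos])
qed

text \<open>An even antidiagonal passes through \<open>(m, m)\<close> and carries exactly the even
  differences. Hence \<open>mass (2 * m)\<close> is asymptotically \<open>nu m m * H\<close>, with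
  \<open>H\<close> the sum of \<open>eta\<close> over the even integers, and \<open>nu m m\<close>
  tends to \<open>S / H\<close>.\<close>

lemma nu_diagonal_limit:
  obtains x0 where "x0 > 0" "(\<lambda>m. nu m m) \<longlonglongrightarrow> x0"
proof -
  obtain S where S: "S > 0" "mass \<longlonglongrightarrow> S" "\<And>n. mass n \<le> S" by (rule mass_limit) blast
  obtain C z where z: "z > 1" "\<And>i j. nu i j * z ^ gap i j \<le> C" by (rule nu_geometric_bound) blast
  \<comment> \<open>The dominating sequence: \<open>k\<close> steps from the centre of the
    antidiagonal the gap is \<open>2 * k\<close>.\<close>
  define s where "s k = C * (1 / z ^ 2) ^ k" for k :: nat
  have C: "C \<ge> 0" using z(2)[of 0 0] nu_pos[of 0 0] z(1) by (simp add: gap_def)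
  have "1 < z ^ 2" using z(1) by (simp add: one_less_power)
  then have s: "summable s" "0 \<le> s k" for k
    unfolding s_def using C z(1) by (auto intro!: summable_mult summable_geometric)
  have nu_s: "nu i j \<le> s k" if "gap i j = 2 * k" for i j k
    using z(2)[of i j] z(1) unfolding that s_def
    by (simp add: power_mult power_one_over pos_le_divide_eq divide_simps)
  have w: "\<bar>nu m m\<bar> \<le> S" for m using order_trans[OF nu_le_mass S(3), of m m] nu_abs by simp
  let ?e1 = "\<lambda>k. eta (2 * int k)" and ?e2 = "\<lambda>k. eta (- 2 * int k)"
  have sub: "strict_mono (\<lambda>k::nat. 2 * k)" by (simp add: strict_mono_def)
  have e: "summable ?e1" "summable ?e2"
    using eta_summable_scaled[of 2] eta_summable_scaled[of "- 2"] by simp_all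
  have "(\<lambda>m. (\<Sum>k\<le>m. nu (m - k) (m + k)) - nu m m * suminf ?e1) \<longlonglongrightarrow> 0"
    by (rule diagonal_dominated_sums[where s = s and S = S])
      (use nu_antidiagonal s e w nu_s in \<open>auto simp: nu_abs gap_def less_imp_le[OF eta_pos]\<close>)
  moreover have "(\<lambda>m. (\<Sum>k\<le>m. nu (m + k) (m - k)) - nu m m * suminf ?e2) \<longlonglongrightarrow> 0"
    by (rule diagonal_dominated_sums[where s = s and S = S])
      (use nu_antidiagonal s e w nu_s in \<open>auto simp: nu_abs gap_def less_imp_le[OF eta_pos]\<close>)
  ultimately have "(\<lambda>m. ((\<Sum>k\<le>m. nu (m - k) (m + k)) - nu m m * suminf ?e1)
      + ((\<Sum>k\<le>m. nu (m + k) (m - k)) - nu m m * suminf ?e2)) \<longlonglongrightarrow> 0 + 0"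
    by (rule tendsto_add)
  \<comment> \<open>The centre \<open>k = 0\<close> is counted in both half sums, and
    \<open>eta 0 = 1\<close>.\<close>
  moreover define H where "H = suminf ?e1 + suminf ?e2 - 1"
  moreover have "((\<Sum>k\<le>m. nu (m - k) (m + k)) - nu m m * suminf ?e1)
      + ((\<Sum>k\<le>m. nu (m + k) (m - k)) - nu m m * suminf ?e2) = mass (2 * m) - nu m m * H" for m
  proof -
    have "mass (2 * m) = (\<Sum>k\<le>m. nu (m - k) (2 * m - (m - k))) + (\<Sum>k\<le>m. nu (m + k) (2 * m - (m + k))) - nu m (2 * m - m)"
      unfolding mass_def by (rule sum_upto_double)
    also have "\<dots> = (\<Sum>k\<le>m. nu (m - k) (m + k)) + (\<Sum>k\<le>m. nu (m + k) (m - k)) - nu m m"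
      by (intro arg_cong2[of _ _ _ _ "(-)"] arg_cong2[of _ _ _ _ "(+)"] sum.cong) (auto intro!: arg_cong2[of _ _ _ _ nu])
    finally show ?thesis by (simp add: H_def algebra_simps)
  qed
  moreover have "(\<lambda>m. mass (2 * m)) \<longlonglongrightarrow> S"
    using LIMSEQ_subseq_LIMSEQ[OF S(2) sub] by (simp add: o_def)
  ultimately have "(\<lambda>m. mass (2 * m) - (mass (2 * m) - nu m m * H)) \<longlonglongrightarrow> S - 0"
    by (intro tendsto_diff) auto
  then have lim: "(\<lambda>m. nu m m * H) \<longlonglongrightarrow> S" by simp
  have "1 \<le> suminf ?e1" "1 \<le> suminf ?e2"
    using sum_le_suminf[of ?e1 "{0}"] sum_le_suminf[of ?e2 "{0}"] e eta_0
    by (auto intro: less_imp_le eta_pos)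
  then have H: "H > 0" by (simp add: H_def)
  have "(\<lambda>m. nu m m * H / H) \<longlonglongrightarrow> S / H" using lim H by (intro tendsto_divide) auto
  then have "(\<lambda>m. nu m m) \<longlonglongrightarrow> S / H" using H by simp
  then show thesis using that[of "S / H"] S H by simp
qed

lemma q_asymptotics:
  obtains x0 where "x0 > 0"
    "\<And>l. (\<lambda>m. q m (m + l) / \<rho> ^ (2 * m)) \<longlonglongrightarrow> x0 * \<rho> ^ l * eta (int l)"
    "\<And>l. (\<lambda>m. q (m + l) m / \<rho> ^ (2 * m)) \<longlonglongrightarrow> x0 * \<rho> ^ l * eta (- int l)"
proof -
  obtain x0 where x0: "x0 > 0" "(\<lambda>m. nu m m) \<longlonglongrightarrow> x0" by (rule nu_diagonal_limit)
  show thesis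
  proof
    show "x0 > 0" by fact
    fix l
    have "(\<lambda>m. ((dens m (m + l) - dens m m) + nu m m) * \<rho> ^ l * eta (int l)) \<longlonglongrightarrow> (0 + x0) * \<rho> ^ l * eta (int l)"
      by (intro tendsto_intros dens_diagonal x0)
    moreover have "((dens m (m + l) - dens m m) + nu m m) * \<rho> ^ l * eta (int l) = q m (m + l) / \<rho> ^ (2 * m)" for m
      using \<rho>_pos eta_pos[of "int l"] by (simp add: dens_0) (simp add: dens_def nu_def power_add mult_2)
    ultimately show "(\<lambda>m. q m (m + l) / \<rho> ^ (2 * m)) \<longlonglongrightarrow> x0 * \<rho> ^ l * eta (int l)" by simp
    have "(\<lambda>m. ((dens (m + l) m - dens m m) + nu m m) * \<rho> ^ l * eta (- int l)) \<longlonglongrightarrow> (0 + x0) * \<rho> ^ l * eta (- int l)"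
      by (intro tendsto_intros dens_diagonal x0)
    moreover have "((dens (m + l) m - dens m m) + nu m m) * \<rho> ^ l * eta (- int l) = q (m + l) m / \<rho> ^ (2 * m)" for m
      using \<rho>_pos eta_pos[of "- int l"] by (simp add: dens_0) (simp add: dens_def nu_def power_add mult_2)
    ultimately show "(\<lambda>m. q (m + l) m / \<rho> ^ (2 * m)) \<longlonglongrightarrow> x0 * \<rho> ^ l * eta (- int l)" by simp
  qed
qed

end

section \<open>Convergence of lazy chains\<close>

lemma has_sum_integral_pmf:
  fixes g :: "'a \<Rightarrow> real"
  assumes "\<And>x. \<bar>g x\<bar> \<le> B"
  shows "((\<lambda>x. pmf P x * g x) has_sum measure_pmf.expectation P g) UNIV"
proof -
  have int: "integrable (measure_pmf P) g"
    using assms by (intro measure_pmf.integrable_const_bound[of _ B]) auto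
  have "integrable (density (count_space UNIV) (pmf P)) g"
    using int by (simp only: measure_pmf_eq_density)
  then have "integrable (count_space UNIV) (\<lambda>x. pmf P x * g x)"
    by (subst (asm) integrable_density) auto
  then have s: "Infinite_Set_Sum.abs_summable_on (\<lambda>x. pmf P x * g x) UNIV"
    by (simp add: Infinite_Set_Sum.abs_summable_on_def)
  have "measure_pmf.expectation P g = infsetsum (\<lambda>x. pmf P x * g x) UNIV"
    unfolding infsetsum_def measure_pmf_eq_density by (subst integral_density) auto
  also have "\<dots> = infsum (\<lambda>x. pmf P x * g x) UNIV"
    using s by (rule infsetsum_infsum)
  finally show ?thesis
    using s[folded abs_summable_equivalent] by (simp add: abs_summable_summable)
qed

lemma abs_expectation_le:
  fixes g :: "'a \<Rightarrow> real"
  assumes "\<And>x. \<bar>g x\<bar> \<le> B"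
  shows "\<bar>measure_pmf.expectation P g\<bar> \<le> B"
proof -
  have "integrable (measure_pmf P) g"
    using assms by (intro measure_pmf.integrable_const_bound[of _ B]) auto
  then have "\<bar>measure_pmf.expectation P g\<bar> \<le> measure_pmf.expectation P (\<lambda>_. B)"
    by (intro order_trans[OF integral_abs_bound] integral_mono integrable_abs) (use assms in auto)
  then show ?thesis by simp
qed

lemma pmf_mult_le_expectation:
  fixes g :: "'a \<Rightarrow> real"
  assumes "\<And>x. 0 \<le> g x" "\<And>x. g x \<le> B"
  shows "pmf P x * g x \<le> measure_pmf.expectation P g"
proof -
  have "((\<lambda>x. pmf P x * g x) has_sum (pmf P x * g x)) {x}"
    by (simp add: has_sum_finiteI)
  moreover have "((\<lambda>x. pmf P x * g x) has_sum measure_pmf.expectation P g) UNIV"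
    by (rule has_sum_integral_pmf[of _ B]) (use assms in auto)
  ultimately show ?thesis
    by (rule has_sum_mono2) (use assms in auto)
qed

lemma pmf_bind_ge: "pmf P x * pmf (f x) y \<le> pmf (bind_pmf P f) y"
  unfolding pmf_bind by (rule pmf_mult_le_expectation[of _ 1]) (auto simp: pmf_le_1)

lemma expectation_reweighted:
  fixes f g :: "'a \<Rightarrow> real"
  assumes "\<And>x. pmf D x = f x * pmf P x" "\<And>x. \<bar>f x\<bar> \<le> B" "\<And>x. \<bar>g x\<bar> \<le> C"
  shows "measure_pmf.expectation D g = measure_pmf.expectation P (\<lambda>x. f x * g x)"
proof -
  have "((\<lambda>x. pmf D x * g x) has_sum measure_pmf.expectation D g) UNIV"
    by (rule has_sum_integral_pmf) fact
  moreover have "((\<lambda>x. pmf P x * (f x * g x)) has_sum measure_pmf.expectation P (\<lambda>x. f x * g x)) UNIV"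
  proof (rule has_sum_integral_pmf)
    have "B \<ge> 0" using assms(2) by (meson abs_ge_zero order_trans)
    then show "\<bar>f x * g x\<bar> \<le> B * C" for x
      using assms(2,3) by (simp add: abs_mult mult_mono)
  qed
  ultimately show ?thesis
    by (simp add: assms(1) mult.left_commute mult.commute has_sum_unique)
qed

lemma emeasure_eq_sum_over_values:
  fixes Y :: "'w \<Rightarrow> 's :: countable"
  assumes "A \<in> sets M" "Y \<in> measurable M (count_space UNIV)"
  shows "emeasure M A = (\<integral>\<^sup>+v. emeasure M {\<omega> \<in> A. Y \<omega> = v} \<partial>count_space UNIV)"
proof -
  have "{\<omega> \<in> A. Y \<omega> = v} = A \<inter> (Y -` {v} \<inter> space M)" for v
    using sets.sets_into_space[OF assms(1)] by auto
  then have "emeasure M (\<Union>v. {\<omega> \<in> A. Y \<omega> = v}) = (\<integral>\<^sup>+v. emeasure M {\<omega> \<in> A. Y \<omega> = v} \<partial>count_space UNIV)"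
    using assms by (intro emeasure_UN_countable) (auto simp: disjoint_family_on_def intro!: sets.Int measurable_sets)
  moreover have "(\<Union>v. {\<omega> \<in> A. Y \<omega> = v}) = A" by auto
  ultimately show ?thesis by simp
qed

text \<open>\<open>markov_chain\<close> prescribes only the probabilities of full paths from time 0,
  so the recursion for the marginal laws is obtained by summing out the earlier states, of which
  there are countably many.\<close>

lemma markov_chain_law:
  fixes K :: "'s :: countable \<Rightarrow> 's pmf"
  assumes "markov_chain M (\<lambda>x y. pmf (K x) y) X"
  obtains D where "\<And>n s. measure M {\<omega> \<in> space M. X n \<omega> = s} = pmf (((\<lambda>D. bind_pmf D K) ^^ n) D) s"
proof -
  interpret prob_space M using assms by (simp add: markov_chain_def)
  have X: "X n \<in> measurable M (count_space UNIV)" for n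
    using assms by (simp add: markov_chain_def)
  have sets [measurable]: "{\<omega> \<in> space M. X n \<omega> = s} \<in> sets M" for n s
    using measurable_sets[OF X, of "{s}" n] by (simp add: vimage_def Int_def conj_commute)
  define path where "path j n s = {\<omega> \<in> space M. \<forall>k\<in>{j..n}. X k \<omega> = s k}" for j n :: nat and s
  have path [measurable]: "path j n s \<in> sets M" for j n s
  proof -
    have "path j n s = space M \<inter> (\<Inter>k\<in>{j..n}. {\<omega> \<in> space M. X k \<omega> = s k})"
      by (auto simp: path_def)
    also have "\<dots> \<in> sets M"
      by (cases "{j..n} = {}") (simp, intro sets.Int sets.top sets.finite_INT, auto)
    finally show ?thesis .
  qed
  \<comment> \<open>The induction on \<open>j\<close> releases the constraint at time
    \<open>j\<close> by summing over the value \<open>v\<close> there; the transition factor does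
    not involve \<open>v\<close>.\<close>
  have step: "emeasure M (path j (Suc n) s) = emeasure M (path j n s) * ennreal (pmf (K (s n)) (s (Suc n)))"
    if "j \<le> n" for j n s
    using that
  proof (induction j arbitrary: s)
    case 0
    have "measure M {\<omega> \<in> space M. \<forall>k\<le>Suc n. X k \<omega> = s k} =
            measure M {\<omega> \<in> space M. \<forall>k\<le>n. X k \<omega> = s k} * pmf (K (s n)) (s (Suc n))"
      using assms unfolding markov_chain_def by blast
    moreover have "path 0 n s = {\<omega> \<in> space M. \<forall>k\<le>n. X k \<omega> = s k}" for n by (auto simp: path_def)
    ultimately show ?case by (simp add: emeasure_eq_measure ennreal_mult)
  next
    case (Suc j)
    have split: "{\<omega> \<in> path (Suc j) n' s. X j \<omega> = v} = path j n' (s(j := v))" if "j \<le> n'" for v n'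
    proof -
      have "{j..n'} = insert j {Suc j..n'}" using that by auto
      then show ?thesis by (auto simp: path_def)
    qed
    have "emeasure M (path (Suc j) (Suc n) s) = (\<integral>\<^sup>+v. emeasure M (path j (Suc n) (s(j := v))) \<partial>count_space UNIV)"
      using Suc.prems by (subst emeasure_eq_sum_over_values[OF path X[of j]]) (simp add: split)
    also have "\<dots> = (\<integral>\<^sup>+v. emeasure M (path j n (s(j := v))) * ennreal (pmf (K (s n)) (s (Suc n))) \<partial>count_space UNIV)"
      using Suc.prems by (subst Suc.IH) auto
    also have "\<dots> = (\<integral>\<^sup>+v. emeasure M (path j n (s(j := v))) \<partial>count_space UNIV) * ennreal (pmf (K (s n)) (s (Suc n)))"
      by (rule nn_integral_multc) simp
    also have "(\<integral>\<^sup>+v. emeasure M (path j n (s(j := v))) \<partial>count_space UNIV) = emeasure M (path (Suc j) n s)"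
      using Suc.prems by (subst emeasure_eq_sum_over_values[OF path X[of j]]) (simp add: split)
    finally show ?case .
  qed
  define law where "law n s = measure M {\<omega> \<in> space M. X n \<omega> = s}" for n s
  have law: "ennreal (law n s) = emeasure M {\<omega> \<in> space M. X n \<omega> = s}" for n s
    by (simp add: law_def emeasure_eq_measure)
  have law_Suc: "ennreal (law (Suc n) y) = (\<integral>\<^sup>+x. ennreal (law n x) * ennreal (pmf (K x) y) \<partial>count_space UNIV)" for n y
  proof -
    have "ennreal (law (Suc n) y) = (\<integral>\<^sup>+x. emeasure M {\<omega> \<in> {\<omega> \<in> space M. X (Suc n) \<omega> = y}. X n \<omega> = x} \<partial>count_space UNIV)"
      unfolding law by (rule emeasure_eq_sum_over_values[OF sets X])
    also have "\<dots> = (\<integral>\<^sup>+x. ennreal (law n x) * ennreal (pmf (K x) y) \<partial>count_space UNIV)"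
    proof (rule nn_integral_cong)
      fix x
      let ?s = "\<lambda>k. if k = n then x else y"
      have "{\<omega> \<in> {\<omega> \<in> space M. X (Suc n) \<omega> = y}. X n \<omega> = x} = path n (Suc n) ?s"
        by (auto simp: path_def le_Suc_eq)
      moreover have "path n n ?s = {\<omega> \<in> space M. X n \<omega> = x}" by (auto simp: path_def)
      ultimately show "emeasure M {\<omega> \<in> {\<omega> \<in> space M. X (Suc n) \<omega> = y}. X n \<omega> = x}
          = ennreal (law n x) * ennreal (pmf (K x) y)"
        using step[of n n ?s] by (simp add: law)
    qed
    finally show ?thesis .
  qed
  define D where "D = embed_pmf (law 0)"
  have "(\<integral>\<^sup>+x. ennreal (law 0 x) \<partial>count_space UNIV) = 1"
    unfolding law using emeasure_eq_sum_over_values[OF sets.top X, of 0] by (simp add: emeasure_space_1)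
  then have D: "pmf D s = law 0 s" for s
    unfolding D_def by (intro pmf_embed_pmf) (auto simp: law_def)
  have "pmf (((\<lambda>D. bind_pmf D K) ^^ n) D) s = law n s" for n s
  proof (induction n arbitrary: s)
    case (Suc n)
    have "ennreal (pmf (((\<lambda>D. bind_pmf D K) ^^ Suc n) D) s) = ennreal (law (Suc n) s)"
      by (simp add: ennreal_pmf_bind nn_integral_measure_pmf Suc law_Suc)
    then show ?case by (simp add: law_def)
  qed (simp add: D)
  then show thesis by (intro that[of D]) (simp add: law_def)
qed

abbreviation iterate_kernel :: "('s \<Rightarrow> 's pmf) \<Rightarrow> nat \<Rightarrow> 's pmf \<Rightarrow> 's pmf" where
  "iterate_kernel K n \<equiv> (\<lambda>D. bind_pmf D K) ^^ n"

lemma iterate_kernel_bind: "iterate_kernel K n (bind_pmf D f) = bind_pmf D (\<lambda>x. iterate_kernel K n (f x))"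
  by (induction n) (simp_all add: bind_assoc_pmf)

lemma iterate_kernel_from_points: "iterate_kernel K n D = bind_pmf D (\<lambda>x. iterate_kernel K n (return_pmf x))"
  using iterate_kernel_bind[of n K D return_pmf] by (simp add: bind_return_pmf')

lemma expectation_bind:
  fixes g :: "'b \<Rightarrow> real"
  assumes "\<And>x. \<bar>g x\<bar> \<le> B"
  shows "measure_pmf.expectation (bind_pmf P f) g = measure_pmf.expectation P (\<lambda>x. measure_pmf.expectation (f x) g)"
  unfolding measure_pmf_bind
  by (rule integral_bind[where K = "count_space UNIV" and B' = 1 and B = B])
    (use assms in \<open>auto intro!: AE_I2 simp: measure_pmf.emeasure_space_1 measure_pmf_in_subprob_algebra\<close>)

text \<open>
  The $L^2(P)$ norms of the densities decrease; the decrement in step \<open>n\<close> is the mean square of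
  $f_n(y) - f_{n+1}(x)$ over a stationary transition from \<open>y\<close> to \<open>x\<close>, so it tends to \<open>0\<close>.
\<close>

lemma density_differences_vanish:
  fixes K :: "'s \<Rightarrow> 's pmf" and f :: "nat \<Rightarrow> 's \<Rightarrow> real"
  assumes stat: "bind_pmf P K = P" and f: "\<And>n x. pmf (D n) x = f n x * pmf P x"
    and D: "\<And>n. D (Suc n) = bind_pmf (D n) K" and bnd: "\<And>n x. \<bar>f n x\<bar> \<le> B"
    and edge: "pmf P y > 0" "pmf (K y) x > 0"
  shows "(\<lambda>n. f n y - f (Suc n) x) \<longlonglongrightarrow> 0"
proof -
  \<comment> \<open>The joint law of a stationary transition, source first; both marginals are
    \<open>P\<close>.\<close>
  define J where "J = bind_pmf P (\<lambda>y. map_pmf (Pair y) (K y))"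
  have J: "map_pmf fst J = P" "map_pmf snd J = P"
    by (simp_all add: J_def map_bind_pmf map_pmf_comp bind_return_pmf' stat)
  define E where "E n = measure_pmf.expectation P (\<lambda>x. (f n x)\<^sup>2)" for n
  have B: "B \<ge> 0" using bnd by (meson abs_ge_zero order_trans)
  have sq: "\<bar>f n x * f m z\<bar> \<le> B * B" for n m x z
    using bnd B by (simp add: abs_mult mult_mono)
  have int: "integrable (measure_pmf J) (\<lambda>z. f n (g z) * f m (g' z))" for n m and g g' :: "'s \<times> 's \<Rightarrow> 's"
    using sq by (intro measure_pmf.integrable_const_bound[of _ "B * B"]) auto
  have marg: "measure_pmf.expectation J (\<lambda>z. f n (fst z) * f n (fst z)) = E n"
    "measure_pmf.expectation J (\<lambda>z. f n (snd z) * f n (snd z)) = E n" for n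
  proof -
    have "measure_pmf.expectation (map_pmf fst J) (\<lambda>x. (f n x)\<^sup>2) = E n"
      "measure_pmf.expectation (map_pmf snd J) (\<lambda>x. (f n x)\<^sup>2) = E n"
      unfolding J E_def by simp_all
    then show "measure_pmf.expectation J (\<lambda>z. f n (fst z) * f n (fst z)) = E n"
      "measure_pmf.expectation J (\<lambda>z. f n (snd z) * f n (snd z)) = E n"
      by (simp_all add: power2_eq_square)
  qed
  \<comment> \<open>Weighting \<open>P\<close> by \<open>f n\<close> gives \<open>D n\<close>, and
    one step of \<open>K\<close> turns this into \<open>D (Suc n)\<close>, which has density
    \<open>f (Suc n)\<close>. So the expanded square has mean
    \<open>E n + E (Suc n) - 2 * E (Suc n)\<close>.\<close>
  have cross: "measure_pmf.expectation J (\<lambda>z. f n (fst z) * f (Suc n) (snd z)) = E (Suc n)" for n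
  proof -
    have K_bnd: "\<bar>measure_pmf.expectation (K y) (f (Suc n))\<bar> \<le> B" for y
      by (rule abs_expectation_le[OF bnd])
    have "measure_pmf.expectation J (\<lambda>z. f n (fst z) * f (Suc n) (snd z))
        = measure_pmf.expectation P (\<lambda>y. f n y * measure_pmf.expectation (K y) (f (Suc n)))"
      unfolding J_def by (subst expectation_bind[of _ "B * B"]) (use sq in simp_all)
    also have "\<dots> = measure_pmf.expectation (D n) (\<lambda>y. measure_pmf.expectation (K y) (f (Suc n)))"
      by (rule expectation_reweighted[symmetric, OF f bnd K_bnd])
    also have "\<dots> = measure_pmf.expectation (D (Suc n)) (f (Suc n))"
      unfolding D by (rule expectation_bind[symmetric, OF bnd])
    also have "\<dots> = E (Suc n)"
      by (subst expectation_reweighted[OF f bnd bnd]) (simp add: E_def power2_eq_square)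
    finally show ?thesis .
  qed
  have diff: "measure_pmf.expectation J (\<lambda>z. (f n (fst z) - f (Suc n) (snd z))\<^sup>2) = E n - E (Suc n)" for n
  proof -
    have "(\<lambda>z. (f n (fst z) - f (Suc n) (snd z))\<^sup>2) = (\<lambda>z. f n (fst z) * f n (fst z)
      + f (Suc n) (snd z) * f (Suc n) (snd z) - 2 * (f n (fst z) * f (Suc n) (snd z)))"
      by (auto simp: power2_eq_square algebra_simps)
    then show ?thesis
      by (simp add: int marg cross)
  qed
  have "E (Suc n) \<le> E n" for n
  proof -
    have "0 \<le> measure_pmf.expectation J (\<lambda>z. (f n (fst z) - f (Suc n) (snd z))\<^sup>2)"
      by (rule integral_nonneg_AE) simp
    then show ?thesis by (simp add: diff)
  qed
  then have "decseq E" by (rule decseq_SucI)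
  moreover have "0 \<le> E n" for n unfolding E_def by (rule integral_nonneg_AE) simp
  ultimately obtain c where "E \<longlonglongrightarrow> c" by (metis decseq_convergent)
  then have "(\<lambda>n. E n - E (Suc n)) \<longlonglongrightarrow> c - c"
    by (intro tendsto_diff LIMSEQ_Suc)
  then have E0: "(\<lambda>n. (E n - E (Suc n)) / pmf J (y, x)) \<longlonglongrightarrow> 0"
    by (auto intro: tendsto_divide_zero)
  have "pmf P y * pmf (map_pmf (Pair y) (K y)) (y, x) \<le> pmf J (y, x)"
    unfolding J_def by (rule pmf_bind_ge)
  moreover have "pmf (map_pmf (Pair y) (K y)) (y, x) = pmf (K y) x"
    by (rule pmf_map_inj') (simp add: inj_def)
  ultimately have J_pos: "pmf J (y, x) > 0"
    using edge by (metis less_le_trans mult_pos_pos)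
  have "(f n y - f (Suc n) x)\<^sup>2 \<le> (E n - E (Suc n)) / pmf J (y, x)" for n
  proof -
    have "(f n u - f (Suc n) v)\<^sup>2 \<le> (2 * B)\<^sup>2" for u v
    proof -
      have "\<bar>f n u - f (Suc n) v\<bar> \<le> \<bar>2 * B\<bar>" using bnd[of n u] bnd[of "Suc n" v] by linarith
      then show ?thesis by (simp only: abs_le_square_iff)
    qed
    then have "pmf J (y, x) * (f n (fst (y, x)) - f (Suc n) (snd (y, x)))\<^sup>2 \<le> E n - E (Suc n)"
      unfolding diff[symmetric] by (intro pmf_mult_le_expectation[of _ "(2 * B)\<^sup>2"]) auto
    then show ?thesis using J_pos by (simp add: pos_le_divide_eq mult.commute)
  qed
  then have "(\<lambda>n. (f n y - f (Suc n) x)\<^sup>2) \<longlonglongrightarrow> 0"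
    by (intro tendsto_sandwich[OF _ _ tendsto_const E0]) auto
  then show ?thesis by (subst (asm) power_tendsto_0_iff) auto
qed

text \<open>\<open>density_differences_vanish\<close> relates different times; applied to an edge
  from \<open>y\<close> to \<open>z\<close> and to the loop at \<open>z\<close>, it relates
  \<open>f n y\<close> and \<open>f n z\<close> at the same time. Reachability spreads this over all
  states, and a density that becomes constant tends to 1 because its mean is 1. A general start is a
  mixture of point masses.\<close>

lemma iterate_kernel_tendsto:
  fixes K :: "'s \<Rightarrow> 's pmf"
  assumes stat: "bind_pmf P K = P" and pos: "\<And>x. pmf P x > 0" and lazy: "\<And>x. pmf (K x) x > 0"
    and reach: "\<And>y. (x1, y) \<in> {(x, y). pmf (K x) y > 0}\<^sup>*"
  shows "(\<lambda>n. pmf (iterate_kernel K n D) s) \<longlonglongrightarrow> pmf P s"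
proof -
  have point: "(\<lambda>n. pmf (iterate_kernel K n (return_pmf x0)) s) \<longlonglongrightarrow> pmf P s" for x0
  proof -
    define d where "d n = iterate_kernel K n (return_pmf x0)" for n
    define f where "f n x = pmf (d n) x / pmf P x" for n x
    \<comment> \<open>\<open>P\<close> dominates \<open>pmf P x0\<close> times the point mass at
      \<open>x0\<close>, and by stationarity this persists under iteration.\<close>
    define B where "B = 1 / pmf P x0"
    have inv: "iterate_kernel K n P = P" for n by (induction n) (simp_all add: stat)
    have bnd: "\<bar>f n x\<bar> \<le> B" for n x
    proof -
      have "pmf P x0 * pmf (d n) x \<le> pmf (bind_pmf P (\<lambda>x. iterate_kernel K n (return_pmf x))) x"
        unfolding d_def by (rule pmf_bind_ge)
      also have "\<dots> = pmf P x" by (simp add: iterate_kernel_from_points[symmetric] inv)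
      finally show ?thesis using pos[of x] pos[of x0] by (simp add: f_def B_def field_simps)
    qed
    have f: "pmf (d n) x = f n x * pmf P x" for n x using pos[of x] by (simp add: f_def)
    have edge: "(\<lambda>n. f n y - f (Suc n) x) \<longlonglongrightarrow> 0" if "pmf (K y) x > 0" for x y
      by (rule density_differences_vanish[OF stat f _ bnd pos that]) (simp add: d_def)
    have diff: "(\<lambda>n. f n x1 - f n y) \<longlonglongrightarrow> 0" for y
      using reach[of y]
    proof (induction rule: rtrancl_induct)
      case (step y z)
      then have "(\<lambda>n. (f n x1 - f n y) + (f n y - f (Suc n) z) - (f n z - f (Suc n) z)) \<longlonglongrightarrow> 0 + 0 - 0"
        by (intro tendsto_intros edge lazy) auto
      then show ?case by simp
    qed simp
    have "(\<lambda>n. measure_pmf.expectation P (\<lambda>y. f n s - f n y)) \<longlonglongrightarrow> measure_pmf.expectation P (\<lambda>y. 0)"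
    proof (rule integral_dominated_convergence[where w = "\<lambda>_. 2 * B"])
      show "AE y in measure_pmf P. (\<lambda>n. f n s - f n y) \<longlonglongrightarrow> 0"
      proof (rule AE_I2)
        fix y
        show "(\<lambda>n. f n s - f n y) \<longlonglongrightarrow> 0"
          using tendsto_diff[OF diff[of y] diff[of s]] by simp
      qed
      show "AE y in measure_pmf P. norm (f n s - f n y) \<le> 2 * B" for n
        using bnd[of n s] bnd[of n] by (intro AE_I2) (smt (verit) real_norm_def)
    qed auto
    moreover have "measure_pmf.expectation P (\<lambda>y. f n s - f n y) = f n s - 1" for n
    proof -
      have "measure_pmf.expectation (d n) (\<lambda>_. c) = c" for c :: real by simp
      then have "1 = measure_pmf.expectation (d n) (\<lambda>_. 1 :: real)" by (rule sym)
      also have "\<dots> = measure_pmf.expectation P (\<lambda>x. f n x * 1)"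
        by (rule expectation_reweighted[of _ "f n" _ B _ 1]) (use f bnd in auto)
      finally have "measure_pmf.expectation P (f n) = 1" by simp
      moreover have "integrable (measure_pmf P) (f n)"
        using bnd by (intro measure_pmf.integrable_const_bound[of _ B]) auto
      ultimately show ?thesis by simp
    qed
    ultimately have "(\<lambda>n. f n s - 1) \<longlonglongrightarrow> 0" by simp
    then have "(\<lambda>n. (f n s - 1 + 1) * pmf P s) \<longlonglongrightarrow> (0 + 1) * pmf P s"
      by (intro tendsto_intros)
    then show ?thesis by (simp add: f[symmetric] d_def)
  qed
  have "(\<lambda>n. measure_pmf.expectation D (\<lambda>x. pmf (iterate_kernel K n (return_pmf x)) s))
      \<longlonglongrightarrow> measure_pmf.expectation D (\<lambda>x. pmf P s)"
    by (rule integral_dominated_convergence[where w = "\<lambda>_. 1"]) (use point in \<open>auto simp: pmf_le_1\<close>)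
  moreover have "pmf (iterate_kernel K n D) s = measure_pmf.expectation D (\<lambda>x. pmf (iterate_kernel K n (return_pmf x)) s)" for n
    by (subst iterate_kernel_from_points) (rule pmf_bind)
  ultimately show ?thesis by simp
qed

section \<open>Stationary distributions from return times\<close>

text \<open>The transition operator of the chain killed on entering \<open>y\<close>: its
  \<open>n\<close>-th power at the indicator of \<open>z\<close> is the probability of being at
  \<open>z\<close> at time \<open>n\<close> with \<open>y\<close> avoided at times 1 to
  \<open>n\<close>.\<close>

definition taboo :: "('s \<Rightarrow> 's pmf) \<Rightarrow> 's \<Rightarrow> ('s \<Rightarrow> ennreal) \<Rightarrow> 's \<Rightarrow> ennreal" where
  "taboo K y \<phi> x = (\<integral>\<^sup>+z. indicator (- {y}) z * \<phi> z \<partial>measure_pmf (K x))"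

text \<open>The bounds are part of the induction: they turn the infinite sum of the next recursion
  step into the expectation of a bounded function.\<close>

lemma first_passage_taboo:
  fixes K :: "'s \<Rightarrow> 's pmf"
  defines "F \<equiv> first_passage (\<lambda>x y. pmf (K x) y)"
  shows "0 \<le> F (Suc n) x y \<and> F (Suc n) x y \<le> 1
    \<and> ennreal (F (Suc n) x y) = (taboo K y ^^ n) (\<lambda>x. ennreal (pmf (K x) y)) x"
proof (induction n arbitrary: x)
  case 0
  show ?case by (simp add: F_def pmf_le_1)
next
  case (Suc n)
  let ?g = "\<lambda>z. indicator (- {y}) z * F (Suc n) z y"
  have g: "0 \<le> ?g z" "?g z \<le> 1" for z using Suc by (auto simp: indicator_def)
  have "((\<lambda>z. pmf (K x) z * ?g z) has_sum measure_pmf.expectation (K x) ?g) UNIV"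
    by (rule has_sum_integral_pmf[of _ 1]) (use g in \<open>simp add: abs_le_iff order_trans[OF _ g(1)]\<close>)
  then have "((\<lambda>z. pmf (K x) z * F (Suc n) z y) has_sum measure_pmf.expectation (K x) ?g) (- {y})"
    by (subst has_sum_cong_neutral[where T = UNIV and g = "\<lambda>z. pmf (K x) z * ?g z"]) auto
  then have F: "F (Suc (Suc n)) x y = measure_pmf.expectation (K x) ?g"
    unfolding F_def by (simp add: infsumI)
  have int: "integrable (measure_pmf (K x)) ?g"
    using g by (intro measure_pmf.integrable_const_bound[of _ 1]) (auto simp: abs_le_iff intro: order_trans[of _ 0])
  have nonneg: "0 \<le> F (Suc (Suc n)) x y"
    unfolding F by (rule integral_nonneg_AE) (use g in simp)
  have "F (Suc (Suc n)) x y \<le> measure_pmf.expectation (K x) (\<lambda>_. 1)"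
    unfolding F by (rule integral_mono[OF int]) (use g in auto)
  then have le: "F (Suc (Suc n)) x y \<le> 1" by simp
  have "ennreal (F (Suc (Suc n)) x y) = (\<integral>\<^sup>+z. ennreal (?g z) \<partial>measure_pmf (K x))"
    unfolding F by (rule nn_integral_eq_integral[OF int, symmetric]) (use g in simp)
  also have "\<dots> = taboo K y ((taboo K y ^^ n) (\<lambda>x. ennreal (pmf (K x) y))) x"
    unfolding taboo_def[of K y "(taboo K y ^^ n) (\<lambda>x. ennreal (pmf (K x) y))"]
    by (intro nn_integral_cong) (use Suc in \<open>auto simp: indicator_def\<close>)
  finally show ?case using nonneg le by simp
qed

lemma taboo_zero: "(taboo K y ^^ n) (\<lambda>_. 0) = (\<lambda>_. 0)"
  by (induction n) (auto simp: taboo_def)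

lemma taboo_kernel:
  fixes K :: "'s :: countable \<Rightarrow> 's pmf"
  shows "(taboo K o' ^^ n) \<phi> x = (\<integral>\<^sup>+y. \<phi> y * (taboo K o' ^^ n) (indicator {y}) x \<partial>count_space UNIV)"
proof (induction n arbitrary: x)
  case 0
  have "(\<integral>\<^sup>+y. \<phi> y * indicator {y} x \<partial>count_space UNIV) = (\<integral>\<^sup>+y. \<phi> y * indicator {x} y \<partial>count_space UNIV)"
    by (intro nn_integral_cong) (auto simp: indicator_def)
  also have "\<dots> = \<phi> x" by simp
  finally show ?case by simp
next
  case (Suc n)
  have "(taboo K o' ^^ Suc n) \<phi> x = (\<integral>\<^sup>+z. \<integral>\<^sup>+y. indicator (- {o'}) z * (\<phi> y * (taboo K o' ^^ n) (indicator {y}) z) \<partial>count_space UNIV \<partial>measure_pmf (K x))"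
    unfolding funpow.simps o_apply taboo_def[of K o' "(taboo K o' ^^ n) \<phi>"] Suc by (simp add: nn_integral_cmult)
  also have "\<dots> = (\<integral>\<^sup>+y. \<integral>\<^sup>+z. indicator (- {o'}) z * (\<phi> y * (taboo K o' ^^ n) (indicator {y}) z) \<partial>measure_pmf (K x) \<partial>count_space UNIV)"
    by (rule nn_integral_count_space_nn_integral) auto
  also have "\<dots> = (\<integral>\<^sup>+y. \<phi> y * (taboo K o' ^^ Suc n) (indicator {y}) x \<partial>count_space UNIV)"
    unfolding funpow.simps o_apply taboo_def[of K o' "(taboo K o' ^^ n) (indicator {_})"]
    by (intro nn_integral_cong) (simp add: nn_integral_cmult[symmetric] mult.left_commute)
  finally show ?case .
qed

text \<open>A chain that has avoided \<open>y\<close> for \<open>n\<close> steps either enters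
  \<open>y\<close> at the next step or goes on avoiding it.\<close>

lemma taboo_split:
  fixes K :: "'s \<Rightarrow> 's pmf"
  shows "(taboo K y ^^ n) (\<lambda>_. 1) x
    = (taboo K y ^^ n) (\<lambda>x. ennreal (pmf (K x) y)) x + (taboo K y ^^ Suc n) (\<lambda>_. 1) x"
proof (induction n arbitrary: x)
  case 0
  have "1 = (\<integral>\<^sup>+z. indicator {y} z + indicator (- {y}) z \<partial>measure_pmf (K x))"
    by (subst nn_integral_cong[of _ _ "\<lambda>_. 1"]) (auto simp: indicator_def measure_pmf.emeasure_space_1)
  also have "\<dots> = ennreal (pmf (K x) y) + taboo K y (\<lambda>_. 1) x"
    by (subst nn_integral_add) (auto simp: taboo_def emeasure_pmf_single)
  finally show ?case by simp
next
  case (Suc n)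
  have "taboo K y (\<lambda>x. a x + b x) x = taboo K y a x + taboo K y b x" for a b
    by (simp add: taboo_def distrib_left nn_integral_add)
  moreover have "(taboo K y ^^ Suc n) (\<lambda>_. 1) x = taboo K y (\<lambda>x. (taboo K y ^^ n) (\<lambda>_. 1) x) x"
    by simp
  ultimately show ?case using Suc by simp
qed

text \<open>The first sum is the mean return time, written as the sum of the tails of the return time.\<close>

lemma taboo_mass_summable:
  fixes K :: "'s \<Rightarrow> 's pmf"
  defines "F \<equiv> first_passage (\<lambda>x y. pmf (K x) y)"
  assumes sums: "(\<lambda>n. F n y y) sums 1" and mean: "summable (\<lambda>n. real n * F n y y)"
  shows "(\<Sum>n. (taboo K y ^^ n) (\<lambda>_. 1) y) < \<infinity>"
    and "(\<Sum>n. (taboo K y ^^ n) (\<lambda>x. ennreal (pmf (K x) y)) y) = 1"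
proof -
  define f where "f n = F (Suc n) y y" for n
  have f: "0 \<le> f n" "ennreal (f n) = (taboo K y ^^ n) (\<lambda>x. ennreal (pmf (K x) y)) y" for n
    using first_passage_taboo[of K n y y] by (simp_all add: f_def F_def)
  have f1: "f sums 1" unfolding f_def using sums by (subst sums_Suc_iff) (simp add: F_def)
  show "(\<Sum>n. (taboo K y ^^ n) (\<lambda>x. ennreal (pmf (K x) y)) y) = 1"
    using suminf_ennreal_eq[OF f(1) f1] by (simp add: f(2))
  \<comment> \<open>\<open>f n\<close> is the probability of return time \<open>n + 1\<close>, so
    \<open>g n\<close> is the probability that the return time exceeds \<open>n\<close>.\<close>
  define g where "g n = (\<Sum>k. f (k + n))" for n
  have g: "1 = (\<Sum>k<n. f k) + g n" for n
    using suminf_split_initial_segment[of f n] f1 unfolding g_def by (simp add: sums_iff add.commute)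
  have g_nonneg: "0 \<le> g n" for n
    unfolding g_def using f f1 by (intro suminf_nonneg summable_ignore_initial_segment) (auto simp: sums_iff)
  have G: "(taboo K y ^^ n) (\<lambda>_. 1) y = ennreal (g n)" for n
  proof -
    have "1 = ennreal (\<Sum>k<n. f k) + (taboo K y ^^ n) (\<lambda>_. 1) y"
    proof (induction n)
      case (Suc n)
      then show ?case
        unfolding taboo_split[where n = n and x = y] f(2)[symmetric] sum.lessThan_Suc
        using f by (simp add: ennreal_plus sum_nonneg add.assoc)
    qed simp
    moreover have "1 = ennreal (\<Sum>k<n. f k) + ennreal (g n)"
      using g[of n] g_nonneg f by (metis ennreal_1 ennreal_plus sum_nonneg)
    ultimately have "ennreal (\<Sum>k<n. f k) + (taboo K y ^^ n) (\<lambda>_. 1) y = ennreal (\<Sum>k<n. f k) + ennreal (g n)"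
      by (rule trans[OF sym])
    then show ?thesis by (simp add: ennreal_add_left_cancel)
  qed
  have kf: "summable (\<lambda>k. real (Suc k) * f k)"
    using mean unfolding f_def by (subst (asm) summable_Suc_iff[symmetric])
  have "summable g"
  proof (rule summableI_nonneg_bounded)
    fix n
    \<comment> \<open>Summation by parts; the remainder \<open>n * g n\<close> is bounded by the
      tail of the mean return time.\<close>
    have "(\<Sum>k<n. g k) = (\<Sum>k<n. real (Suc k) * f k) + real n * g n"
    proof (induction n)
      case (Suc n)
      have "g n = f n + g (Suc n)" using g[of n] g[of "Suc n"] by simp
      then show ?case using Suc by (simp add: algebra_simps)
    qed simp
    also have "real n * g n \<le> (\<Sum>k. real (Suc (k + n)) * f (k + n))"
    proof -
      have sf: "summable (\<lambda>k. f (k + n))" using f1 by (intro summable_ignore_initial_segment) (simp add: sums_iff)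
      have "real n * g n = (\<Sum>k. real n * f (k + n))" unfolding g_def using sf by (rule suminf_mult[symmetric])
      also have "\<dots> \<le> (\<Sum>k. real (Suc (k + n)) * f (k + n))"
        using f summable_ignore_initial_segment[OF kf, of n] sf
        by (intro suminf_le summable_mult mult_right_mono) auto
      finally show ?thesis .
    qed
    also have "(\<Sum>k<n. real (Suc k) * f k) + (\<Sum>k. real (Suc (k + n)) * f (k + n)) = (\<Sum>k. real (Suc k) * f k)"
      using suminf_split_initial_segment[OF kf, of n] by simp
    finally show "(\<Sum>k<n. g k) \<le> (\<Sum>k. real (Suc k) * f k)" by simp
  qed (rule g_nonneg)
  then show "(\<Sum>n. (taboo K y ^^ n) (\<lambda>_. 1) y) < \<infinity>"
    unfolding G using suminf_ennreal2[OF g_nonneg] by (simp add: less_top[symmetric])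
qed

text \<open>The cycle formula: \<open>T y\<close> is the expected number of visits to
  \<open>y\<close> during an excursion from \<open>x0\<close>, with time 0 counted and the return
  not counted. Its total \<open>m\<close> is the mean return time, and \<open>T / m\<close> is
  stationary.\<close>

lemma stationary_pmf_exists:
  fixes K :: "'s :: countable \<Rightarrow> 's pmf"
  defines "F \<equiv> first_passage (\<lambda>x y. pmf (K x) y)"
  assumes sums: "(\<lambda>n. F n x0 x0) sums 1" and mean: "summable (\<lambda>n. real n * F n x0 x0)"
    and reach: "\<And>y. (x0, y) \<in> {(x, y). pmf (K x) y > 0}\<^sup>*"
  obtains P where "bind_pmf P K = P" "\<And>x. pmf P x > 0"
proof -
  let ?A = "taboo K x0"
  define T where "T y = (\<Sum>n. (?A ^^ n) (indicator {y}) x0)" for y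
  define m where "m = (\<Sum>n. (?A ^^ n) (\<lambda>_. 1) x0)"
  note fin = taboo_mass_summable[where K = K and y = x0, folded F_def, OF sums mean]
  have total: "(\<integral>\<^sup>+y. T y \<partial>count_space UNIV) = m"
    unfolding T_def m_def
    by (subst nn_integral_suminf) (auto simp: taboo_kernel[where \<phi> = "\<lambda>_. 1"])
  have shift: "(\<Sum>n. f n) = f 0 + (\<Sum>n. f (Suc n))" for f :: "nat \<Rightarrow> ennreal"
    using suminf_offset[of f 1] by simp
  have T0: "T x0 = 1"
  proof -
    have "(?A ^^ Suc n) (indicator {x0}) x0 = 0" for n
    proof -
      have "indicator (- {x0}) z * indicator {x0} z = (0 :: ennreal)" for z
        by (simp add: indicator_def)
      then have "?A (indicator {x0}) = (\<lambda>_. 0)" by (intro ext) (simp add: taboo_def)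
      then show ?thesis unfolding funpow_Suc_right o_def by (simp add: taboo_zero)
    qed
    then show ?thesis unfolding T_def by (subst shift) simp
  qed
  \<comment> \<open>One step of the chain advances the time within the excursion by one. For
    \<open>y = x0\<close> the sum counts the return itself, which is certain by recurrence and
    matches \<open>T x0 = 1\<close>.\<close>
  have T_inv: "(\<integral>\<^sup>+x. T x * ennreal (pmf (K x) y) \<partial>count_space UNIV) = T y" for y
  proof -
    have "(\<integral>\<^sup>+x. T x * ennreal (pmf (K x) y) \<partial>count_space UNIV)
        = (\<Sum>n. \<integral>\<^sup>+x. ennreal (pmf (K x) y) * (?A ^^ n) (indicator {x}) x0 \<partial>count_space UNIV)"
      unfolding T_def by (subst nn_integral_suminf[symmetric]) (auto simp: mult.commute)
    also have "\<dots> = (\<Sum>n. (?A ^^ n) (\<lambda>x. ennreal (pmf (K x) y)) x0)"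
      by (subst taboo_kernel[where \<phi> = "\<lambda>x. ennreal (pmf (K x) y)"]) simp
    also have "\<dots> = T y"
    proof (cases "y = x0")
      case True
      then show ?thesis using fin(2) T0 by simp
    next
      case False
      have "(\<lambda>x. ennreal (pmf (K x) y)) = ?A (indicator {y})"
      proof
        fix x
        have "ennreal (pmf (K x) y) = (\<integral>\<^sup>+z. indicator {y} z \<partial>measure_pmf (K x))"
          by (simp add: emeasure_pmf_single)
        also have "\<dots> = ?A (indicator {y}) x"
          unfolding taboo_def using False by (intro nn_integral_cong) (auto simp: indicator_def)
        finally show "ennreal (pmf (K x) y) = ?A (indicator {y}) x" .
      qed
      then have "(\<Sum>n. (?A ^^ n) (\<lambda>x. ennreal (pmf (K x) y)) x0) = (\<Sum>n. (?A ^^ Suc n) (indicator {y}) x0)"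
        by (simp add: funpow_swap1)
      also have "\<dots> = T y"
        unfolding T_def using False by (subst (2) shift) simp
      finally show ?thesis .
    qed
    finally show ?thesis .
  qed
  have "T x0 \<le> m"
    unfolding total[symmetric] using nn_integral_ge_point[of x0 UNIV T] by simp
  then have m: "m \<noteq> 0" "m \<noteq> \<infinity>" using T0 fin(1) by (auto simp: m_def)
  have T_le: "T y \<le> m" for y
    unfolding total[symmetric] using nn_integral_ge_point[of y UNIV T] by simp
  define P where "P = embed_pmf (\<lambda>y. enn2real (T y / m))"
  have Tm: "ennreal (enn2real (T y / m)) = T y / m" for y
    using T_le[of y] m by (intro ennreal_enn2real) (auto simp: ennreal_divide_eq_top_iff less_top[symmetric] top_unique)
  have P: "ennreal (pmf P y) = T y / m" for y
  proof -
    have "(\<integral>\<^sup>+y. ennreal (enn2real (T y / m)) \<partial>count_space UNIV) = 1"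
      unfolding Tm using m by (simp add: nn_integral_divide total ennreal_divide_self less_top)
    then have "pmf P y = enn2real (T y / m)"
      unfolding P_def by (intro pmf_embed_pmf) auto
    then show ?thesis by (simp add: Tm)
  qed
  have inv: "bind_pmf P K = P"
  proof (rule pmf_eqI)
    fix y
    have "ennreal (pmf (bind_pmf P K) y) = (\<integral>\<^sup>+x. (T x * ennreal (pmf (K x) y)) / m \<partial>count_space UNIV)"
      by (simp add: ennreal_pmf_bind nn_integral_measure_pmf P divide_ennreal_def ac_simps)
    also have "\<dots> = ennreal (pmf P y)" by (simp add: nn_integral_divide T_inv P)
    finally show "pmf (bind_pmf P K) y = pmf P y" by simp
  qed
  have "pmf P y > 0" for y
    using reach[of y]
  proof (induction rule: rtrancl_induct)
    case base
    have "ennreal (pmf P x0) \<noteq> 0" using P[of x0] T0 m by (simp add: ennreal_divide_eq_0_iff)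
    then show ?case by (simp add: pmf_pos)
  next
    case (step y z)
    have "pmf P y * pmf (K y) z \<le> pmf P z" using pmf_bind_ge[of P y K z] by (simp add: inv)
    moreover have "0 < pmf P y * pmf (K y) z" using step by simp
    ultimately show ?case by linarith
  qed
  with inv show thesis by (rule that)
qed

section \<open>The orbit queue system\<close>

locale gjsoq =
  fixes lam0 lam1 lam2 \<mu> \<alpha>1 \<alpha>2 lam :: real
  assumes pos: "lam0 > 0" "lam1 > 0" "lam2 > 0" "\<mu> > 0" "\<alpha>1 > 0" "\<alpha>2 > 0"
    and lam: "lam = lam0 + lam1 + lam2"
    and normalized: "lam + \<mu> + \<alpha>1 + \<alpha>2 = 1"
begin

abbreviation "trans_prob \<equiv> gjsoq_trans lam0 lam1 lam2 \<mu> \<alpha>1 \<alpha>2"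

definition kernel :: "nat \<times> nat \<times> bool \<Rightarrow> (nat \<times> nat \<times> bool) pmf" where
  "kernel s = embed_pmf (trans_prob s)"

text \<open>A finite set that contains the support. With an empty orbit, truncated subtraction makes
  some of the listed states coincide.\<close>

fun targets :: "nat \<times> nat \<times> bool \<Rightarrow> (nat \<times> nat \<times> bool) set" where
  "targets (i, j, False) = {(i, j, False), (i, j, True), (i - 1, j, True), (i, j - 1, True)}"
| "targets (i, j, True) = {(i, j, False), (i, j, True), (i + 1, j, True), (i, j + 1, True)}"

lemma arrival_rates:
  "(lam1 + lam0 * h (int j - int i)) + (lam2 + lam0 * h (int i - int j)) = lam"
  "0 < lam1 + lam0 * h (int j - int i)" "0 < lam2 + lam0 * h (int i - int j)"
proof -
  have "h (int i - int j) = 1 - h (int j - int i)"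
    using h_add_minus[of "int j - int i"] by simp
  show "(lam1 + lam0 * h (int j - int i)) + (lam2 + lam0 * h (int i - int j)) = lam"
    unfolding lam \<open>h (int i - int j) = 1 - h (int j - int i)\<close> by (simp add: algebra_simps)
  show "0 < lam1 + lam0 * h (int j - int i)" "0 < lam2 + lam0 * h (int i - int j)"
    using pos h_bounds by (auto intro!: add_pos_nonneg)
qed

lemma trans_prob_nonneg: "0 \<le> trans_prob s t"
proof -
  obtain i j c where s: "s = (i, j, c)" by (metis prod_cases3)
  have "0 \<le> 1 - (lam0 + lam1 + lam2) - \<alpha>1 * of_bool (i > 0) - \<alpha>2 * of_bool (j > 0)"
    using pos lam normalized by auto
  then show ?thesis
    using s pos arrival_rates(2,3)[of j i] arrival_rates(2,3)[of i j]
    by (cases c) (auto intro!: add_nonneg_nonneg mult_nonneg_nonneg)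
qed

lemma trans_prob_outside: "t \<notin> targets s \<Longrightarrow> trans_prob s t = 0"
  by (cases s rule: targets.cases) auto

lemma trans_prob_sum:
  "(\<Sum>t\<in>targets (i, j, False). f t * trans_prob (i, j, False) t)
    = lam * f (i, j, True) + \<alpha>1 * of_bool (i > 0) * f (i - 1, j, True) + \<alpha>2 * of_bool (j > 0) * f (i, j - 1, True)
      + (1 - lam - \<alpha>1 * of_bool (i > 0) - \<alpha>2 * of_bool (j > 0)) * f (i, j, False)"
  "(\<Sum>t\<in>targets (i, j, True). f t * trans_prob (i, j, True) t)
    = \<mu> * f (i, j, False) + (lam1 + lam0 * h (int j - int i)) * f (i + 1, j, True)
      + (lam2 + lam0 * h (int i - int j)) * f (i, j + 1, True) + (\<alpha>1 + \<alpha>2) * f (i, j, True)"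
proof -
  show "(\<Sum>t\<in>targets (i, j, False). f t * trans_prob (i, j, False) t)
    = lam * f (i, j, True) + \<alpha>1 * of_bool (i > 0) * f (i - 1, j, True) + \<alpha>2 * of_bool (j > 0) * f (i, j - 1, True)
      + (1 - lam - \<alpha>1 * of_bool (i > 0) - \<alpha>2 * of_bool (j > 0)) * f (i, j, False)"
    by (cases i; cases j) (simp_all add: sum.insert_if lam algebra_simps)
  show "(\<Sum>t\<in>targets (i, j, True). f t * trans_prob (i, j, True) t)
    = \<mu> * f (i, j, False) + (lam1 + lam0 * h (int j - int i)) * f (i + 1, j, True)
      + (lam2 + lam0 * h (int i - int j)) * f (i, j + 1, True) + (\<alpha>1 + \<alpha>2) * f (i, j, True)"
    by simp
qed

lemma pmf_kernel: "pmf (kernel s) t = trans_prob s t"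
proof -
  have fin: "finite (targets s)" by (cases s rule: targets.cases) auto
  have "(\<Sum>t\<in>targets s. trans_prob s t) = 1"
  proof -
    obtain i j c where s: "s = (i, j, c)" by (metis prod_cases3)
    show ?thesis
      using trans_prob_sum[of "\<lambda>_. 1" i j] arrival_rates(1)[of j i] normalized
      by (cases c) (simp_all add: s del: targets.simps gjsoq_trans.simps)
  qed
  then have "(\<integral>\<^sup>+t. ennreal (trans_prob s t) \<partial>count_space UNIV) = 1"
    using fin trans_prob_outside[of _ s] trans_prob_nonneg
    by (subst nn_integral_count_space'[of "targets s"]) (auto simp: sum_ennreal)
  then show ?thesis unfolding kernel_def by (intro pmf_embed_pmf trans_prob_nonneg)
qed

lemma expectation_kernel: "measure_pmf.expectation (kernel s) f = (\<Sum>t\<in>targets s. f t * trans_prob s t)"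
proof -
  have "finite (targets s)" by (cases s rule: targets.cases) auto
  then have "measure_pmf.expectation (kernel s) f = (\<Sum>t\<in>targets s. f t * pmf (kernel s) t)"
    by (intro integral_measure_pmf_real) (metis set_pmf_iff pmf_kernel trans_prob_outside)+
  then show ?thesis by (simp add: pmf_kernel)
qed

text \<open>By the normalization an idle state is kept with probability at least \<mu>, a busy one
  with probability \<alpha>1 + \<alpha>2.\<close>

lemma kernel_lazy: "pmf (kernel s) s > 0"
proof -
  obtain i j c where s: "s = (i, j, c)" by (metis prod_cases3)
  have "0 < 1 - (lam0 + lam1 + lam2) - \<alpha>1 * of_bool (i > 0) - \<alpha>2 * of_bool (j > 0)"
    using pos lam normalized by auto
  then show ?thesis using s pos by (cases c) (auto simp: pmf_kernel)
qed

text \<open>Arrivals at the busy server lead to every busy state, and a service completion then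
  leads to the idle one.\<close>

lemma kernel_reach: "((0, 0, True), s) \<in> {(x, y). pmf (kernel x) y > 0}\<^sup>*"
proof -
  let ?E = "{(x, y). pmf (kernel x) y > 0}"
  have right: "((i, j, True), (Suc i, j, True)) \<in> ?E" and up: "((i, j, True), (i, Suc j, True)) \<in> ?E"
    and idle: "((i, j, True), (i, j, False)) \<in> ?E" for i j
    using pos arrival_rates(2,3)[where i = i and j = j] by (simp_all add: pmf_kernel)
  have "((0, 0, True), (i, 0, True)) \<in> ?E\<^sup>*" for i
    by (induction i) (use right in \<open>auto intro: rtrancl_into_rtrancl\<close>)
  then have busy: "((0, 0, True), (i, j, True)) \<in> ?E\<^sup>*" for i j
    by (induction j) (use up in \<open>auto intro: rtrancl_into_rtrancl\<close>)
  obtain i j c where s: "s = (i, j, c)" by (metis prod_cases3)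
  show ?thesis unfolding s using busy[of i j] idle[of i j] by (cases c) (auto intro: rtrancl_into_rtrancl)
qed

end

locale gjsoq_stationary = gjsoq +
  fixes P :: "(nat \<times> nat \<times> bool) pmf"
  assumes stationary: "bind_pmf P kernel = P" and P_pos: "pmf P s > 0"
begin

text \<open>The exit rate of an idle state with both orbits nonempty; it is also the factor that
  produces the hatted arrival rates.\<close>

definition D :: real where "D = lam + \<alpha>1 + \<alpha>2"

lemma D_pos: "D > 0" "lam > 0"
proof -
  show "lam > 0" using pos by (simp add: lam)
  then show "D > 0" using pos by (simp add: D_def)
qed

lemma expectation_stationary:
  fixes f :: "nat \<times> nat \<times> bool \<Rightarrow> real"
  assumes "\<And>s. \<bar>f s\<bar> \<le> B"
  shows "measure_pmf.expectation P (\<lambda>s. measure_pmf.expectation (kernel s) f - f s) = 0"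
proof -
  have bnd: "\<bar>measure_pmf.expectation (kernel s) f\<bar> \<le> B" for s
    by (rule abs_expectation_le[OF assms])
  have "integrable (measure_pmf P) f" "integrable (measure_pmf P) (\<lambda>s. measure_pmf.expectation (kernel s) f)"
    using assms bnd by (auto intro!: measure_pmf.integrable_const_bound[of _ B])
  moreover have "measure_pmf.expectation P (\<lambda>s. measure_pmf.expectation (kernel s) f) = measure_pmf.expectation P f"
    using expectation_bind[OF assms, of P kernel] by (simp add: stationary)
  ultimately show ?thesis by simp
qed

text \<open>An idle state is entered from another state only by a service completion at the same
  orbit lengths.\<close>

lemma idle_balance:
  "(lam + \<alpha>1 * of_bool (i > 0) + \<alpha>2 * of_bool (j > 0)) * pmf P (i, j, False) = \<mu> * pmf P (i, j, True)"
proof -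
  let ?s = "(i, j, False)"
  have "pmf P ?s = measure_pmf.expectation P (\<lambda>s. pmf (kernel s) ?s)"
    by (subst stationary[symmetric]) (rule pmf_bind)
  also have "\<dots> = (\<Sum>s\<in>{(i, j, False), (i, j, True)}. pmf (kernel s) ?s * pmf P s)"
  proof (rule integral_measure_pmf_real)
    fix s assume "pmf (kernel s) ?s \<noteq> 0"
    then show "s \<in> {(i, j, False), (i, j, True)}"
      by (cases s rule: targets.cases) (auto simp: pmf_kernel split: if_splits)
  qed simp
  finally show ?thesis
    by (simp add: pmf_kernel lam algebra_simps)
qed

text \<open>When orbit 2 is empty, an idle period ends with a retrial from orbit 1 with probability
  \<open>\<alpha>1 / (lam + \<alpha>1)\<close>. The factor \<open>D\<close> is the common change of
  time scale; with both orbits nonempty it cancels the exit rate and leaves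
  \<open>\<mu> * \<alpha>1\<close>.\<close>

definition M1' :: real where "M1' = \<mu> * \<alpha>1 * D / (lam + \<alpha>1)"
definition M2' :: real where "M2' = \<mu> * \<alpha>2 * D / (lam + \<alpha>2)"

lemma has_sum_busy:
  assumes "((\<lambda>s. pmf P s * g s) has_sum S) UNIV" "\<And>i j. g (i, j, False) = 0"
  shows "((\<lambda>(i, j). pmf P (i, j, True) * g (i, j, True)) has_sum S) UNIV"
proof -
  let ?b = "\<lambda>(i, j). (i, j, True) :: nat \<times> nat \<times> bool"
  have "s \<in> range ?b \<or> g s = 0" for s
    using assms(2) by (cases s rule: targets.cases) (auto simp: image_iff)
  then have "((\<lambda>s. pmf P s * g s) has_sum S) (range ?b)"
    using assms(1) by (subst has_sum_cong_neutral[where T = UNIV and g = "\<lambda>s. pmf P s * g s"]) auto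
  moreover have "inj ?b" by (auto simp: inj_def)
  ultimately show ?thesis by (simp add: has_sum_reindex o_def case_prod_unfold)
qed

text \<open>Watched only while busy, the system is the walk above: a service completion and the idle
  period after it remove one job from an orbit or change nothing. Speeding up time by
  \<open>D\<close> clears the denominators.\<close>

lemma busy_invariant:
  assumes \<rho>: "\<rho> * (\<mu> * \<alpha>1 + \<mu> * \<alpha>2) = lam * D" and \<rho>_less: "\<rho> < 1" "lam1 * D < \<rho> * (\<mu> * \<alpha>1)" "lam2 * D < \<rho> * (\<mu> * \<alpha>2)"
    and \<gamma>: "\<gamma>1 = \<mu> * \<alpha>1 * \<rho>\<^sup>2 + lam2 * D" "\<gamma>2 = \<mu> * \<alpha>2 * \<rho>\<^sup>2 + lam1 * D"
      "\<gamma>1 < \<gamma>2 + lam0 * D" "\<gamma>2 < \<gamma>1 + lam0 * D"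
  shows "gjsq_invariant (lam0 * D) (lam1 * D) (lam2 * D) (\<mu> * \<alpha>1) (\<mu> * \<alpha>2) M1' M2' \<rho> \<gamma>1 \<gamma>2
    (\<lambda>i j. pmf P (i, j, True))"
proof -
  \<comment> \<open>\<open>a\<close> is the retrial rate of the nonempty orbit and \<open>b\<close>
    that of the empty one; the upper bound reduces to \<open>b * lam \<ge> 0\<close>.\<close>
  have le: "\<mu> * a \<le> \<mu> * a * D / (lam + a)" "\<mu> * a * D / (lam + a) \<le> \<mu> * \<alpha>1 + \<mu> * \<alpha>2"
    if "D = lam + a + b" "a + b = \<alpha>1 + \<alpha>2" "a > 0" "b > 0" for a b
  proof -
    have w: "lam + a > 0" using that D_pos by simp
    have "\<mu> * a * (lam + a) \<le> \<mu> * a * D" using that pos by (intro mult_left_mono) auto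
    then show "\<mu> * a \<le> \<mu> * a * D / (lam + a)" using w by (simp add: pos_le_divide_eq)
    have "a * D \<le> (a + b) * (lam + a)"
    proof -
      have "0 \<le> b * lam" using that D_pos by simp
      then show ?thesis unfolding that(1) by (simp add: algebra_simps)
    qed
    then have "\<mu> * (a * D) \<le> \<mu> * ((a + b) * (lam + a))" using pos by (intro mult_left_mono) auto
    then have "\<mu> * a * D \<le> (\<mu> * \<alpha>1 + \<mu> * \<alpha>2) * (lam + a)"
      unfolding that(2) by (simp add: algebra_simps)
    then show "\<mu> * a * D / (lam + a) \<le> \<mu> * \<alpha>1 + \<mu> * \<alpha>2"
      using w by (simp add: pos_divide_le_eq)
  qed
  have M: "\<mu> * \<alpha>1 \<le> M1'" "M1' \<le> \<mu> * \<alpha>1 + \<mu> * \<alpha>2" "\<mu> * \<alpha>2 \<le> M2'" "M2' \<le> \<mu> * \<alpha>1 + \<mu> * \<alpha>2"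
    unfolding M1'_def M2'_def using le[of \<alpha>1 \<alpha>2] le[of \<alpha>2 \<alpha>1] pos by (simp_all add: D_def)
  interpret gjsq "lam0 * D" "lam1 * D" "lam2 * D" "\<mu> * \<alpha>1" "\<mu> * \<alpha>2" M1' M2' \<rho> \<gamma>1 \<gamma>2
    "\<lambda>i j. pmf P (i, j, True)"
    by standard (use pos D_pos M \<rho> \<rho>_less \<gamma> P_pos in \<open>simp_all add: lam distrib_right\<close>)
  show ?thesis
  proof
    fix V :: "nat \<Rightarrow> nat \<Rightarrow> real" and B
    assume V: "\<And>i j. \<bar>V i j\<bar> \<le> B"
    \<comment> \<open>\<open>V\<close> is extended to the idle states harmonically, so that only the busy states contribute.\<close>
    define w where "w i j = lam + \<alpha>1 * of_bool (i > 0) + \<alpha>2 * of_bool (j > 0)" for i j :: nat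
    define I where "I i j = lam * V i j + \<alpha>1 * of_bool (i > 0) * V (i - 1) j + \<alpha>2 * of_bool (j > 0) * V i (j - 1)" for i j
    define f where "f = (\<lambda>(i, j, c). if c then V i j else I i j / w i j)"
    have w: "w i j > 0" for i j using pos D_pos by (auto simp: w_def intro!: add_pos_nonneg)
    have f_bnd: "\<bar>f s\<bar> \<le> B" for s
    proof (cases s rule: targets.cases)
      case (1 i j)
      have "\<bar>I i j\<bar> \<le> \<bar>lam * V i j\<bar> + \<bar>\<alpha>1 * of_bool (i > 0) * V (i - 1) j\<bar> + \<bar>\<alpha>2 * of_bool (j > 0) * V i (j - 1)\<bar>"
        unfolding I_def by linarith
      also have "\<dots> \<le> lam * B + \<alpha>1 * of_bool (i > 0) * B + \<alpha>2 * of_bool (j > 0) * B"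
        using pos D_pos by (intro add_mono) (auto simp: abs_mult V)
      also have "\<dots> = B * w i j" by (simp add: w_def algebra_simps)
      finally show ?thesis using 1 w[of i j] by (simp add: f_def pos_divide_le_eq)
    qed (use V in \<open>simp add: f_def\<close>)
    define g where "g s = measure_pmf.expectation (kernel s) f - f s" for s
    have g_idle: "g (i, j, False) = 0" for i j
    proof -
      have "g (i, j, False) = I i j + (1 - w i j) * (I i j / w i j) - I i j / w i j"
        unfolding g_def expectation_kernel trans_prob_sum by (simp add: f_def I_def w_def)
      then show ?thesis using w[of i j] by (simp add: field_simps)
    qed
    have g_busy: "g (i, j, True) * D = gen V i j" for i j
    proof -
      have down: "D * (\<mu> * (I i j / w i j - V i j)) = down1 i j * (V (i - 1) j - V i j) + down2 i j * (V i (j - 1) - V i j)"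
      proof -
        have "D * (\<mu> * (I i j / w i j - V i j)) = D * \<mu> / w i j *
            (\<alpha>1 * of_bool (i > 0) * (V (i - 1) j - V i j) + \<alpha>2 * of_bool (j > 0) * (V i (j - 1) - V i j))"
          using w[of i j] by (simp add: I_def w_def field_simps)
        also have "\<dots> = down1 i j * (V (i - 1) j - V i j) + down2 i j * (V i (j - 1) - V i j)"
          unfolding down1_def down2_def w_def unfolding M1'_def M2'_def
          using D_pos by (cases "i = 0"; cases "j = 0") (simp_all add: distrib_left flip: D_def)
        finally show ?thesis .
      qed
      have "g (i, j, True) = \<mu> * (I i j / w i j - V i j)
          + (lam1 + lam0 * h (int j - int i)) * (V (i + 1) j - V i j)
          + (lam2 + lam0 * h (int i - int j)) * (V i (j + 1) - V i j)
          + (\<mu> + (lam1 + lam0 * h (int j - int i)) + (lam2 + lam0 * h (int i - int j)) + \<alpha>1 + \<alpha>2 - 1) * V i j"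
        unfolding g_def expectation_kernel trans_prob_sum by (simp add: f_def algebra_simps)
      moreover have "\<mu> + (lam1 + lam0 * h (int j - int i)) + (lam2 + lam0 * h (int i - int j)) + \<alpha>1 + \<alpha>2 - 1 = 0"
        using arrival_rates(1)[where i = i and j = j] normalized by linarith
      ultimately have "g (i, j, True) * D = D * (\<mu> * (I i j / w i j - V i j))
          + up1 i j * (V (i + 1) j - V i j) + up2 i j * (V i (j + 1) - V i j)"
        by (simp only:) (simp add: up1_def up2_def algebra_simps)
      then show ?thesis unfolding down by (simp add: gen_def)
    qed
    have "\<bar>g s\<bar> \<le> 2 * B" for s
    proof -
      have "\<bar>measure_pmf.expectation (kernel s) f\<bar> \<le> B" by (rule abs_expectation_le[OF f_bnd])
      then show ?thesis using f_bnd[of s] by (simp add: g_def)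
    qed
    then have "((\<lambda>s. pmf P s * g s) has_sum measure_pmf.expectation P g) UNIV"
      by (rule has_sum_integral_pmf)
    moreover have "measure_pmf.expectation P g = 0"
      unfolding g_def by (rule expectation_stationary[OF f_bnd])
    ultimately have "((\<lambda>(i, j). pmf P (i, j, True) * g (i, j, True)) has_sum 0) UNIV"
      using g_idle by (intro has_sum_busy) simp_all
    then have "((\<lambda>x. (case x of (i, j) \<Rightarrow> pmf P (i, j, True) * g (i, j, True)) * D) has_sum 0 * D) UNIV"
      by (rule has_sum_cmult_left)
    then show "((\<lambda>(i, j). pmf P (i, j, True) * gen V i j) has_sum 0) UNIV"
      by (simp add: case_prod_unfold mult.assoc g_busy)
  qed
qed

end

text \<open>\<open>lim\<close> has a value even for a divergent sequence, so the first conjunct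
  certifies that \<pi> consists of genuine limits. The existentially bound \<open>x\<close> is tied
  to the scaled limits of the busy probabilities, which determine it.\<close>

theorem corollary1:
  fixes lam0 lam1 lam2 \<mu> \<alpha>1 \<alpha>2 :: real
    and lam lamh lamh0 lamh1 lamh2 \<mu>h1 \<mu>h2 \<rho>1 \<rho>2 \<rho> \<gamma>1 \<gamma>2 :: real
    and M :: "'w measure"
    and N1 N2 :: "nat \<Rightarrow> 'w \<Rightarrow> nat" and C :: "nat \<Rightarrow> 'w \<Rightarrow> bool"
    and \<pi> :: "nat \<Rightarrow> int \<Rightarrow> bool \<Rightarrow> real"
  assumes pos: "lam0 > 0" "lam1 > 0" "lam2 > 0" "\<mu> > 0" "\<alpha>1 > 0" "\<alpha>2 > 0"
    and lam: "lam = lam0 + lam1 + lam2"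
    and normalized: "lam + \<mu> + \<alpha>1 + \<alpha>2 = 1"
    and chain: "markov_chain M (gjsoq_trans lam0 lam1 lam2 \<mu> \<alpha>1 \<alpha>2)
                  (\<lambda>n \<omega>. (N1 n \<omega>, N2 n \<omega>, C n \<omega>))"
    and recurrent: "positive_recurrent (gjsoq_trans lam0 lam1 lam2 \<mu> \<alpha>1 \<alpha>2)"
    and lamh: "lamh = lam * (lam + \<alpha>1 + \<alpha>2)"
    and lamh0: "lamh0 = lam0 * (lam + \<alpha>1 + \<alpha>2)"
    and lamh1: "lamh1 = lam1 * (lam + \<alpha>1 + \<alpha>2)"
    and lamh2: "lamh2 = lam2 * (lam + \<alpha>1 + \<alpha>2)"
    and \<mu>h1: "\<mu>h1 = \<mu> * \<alpha>1"
    and \<mu>h2: "\<mu>h2 = \<mu> * \<alpha>2"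
    and \<rho>1: "\<rho>1 = lamh1 / \<mu>h1"
    and \<rho>2: "\<rho>2 = lamh2 / \<mu>h2"
    and \<rho>: "\<rho> = lamh / (\<mu>h1 + \<mu>h2)"
    and \<gamma>1: "\<gamma>1 = \<mu>h1 * \<rho>\<^sup>2 + lamh2"
    and \<gamma>2: "\<gamma>2 = \<mu>h2 * \<rho>\<^sup>2 + lamh1"
    and \<pi>: "\<pi> = (\<lambda>m l k. lim (\<lambda>n. measure M
                {\<omega> \<in> space M. min (N1 n \<omega>) (N2 n \<omega>) = m \<and>
                   int (N2 n \<omega>) - int (N1 n \<omega>) = l \<and> C n \<omega> = k}))"
    and "max \<rho>1 \<rho>2 < \<rho>" "\<rho> < 1"
    and "lamh0 > \<bar>lamh2 - lamh1 + \<rho>\<^sup>2 * (\<mu>h1 - \<mu>h2)\<bar>"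
  shows "(\<forall>m l k. convergent (\<lambda>n. measure M
             {\<omega> \<in> space M. min (N1 n \<omega>) (N2 n \<omega>) = m \<and>
                int (N2 n \<omega>) - int (N1 n \<omega>) = l \<and> C n \<omega> = k}))
       \<and> (\<exists>x0 x. x0 > 0
            \<and> (\<forall>l. x l =
                 (if l \<le> -1 then
                    (\<gamma>2 + lamh0 / 2) / \<gamma>2 * x0 * (\<rho> * (\<gamma>2 / (\<gamma>1 + lamh0))) ^ nat \<bar>l\<bar>
                  else if l = 0 then x0
                  else (\<gamma>1 + lamh0 / 2) / \<gamma>1 * x0 * (\<rho> * (\<gamma>1 / (\<gamma>2 + lamh0))) ^ nat l))
            \<and> (\<forall>l. (\<lambda>m. \<rho> powi (- 2 * int m) * \<pi> m l True) \<longlonglongrightarrow> x l)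
            \<and> (\<forall>l. (\<lambda>m. \<rho> powi (- 2 * int m) * \<pi> m l False)
                     \<longlonglongrightarrow> \<mu> / (lam + \<alpha>1 + \<alpha>2) * x l))"
proof -
  interpret gjsoq lam0 lam1 lam2 \<mu> \<alpha>1 \<alpha>2 lam
    by standard (use pos lam normalized in auto)
  have kernel_eq: "gjsoq_trans lam0 lam1 lam2 \<mu> \<alpha>1 \<alpha>2 = (\<lambda>x y. pmf (kernel x) y)"
    by (intro ext) (simp add: pmf_kernel)
  let ?F = "first_passage (\<lambda>x y. pmf (kernel x) y)" and ?o = "(0, 0, True) :: nat \<times> nat \<times> bool"
  have "(\<lambda>n. ?F n ?o ?o) sums 1" "summable (\<lambda>n. real n * ?F n ?o ?o)"
    using recurrent unfolding kernel_eq positive_recurrent_def by blast+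
  then obtain P where P: "bind_pmf P kernel = P" "\<And>s. pmf P s > 0"
    using stationary_pmf_exists[of kernel ?o] kernel_reach by blast
  interpret gjsoq_stationary lam0 lam1 lam2 \<mu> \<alpha>1 \<alpha>2 lam P
    by standard (use P in auto)
  obtain D0 where D0: "\<And>n s. measure M {\<omega> \<in> space M. (N1 n \<omega>, N2 n \<omega>, C n \<omega>) = s}
      = pmf (iterate_kernel kernel n D0) s"
    using markov_chain_law[OF chain[unfolded kernel_eq]] by blast
  \<comment> \<open>One of \<open>nat (- l)\<close> and \<open>nat l\<close> is 0, so
    \<open>m\<close> is the minimum and \<open>l\<close> the difference of the orbit
    lengths.\<close>
  define st where "st m l k = (m + nat (- l), m + nat l, k)" for m :: nat and l :: int and k :: bool
  have law: "measure M {\<omega> \<in> space M. min (N1 n \<omega>) (N2 n \<omega>) = m \<and>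
      int (N2 n \<omega>) - int (N1 n \<omega>) = l \<and> C n \<omega> = k} = pmf (iterate_kernel kernel n D0) (st m l k)" for n m l k
  proof -
    have "min (N1 n \<omega>) (N2 n \<omega>) = m \<and> int (N2 n \<omega>) - int (N1 n \<omega>) = l \<and> C n \<omega> = k
        \<longleftrightarrow> (N1 n \<omega>, N2 n \<omega>, C n \<omega>) = st m l k" for \<omega>
      by (auto simp: st_def)
    then show ?thesis by (simp add: D0)
  qed
  have lim: "(\<lambda>n. pmf (iterate_kernel kernel n D0) s) \<longlonglongrightarrow> pmf P s" for s
    by (rule iterate_kernel_tendsto[OF P(1,2) kernel_lazy kernel_reach])
  have \<pi>_eq: "\<pi> m l k = pmf P (st m l k)" for m l k
    unfolding \<pi> law by (rule limI[OF lim])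
  have Mh: "\<mu>h1 > 0" "\<mu>h2 > 0" using pos by (simp_all add: \<mu>h1 \<mu>h2)
  have \<rho>_eq: "\<rho> * (\<mu> * \<alpha>1 + \<mu> * \<alpha>2) = lam * D"
    using Mh by (simp add: \<rho> lamh D_def flip: \<mu>h1 \<mu>h2)
  have less: "lam1 * D < \<rho> * (\<mu> * \<alpha>1)" "lam2 * D < \<rho> * (\<mu> * \<alpha>2)"
    using \<open>max \<rho>1 \<rho>2 < \<rho>\<close> Mh unfolding \<rho>1 \<rho>2 by (simp_all add: pos_divide_less_eq lamh1 lamh2 D_def \<mu>h1 \<mu>h2)
  interpret gjsq_invariant "lam0 * D" "lam1 * D" "lam2 * D" "\<mu> * \<alpha>1" "\<mu> * \<alpha>2" M1' M2' \<rho> \<gamma>1 \<gamma>2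
    "\<lambda>i j. pmf P (i, j, True)"
  proof (rule busy_invariant[OF \<rho>_eq \<open>\<rho> < 1\<close> less])
    show "\<gamma>1 = \<mu> * \<alpha>1 * \<rho>\<^sup>2 + lam2 * D" "\<gamma>2 = \<mu> * \<alpha>2 * \<rho>\<^sup>2 + lam1 * D"
      by (simp_all add: \<gamma>1 \<gamma>2 \<mu>h1 \<mu>h2 lamh1 lamh2 D_def)
    \<comment> \<open>The last hypothesis bounds the distance of \<gamma>1 and \<gamma>2: the
      difference coordinate is pulled back towards 0 from both sides.\<close>
    have "lamh2 - lamh1 + \<rho>\<^sup>2 * (\<mu>h1 - \<mu>h2) = \<gamma>1 - \<gamma>2" by (simp add: \<gamma>1 \<gamma>2 algebra_simps)
    then have "\<bar>\<gamma>1 - \<gamma>2\<bar> < lam0 * D"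
      using \<open>lamh0 > \<bar>lamh2 - lamh1 + \<rho>\<^sup>2 * (\<mu>h1 - \<mu>h2)\<bar>\<close> by (simp add: lamh0 D_def)
    then show "\<gamma>1 < \<gamma>2 + lam0 * D" "\<gamma>2 < \<gamma>1 + lam0 * D" by linarith+
  qed
  obtain x0 where x0: "x0 > 0"
    "\<And>l. (\<lambda>m. pmf P (m, m + l, True) / \<rho> ^ (2 * m)) \<longlonglongrightarrow> x0 * \<rho> ^ l * eta (int l)"
    "\<And>l. (\<lambda>m. pmf P (m + l, m, True) / \<rho> ^ (2 * m)) \<longlonglongrightarrow> x0 * \<rho> ^ l * eta (- int l)"
    by (rule q_asymptotics) blast
  define x where "x l = x0 * \<rho> ^ nat \<bar>l\<bar> * eta l" for l
  have powi: "\<rho> powi (- 2 * int m) * a = a / \<rho> ^ (2 * m)" for m a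
  proof -
    have "- 2 * int m = - int (2 * m)" by simp
    then show ?thesis by (simp only: power_int_minus power_int_of_nat) (simp add: field_simps)
  qed
  have busy: "(\<lambda>m. \<rho> powi (- 2 * int m) * \<pi> m l True) \<longlonglongrightarrow> x l" for l
  proof (cases "l \<ge> 0")
    case True
    then show ?thesis using x0(2)[of "nat l"] unfolding powi \<pi>_eq st_def x_def by simp
  next
    case False
    then show ?thesis using x0(3)[of "nat (- l)"] unfolding powi \<pi>_eq st_def x_def by (simp add: abs_if)
  qed
  have idle: "(\<lambda>m. \<rho> powi (- 2 * int m) * \<pi> m l False) \<longlonglongrightarrow> \<mu> / (lam + \<alpha>1 + \<alpha>2) * x l" for l
  proof -
    \<comment> \<open>For \<open>m > 0\<close> both orbits are nonempty, and the factor in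
      \<open>idle_balance\<close> is \<open>D\<close>.\<close>
    have "\<forall>\<^sub>F m in sequentially. \<mu> / D * (\<rho> powi (- 2 * int m) * \<pi> m l True) = \<rho> powi (- 2 * int m) * \<pi> m l False"
      using eventually_gt_at_top[of 0]
    proof eventually_elim
      case (elim m)
      then have "D * \<pi> m l False = \<mu> * \<pi> m l True"
        using idle_balance[of "m + nat (- l)" "m + nat l"] by (simp add: \<pi>_eq st_def D_def)
      then show ?case using D_pos by (simp add: field_simps)
    qed
    with tendsto_mult_left[OF busy] show ?thesis
      unfolding D_def by (rule Lim_transform_eventually)
  qed
  have "x l = (if l \<le> -1 then
      (\<gamma>2 + lamh0 / 2) / \<gamma>2 * x0 * (\<rho> * (\<gamma>2 / (\<gamma>1 + lamh0))) ^ nat \<bar>l\<bar>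
    else if l = 0 then x0
    else (\<gamma>1 + lamh0 / 2) / \<gamma>1 * x0 * (\<rho> * (\<gamma>1 / (\<gamma>2 + lamh0))) ^ nat l)" for l
    unfolding x_def eta_def lamh0 D_def[symmetric] power_mult_distrib by auto
  then have "\<exists>x0 x. x0 > 0
      \<and> (\<forall>l. x l =
           (if l \<le> -1 then
              (\<gamma>2 + lamh0 / 2) / \<gamma>2 * x0 * (\<rho> * (\<gamma>2 / (\<gamma>1 + lamh0))) ^ nat \<bar>l\<bar>
            else if l = 0 then x0
            else (\<gamma>1 + lamh0 / 2) / \<gamma>1 * x0 * (\<rho> * (\<gamma>1 / (\<gamma>2 + lamh0))) ^ nat l))
      \<and> (\<forall>l. (\<lambda>m. \<rho> powi (- 2 * int m) * \<pi> m l True) \<longlonglongrightarrow> x l)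
      \<and> (\<forall>l. (\<lambda>m. \<rho> powi (- 2 * int m) * \<pi> m l False)
               \<longlonglongrightarrow> \<mu> / (lam + \<alpha>1 + \<alpha>2) * x l)"
    using x0(1) busy idle by (intro exI[of _ x0] exI[of _ x] conjI allI)
  moreover have "\<forall>m l k. convergent (\<lambda>n. measure M
      {\<omega> \<in> space M. min (N1 n \<omega>) (N2 n \<omega>) = m \<and> int (N2 n \<omega>) - int (N1 n \<omega>) = l \<and> C n \<omega> = k})"
    unfolding law using lim by (blast intro: convergentI)
  ultimately show ?thesis by blast
qed

end
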